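(* Let $m\ge 1$, let $(V_m,R_m)$ be the Yang-Baxter operator defined in the context, and let $M$ be any $V_m$-module. Let $C(M)$ be the one-term Yang-Baxter complex of $M$, let $C^f(M)$ be the finite complex with terms $M\otimes [V_m]_n$, $0\le n\le m$, and let $B(V_m)=\bigoplus_{n\ge 0}\ker\sigma_n$. Then: (1) The complex $C(M)$ is isomorphic to the tensor product $C^f(M)\otimes B(V_m)$, where $C^f(M)$ is a finite complex of length $m$ (concentrated in degrees $0,\dots,m$), and $B(V_m)$ is a graded vector space (regarded as a complex with zero differential) depending only on $(V_m,R_m)$. (2) The finite complex $C^f(M)$ is isomorphic to $M\otimes_{F(V_m)}K$, where $K$ is the Koszul resolution of the one-dimensional left $F(V_m)$-module $\mathbb{K}$ (on which each $v_i$ acts by $0$). (3) With multiplication given by concatenation of tensors, the graded vector space $B(V_m)$ is a free (associative, unital, non-commutative) $\mathbb{K}$-algebra freely generated by $b_i$ homogeneous elements of degree $i$ for $2\le i\le m+1$, where the integers $b_i$ are determined by $$1-\sum_{i=2}^{m+1}b_iq^i=(1-mq)(1+q)^m .$$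
   Context: Let $\mathbb{K}=\mathbb{C}(y)$, and let $V=V_m$ be the $\mathbb{K}$-vector space with basis $v_1,\dots,v_m$; tensor products are over $\mathbb{K}$ unless indicated. The operator $R=R_m:V\otimes V\to V\otimes V$ is the linear map with $R(v_i\otimes v_j)=(1-y^2)v_i\otimes v_j+y^2v_j\otimes v_i$ and $R(v_j\otimes v_i)=v_i\otimes v_j$ for $1\le i<j\le m$, and $R(v_i\otimes v_i)=v_i\otimes v_i$. It is a Yang-Baxter operator: it is invertible and $(R\otimes \mathrm{id})(\mathrm{id}\otimes R)(R\otimes\mathrm{id})=(\mathrm{id}\otimes R)(R\otimes\mathrm{id})(\mathrm{id}\otimes R)$ on $V^{\otimes 3}$. A $V_m$-module is a $\mathbb{K}$-vector space $M$ with a linear map $R_M:M\otimes V\to M$ satisfying the wall condition $R_M\circ(R_M\otimes\mathrm{id}_V)=R_M\circ(R_M\otimes\mathrm{id}_V)\circ(\mathrm{id}_M\otimes R)$. The algebra $F(V_m)$ is $T(V)/(\mathrm{im}(\mathrm{id}_{V^{\otimes 2}}-R))=\mathbb{K}[v_1,\dots,v_m]$, and a $V_m$-module is the same as a right $F(V_m)$-module, with $m\cdot v=R_M(m\otimes v)$. For $n\ge1$ let $d_1^n=\mathrm{id}_{V^{\otimes n}}$ and, for $2\le k\le n$, $d_k^n=(R\otimes\mathrm{id}_{V^{\otimes n-2}})\circ(\mathrm{id}_V\otimes R\otimes\mathrm{id}_{V^{\otimes n-3}})\circ\cdots\circ(\mathrm{id}_{V^{\otimes k-2}}\otimes R\otimes\mathrm{id}_{V^{\otimes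 n-k}})$ (the rightmost map is applied first). Let $\sigma_n=\sum_{k=1}^n(-1)^{k-1}d_k^n:V^{\otimes n}\to V^{\otimes n}$, and put $\ker\sigma_0=\mathbb{K}=V^{\otimes 0}$. The one-term Yang-Baxter complex $C(M)$ has terms $C_n=M\otimes V^{\otimes n}$ ($n\ge0$) and differential $\partial_n=\sum_{i=1}^n(-1)^{i-1}d_{i,n}:C_n\to C_{n-1}$, where $d_{i,n}=(R_M\otimes\mathrm{id}_{V^{\otimes n-1}})\circ(\mathrm{id}_M\otimes d_i^n)$. For $n\ge 1$, $[V]_n\subset V^{\otimes n}$ is the span of all elements $[v_{i_1},\dots,v_{i_n}]=\sum_{\tau\in S_n}\mathrm{sgn}(\tau)\,v_{i_{\tau(1)}}\otimes\cdots\otimes v_{i_{\tau(n)}}$, with $\mathrm{sgn}(\tau)\in\{1,-1\}$ the sign of $\tau$; $[V]_0=\mathbb{K}$; $[V]_n=0$ for $n>m$. The complex $C^f(M)$ has terms $M\otimes[V]_n$ in degree $n$, with differential the restriction of $\partial_n$. The graded vector space $B(V_m)=\bigoplus_{n\ge0}\ker\sigma_n$ has $\ker\sigma_n$ in degree $n$, and its multiplication is the restriction of that of the tensor algebra $T(V)$. *)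

theory Defs
  imports
    "HOL-Algebra.Free_Abelian_Groups"
    "HOL-Algebra.Generated_Groups"
    "HOL-Algebra.Module"
    "HOL-Computational_Algebra.Polynomial"
    "HOL-Computational_Algebra.Fraction_Field"
    "HOL-Combinatorics.Permutations"
    "HOL-Library.Function_Algebras"
begin

section \<open>The ground field and tensor powers\<close>

text \<open>The field of rational functions C(y).\<close>

type_synonym ratfun = "complex poly fract"

definition yvar :: ratfun where
  "yvar = Fract [:0, 1:] 1"

text \<open>
  The space V has basis v_1, ..., v_m, and a word [i_1, ..., i_n] stands for the basis vector
  v_{i_1} \<otimes> ... \<otimes> v_{i_n} of the n-th tensor power. For any vector space W, an element
  sum_w x_w \<otimes> v_w of W \<otimes> V^n is represented by its coordinate function w \<mapsto> x_w; taking for W the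
  ground field gives V^n itself. Functions are added pointwise.
\<close>

definition words :: "nat \<Rightarrow> nat \<Rightarrow> nat list set" where
  "words m n = {w. length w = n \<and> set w \<subseteq> {1..m}}"

definition tens :: "nat \<Rightarrow> nat \<Rightarrow> (nat list \<Rightarrow> 'x::zero) set" where
  "tens m n = {f. \<forall>w. f w \<noteq> 0 \<longrightarrow> w \<in> words m n}"

definition pure :: "'x::zero \<Rightarrow> 'i list \<Rightarrow> 'i list \<Rightarrow> 'x" where
  "pure x w = (\<lambda>u. if u = w then x else 0)"

definition pointwise :: "('r \<Rightarrow> 'x \<Rightarrow> 'x) \<Rightarrow> 'r \<Rightarrow> ('i \<Rightarrow> 'x) \<Rightarrow> 'i \<Rightarrow> 'x" where
  "pointwise s c f = (\<lambda>u. s c (f u))"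

text \<open>Multiplication of the tensor algebra: bilinear extension of the concatenation of words.\<close>

definition conc :: "('i list \<Rightarrow> ratfun) \<Rightarrow> ('i list \<Rightarrow> ratfun) \<Rightarrow> 'i list \<Rightarrow> ratfun" where
  "conc f g = (\<lambda>w. \<Sum>k\<le>length w. f (take k w) * g (drop k w))"

definition lin_ext ::
    "('i list \<Rightarrow> 'j list \<Rightarrow> ratfun) \<Rightarrow> ('i list \<Rightarrow> ratfun) \<Rightarrow> 'j list \<Rightarrow> ratfun" where
  "lin_ext \<phi> f = (\<lambda>u. \<Sum>w | f w \<noteq> 0. f w * \<phi> w u)"

text \<open>
  For a linear operator L on a tensor power of V, the operator id \<otimes> L on W \<otimes> V^n, where W has
  scalar multiplication \<open>s\<close>.
\<close>

definition id_tens ::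
    "(ratfun \<Rightarrow> 'x::ab_group_add \<Rightarrow> 'x) \<Rightarrow> ((nat list \<Rightarrow> ratfun) \<Rightarrow> (nat list \<Rightarrow> ratfun))
      \<Rightarrow> (nat list \<Rightarrow> 'x) \<Rightarrow> nat list \<Rightarrow> 'x" where
  "id_tens s L f = (\<lambda>u. \<Sum>w | f w \<noteq> 0. s (L (pure 1 w) u) (f w))"


section \<open>The Yang-Baxter operator and the maps built from it\<close>

fun R_basis :: "nat list \<Rightarrow> nat list \<Rightarrow> ratfun" where
  "R_basis [i, j] =
     (if i < j then (\<lambda>u. (1 - yvar\<^sup>2) * pure 1 [i, j] u + yvar\<^sup>2 * pure 1 [j, i] u)
      else pure 1 [j, i])"
| "R_basis _ = (\<lambda>_. 0)"

definition R_op :: "(nat list \<Rightarrow> ratfun) \<Rightarrow> nat list \<Rightarrow> ratfun" where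
  "R_op = lin_ext R_basis"

text \<open>
  The map id_{V^k} \<otimes> R \<otimes> id_{V^(n-k-2)}; the formula does not depend on n, and it is only meant
  for tensors of degree at least k + 2.
\<close>

definition R_at :: "nat \<Rightarrow> (nat list \<Rightarrow> ratfun) \<Rightarrow> nat list \<Rightarrow> ratfun" where
  "R_at k = lin_ext (\<lambda>w. conc (pure 1 (take k w))
      (conc (R_op (pure 1 [w ! k, w ! (k + 1)])) (pure 1 (drop (k + 2) w))))"

text \<open>\<open>d_op k\<close> is d_k^n = R_at 0 o R_at 1 o ... o R_at (k - 2), for every n \<ge> k.\<close>

definition d_op :: "nat \<Rightarrow> (nat list \<Rightarrow> ratfun) \<Rightarrow> nat list \<Rightarrow> ratfun" where
  "d_op k = foldr (\<circ>) (map R_at [0..<k - 1]) id"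

definition sigma :: "nat \<Rightarrow> (nat list \<Rightarrow> ratfun) \<Rightarrow> nat list \<Rightarrow> ratfun" where
  "sigma n f = (\<lambda>u. \<Sum>k = 1..n. (-1) ^ (k - 1) * d_op k f u)"

text \<open>For n = 0 the sum defining sigma is empty, so that the kernel is all of V^0, the ground field.\<close>

definition ker_sigma :: "nat \<Rightarrow> nat \<Rightarrow> (nat list \<Rightarrow> ratfun) set" where
  "ker_sigma m n = {f \<in> tens m n. sigma n f = 0}"


section \<open>Modules over the Yang-Baxter operator\<close>

text \<open>For R_M : M \<otimes> V \<rightarrow> M, the map R_M \<otimes> id from M \<otimes> V^n to M \<otimes> V^(n-1).\<close>

definition RM_id :: "((nat list \<Rightarrow> 'a::zero) \<Rightarrow> 'a) \<Rightarrow> (nat list \<Rightarrow> 'a) \<Rightarrow> nat list \<Rightarrow> 'a" where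
  "RM_id RM f = (\<lambda>u. RM (\<lambda>w. if length w = 1 then f (w @ u) else 0))"

locale yb_module = vector_space scale
  for scale :: "ratfun \<Rightarrow> 'a::ab_group_add \<Rightarrow> 'a" +
  fixes m :: nat and RM :: "(nat list \<Rightarrow> 'a) \<Rightarrow> 'a"
  assumes RM_add: "f \<in> tens m 1 \<Longrightarrow> g \<in> tens m 1 \<Longrightarrow> RM (f + g) = RM f + RM g"
    and RM_scale: "f \<in> tens m 1 \<Longrightarrow> RM (pointwise scale c f) = scale c (RM f)"
    and wall: "f \<in> tens m 2 \<Longrightarrow> RM (RM_id RM f) = RM (RM_id RM (id_tens scale R_op f))"


section \<open>Modules and tensor products\<close>

definition mk_module :: "('r \<Rightarrow> 'x \<Rightarrow> 'x) \<Rightarrow> 'x::ab_group_add set \<Rightarrow> ('r, 'x) module" where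
  "mk_module s S = \<lparr>carrier = S, monoid.mult = undefined, one = undefined,
     zero = 0, add = (+), module.smult = s\<rparr>"

text \<open>
  The tensor product of a right R-module A and a left R-module B, R commutative: the free abelian
  group on A \<times> B modulo the additivity and balancing relations. The multiplication fields of the
  module records carry no meaning.
\<close>

definition tensor_free ::
    "('r, 'a) module \<Rightarrow> ('r, 'b) module \<Rightarrow> ('a \<times> 'b \<Rightarrow>\<^sub>0 int) monoid" where
  "tensor_free A B = free_Abelian_group (carrier A \<times> carrier B)"

definition tensor_rel ::
    "'r ring \<Rightarrow> ('r, 'a) module \<Rightarrow> ('r, 'b) module \<Rightarrow> ('a \<times> 'b \<Rightarrow>\<^sub>0 int) set" where
  "tensor_rel R A B =
     {frag_of (a \<oplus>\<^bsub>A\<^esub> a', b) - frag_of (a, b) - frag_of (a', b) | a a' b.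
        a \<in> carrier A \<and> a' \<in> carrier A \<and> b \<in> carrier B} \<union>
     {frag_of (a, b \<oplus>\<^bsub>B\<^esub> b') - frag_of (a, b) - frag_of (a, b') | a b b'.
        a \<in> carrier A \<and> b \<in> carrier B \<and> b' \<in> carrier B} \<union>
     {frag_of (r \<odot>\<^bsub>A\<^esub> a, b) - frag_of (a, r \<odot>\<^bsub>B\<^esub> b) | r a b.
        r \<in> carrier R \<and> a \<in> carrier A \<and> b \<in> carrier B}"

definition tensor_sub ::
    "'r ring \<Rightarrow> ('r, 'a) module \<Rightarrow> ('r, 'b) module \<Rightarrow> ('a \<times> 'b \<Rightarrow>\<^sub>0 int) set" where
  "tensor_sub R A B = generate (tensor_free A B) (tensor_rel R A B)"

text \<open>
  The map f \<otimes> g from A \<otimes> B to A' \<otimes> B' induced by R-linear maps f and g: on a coset X it is the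
  common coset of the images of the members of X.
\<close>

definition tensor_map ::
    "'r ring \<Rightarrow> ('r, 'a) module \<Rightarrow> ('r, 'b) module \<Rightarrow> ('a \<Rightarrow> 'a) \<Rightarrow> ('b \<Rightarrow> 'b)
      \<Rightarrow> ('a \<times> 'b \<Rightarrow>\<^sub>0 int) set \<Rightarrow> ('a \<times> 'b \<Rightarrow>\<^sub>0 int) set" where
  "tensor_map R A' B' f g X =
     the_elem ((\<lambda>x. tensor_sub R A' B' #>\<^bsub>tensor_free A' B'\<^esub>
       frag_extend (\<lambda>(a, b). frag_of (f a, g b)) x) ` X)"

definition tensor ::
    "'r ring \<Rightarrow> ('r, 'a) module \<Rightarrow> ('r, 'b) module \<Rightarrow> ('r, ('a \<times> 'b \<Rightarrow>\<^sub>0 int) set) module" where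
  "tensor R A B = (let Q = tensor_free A B Mod tensor_sub R A B in
     \<lparr>carrier = carrier Q, monoid.mult = undefined, one = undefined,
      zero = \<one>\<^bsub>Q\<^esub>, add = (\<otimes>\<^bsub>Q\<^esub>),
      module.smult = (\<lambda>r. tensor_map R A B (\<lambda>a. r \<odot>\<^bsub>A\<^esub> a) (\<lambda>b. b))\<rparr>)"

definition dsum :: "nat set \<Rightarrow> (nat \<Rightarrow> ('r, 'x) module) \<Rightarrow> ('r, nat \<Rightarrow> 'x) module" where
  "dsum I A = \<lparr>carrier = (\<Pi>\<^sub>E p\<in>I. carrier (A p)), monoid.mult = undefined, one = undefined,
     zero = (\<lambda>p\<in>I. \<zero>\<^bsub>A p\<^esub>), add = (\<lambda>x y. \<lambda>p\<in>I. x p \<oplus>\<^bsub>A p\<^esub> y p),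
     module.smult = (\<lambda>r x. \<lambda>p\<in>I. r \<odot>\<^bsub>A p\<^esub> x p)\<rparr>"


section \<open>Complexes\<close>

definition KK :: "ratfun ring" where
  "KK = \<lparr>carrier = UNIV, monoid.mult = (*), one = 1, zero = 0, add = (+)\<rparr>"

definition linear_map :: "('r, 'x) module \<Rightarrow> ('r, 'z) module \<Rightarrow> 'r set \<Rightarrow> ('x \<Rightarrow> 'z) \<Rightarrow> bool" where
  "linear_map A B S f \<longleftrightarrow> f \<in> carrier A \<rightarrow> carrier B \<and>
     (\<forall>x\<in>carrier A. \<forall>x'\<in>carrier A. f (x \<oplus>\<^bsub>A\<^esub> x') = f x \<oplus>\<^bsub>B\<^esub> f x') \<and>
     (\<forall>c\<in>S. \<forall>x\<in>carrier A. f (c \<odot>\<^bsub>A\<^esub> x) = c \<odot>\<^bsub>B\<^esub> f x)"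

text \<open>
  A complex consists of its terms in degrees n \<ge> 0 and of its differentials; the n-th differential
  goes from degree n to degree n - 1 and is only used for n \<ge> 1.
\<close>

type_synonym 'x cplx = "(nat \<Rightarrow> (ratfun, 'x) module) \<times> (nat \<Rightarrow> 'x \<Rightarrow> 'x)"

definition is_cplx :: "'x cplx \<Rightarrow> bool" where
  "is_cplx X \<longleftrightarrow> (\<forall>n. Module.module KK (fst X n)) \<and>
     (\<forall>n. linear_map (fst X (Suc n)) (fst X n) UNIV (snd X (Suc n))) \<and>
     (\<forall>n. \<forall>x\<in>carrier (fst X (Suc (Suc n))).
        snd X (Suc n) (snd X (Suc (Suc n)) x) = \<zero>\<^bsub>fst X n\<^esub>)"

definition cplx_iso :: "'x cplx \<Rightarrow> 'z cplx \<Rightarrow> bool" where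
  "cplx_iso X Y \<longleftrightarrow> is_cplx X \<and> is_cplx Y \<and>
     (\<exists>\<phi>. (\<forall>n. linear_map (fst X n) (fst Y n) UNIV (\<phi> n) \<and>
                bij_betw (\<phi> n) (carrier (fst X n)) (carrier (fst Y n))) \<and>
          (\<forall>n. \<forall>x\<in>carrier (fst X (Suc n)).
                \<phi> n (snd X (Suc n) x) = snd Y (Suc n) (\<phi> (Suc n) x)))"

text \<open>The tensor product of a complex with a graded vector space having zero differential.\<close>

definition tensor_graded ::
    "'x cplx \<Rightarrow> (nat \<Rightarrow> (ratfun, 'b) module) \<Rightarrow> (nat \<Rightarrow> ('x \<times> 'b \<Rightarrow>\<^sub>0 int) set) cplx" where
  "tensor_graded X B =
     (\<lambda>N. dsum {..N} (\<lambda>p. tensor KK (fst X p) (B (N - p))),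
      \<lambda>N z. \<lambda>p\<in>{..N - 1}.
        tensor_map KK (fst X p) (B (N - 1 - p)) (snd X (Suc p)) (\<lambda>b. b) (z (Suc p)))"


section \<open>The one-term Yang-Baxter complex and its finite subcomplex\<close>

definition yb_diff ::
    "(ratfun \<Rightarrow> 'a::ab_group_add \<Rightarrow> 'a) \<Rightarrow> ((nat list \<Rightarrow> 'a) \<Rightarrow> 'a)
      \<Rightarrow> nat \<Rightarrow> (nat list \<Rightarrow> 'a) \<Rightarrow> nat list \<Rightarrow> 'a" where
  "yb_diff s RM n f =
     (\<lambda>u. \<Sum>i = 1..n. s ((-1) ^ (i - 1)) (RM_id RM (id_tens s (d_op i) f) u))"

definition yb_complex ::
    "nat \<Rightarrow> (ratfun \<Rightarrow> 'a::ab_group_add \<Rightarrow> 'a) \<Rightarrow> ((nat list \<Rightarrow> 'a) \<Rightarrow> 'a)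
      \<Rightarrow> (nat list \<Rightarrow> 'a) cplx" where
  "yb_complex m s RM = (\<lambda>n. mk_module (pointwise s) (tens m n), yb_diff s RM)"

text \<open>The element [v_{i_1}, ..., v_{i_n}] for the word is = [i_1, ..., i_n].\<close>

definition bracket :: "nat list \<Rightarrow> nat list \<Rightarrow> ratfun" where
  "bracket is = (\<lambda>u. \<Sum>\<tau> | \<tau> permutes {..<length is}. of_int (sign \<tau>) * pure 1 (permute_list \<tau> is) u)"

definition bracket_space :: "nat \<Rightarrow> nat \<Rightarrow> (nat list \<Rightarrow> ratfun) set" where
  "bracket_space m n = module.span (pointwise (*)) (bracket ` words m n)"

text \<open>M \<otimes> [V]_n, as a subspace of M \<otimes> V^n.\<close>

definition M_bracket ::
    "nat \<Rightarrow> (ratfun \<Rightarrow> 'a::ab_group_add \<Rightarrow> 'a) \<Rightarrow> nat \<Rightarrow> (nat list \<Rightarrow> 'a) set" where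
  "M_bracket m s n =
     module.span (pointwise s) {(\<lambda>u. s (a u) x) | x a. a \<in> bracket_space m n}"

definition finite_complex ::
    "nat \<Rightarrow> (ratfun \<Rightarrow> 'a::ab_group_add \<Rightarrow> 'a) \<Rightarrow> ((nat list \<Rightarrow> 'a) \<Rightarrow> 'a)
      \<Rightarrow> (nat list \<Rightarrow> 'a) cplx" where
  "finite_complex m s RM = (\<lambda>n. mk_module (pointwise s) (M_bracket m s n), yb_diff s RM)"


section \<open>The Koszul resolution over F(V) = K[v_1, ..., v_m]\<close>

type_synonym mpoly = "(nat \<Rightarrow>\<^sub>0 nat) \<Rightarrow>\<^sub>0 ratfun"

definition var :: "nat \<Rightarrow> mpoly" where
  "var i = Poly_Mapping.single (Poly_Mapping.single i 1) 1"

definition const_poly :: "ratfun \<Rightarrow> mpoly" where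
  "const_poly c = Poly_Mapping.single 0 c"

definition F_ring :: "nat \<Rightarrow> mpoly ring" where
  "F_ring m = \<lparr>carrier = {p. \<forall>t\<in>Poly_Mapping.keys p. Poly_Mapping.keys t \<subseteq> {1..m}},
     monoid.mult = (*), one = 1, zero = 0, add = (+)\<rparr>"

text \<open>
  The right action of F(V) on M determined by x v_j = R_M (x \<otimes> v_j): a monomial
  v_1^t_1 ... v_m^t_m first applies v_1, t_1 times, and so on.
\<close>

definition mono_act ::
    "nat \<Rightarrow> ((nat list \<Rightarrow> 'a::zero) \<Rightarrow> 'a) \<Rightarrow> (nat \<Rightarrow>\<^sub>0 nat) \<Rightarrow> 'a \<Rightarrow> 'a" where
  "mono_act m RM t =
     fold (\<lambda>j. (\<lambda>x. RM (pure x [j])) ^^ Poly_Mapping.lookup t j) [1..<m + 1]"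

definition poly_act ::
    "nat \<Rightarrow> (ratfun \<Rightarrow> 'a::ab_group_add \<Rightarrow> 'a) \<Rightarrow> ((nat list \<Rightarrow> 'a) \<Rightarrow> 'a) \<Rightarrow> mpoly \<Rightarrow> 'a \<Rightarrow> 'a" where
  "poly_act m s RM p x =
     (\<Sum>t\<in>Poly_Mapping.keys p. s (Poly_Mapping.lookup p t) (mono_act m RM t x))"

text \<open>
  K_n = F \<otimes> Lambda^n V is the free F-module on the n-element subsets S of {1..m}, where S stands
  for the exterior product of the v_i, i in S, in increasing order. The differential sends the
  basis element S to the sum over i in S of (-1)^{number of j in S with j < i} v_i (S - {i});
  \<open>koszul_diff\<close> gives the coefficient of T in the image.
\<close>

definition koszul_term :: "nat \<Rightarrow> nat \<Rightarrow> (mpoly, nat set \<Rightarrow> mpoly) module" where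
  "koszul_term m n = mk_module (pointwise (*))
     {k. (\<forall>S. k S \<in> carrier (F_ring m)) \<and> (\<forall>S. k S \<noteq> 0 \<longrightarrow> S \<subseteq> {1..m} \<and> card S = n)}"

definition koszul_diff :: "nat \<Rightarrow> (nat set \<Rightarrow> mpoly) \<Rightarrow> nat set \<Rightarrow> mpoly" where
  "koszul_diff m k =
     (\<lambda>T. \<Sum>i\<in>{1..m} - T. (-1) ^ card {j \<in> T. j < i} * var i * k (insert i T))"

definition restrict_scalars :: "(mpoly, 'x) module \<Rightarrow> (ratfun, 'x) module" where
  "restrict_scalars A = \<lparr>carrier = carrier A, monoid.mult = undefined, one = undefined,
     zero = \<zero>\<^bsub>A\<^esub>, add = (\<oplus>\<^bsub>A\<^esub>), module.smult = (\<lambda>c x. const_poly c \<odot>\<^bsub>A\<^esub> x)\<rparr>"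

definition M_tensor_koszul ::
    "nat \<Rightarrow> (ratfun \<Rightarrow> 'a::ab_group_add \<Rightarrow> 'a) \<Rightarrow> ((nat list \<Rightarrow> 'a) \<Rightarrow> 'a)
      \<Rightarrow> ('a \<times> (nat set \<Rightarrow> mpoly) \<Rightarrow>\<^sub>0 int) set cplx" where
  "M_tensor_koszul m s RM = (let MF = mk_module (poly_act m s RM) UNIV in
     (\<lambda>n. restrict_scalars (tensor (F_ring m) MF (koszul_term m n)),
      \<lambda>n. tensor_map (F_ring m) MF (koszul_term m (n - 1)) (\<lambda>x. x) (koszul_diff m)))"


section \<open>The algebra B(V) and free algebras\<close>

definition B_graded :: "nat \<Rightarrow> nat \<Rightarrow> (ratfun, nat list \<Rightarrow> ratfun) module" where
  "B_graded m n = mk_module (pointwise (*)) (ker_sigma m n)"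

text \<open>The direct sum of the spaces ker sigma_n, n \<ge> 0, inside the tensor algebra.\<close>

definition B_alg :: "nat \<Rightarrow> (nat list \<Rightarrow> ratfun) set" where
  "B_alg m = {f. finite {w. f w \<noteq> 0} \<and>
     (\<forall>n. (\<lambda>w. if length w = n then f w else 0) \<in> ker_sigma m n)}"

definition subalgebra_conc :: "('i list \<Rightarrow> ratfun) set \<Rightarrow> bool" where
  "subalgebra_conc A \<longleftrightarrow> module.subspace (pointwise (*)) A \<and> pure 1 [] \<in> A \<and>
     (\<forall>f\<in>A. \<forall>g\<in>A. conc f g \<in> A)"

text \<open>
  The free algebra on a set X consists of the finitely supported functions on words over X, with
  multiplication \<open>conc\<close>. \<open>eval_hom g\<close> is the unital algebra homomorphism into the tensor algebra
  that sends each generator x in X to \<open>g x\<close>.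
\<close>

definition free_alg :: "'x set \<Rightarrow> ('x list \<Rightarrow> ratfun) set" where
  "free_alg X = {p. finite {w. p w \<noteq> 0} \<and> (\<forall>w. p w \<noteq> 0 \<longrightarrow> set w \<subseteq> X)}"

definition eval_hom ::
    "('x \<Rightarrow> 'i list \<Rightarrow> ratfun) \<Rightarrow> ('x list \<Rightarrow> ratfun) \<Rightarrow> 'i list \<Rightarrow> ratfun" where
  "eval_hom g = lin_ext (\<lambda>w. foldr conc (map g w) (pure 1 []))"

definition freely_generated ::
    "('i list \<Rightarrow> ratfun) set \<Rightarrow> 'x set \<Rightarrow> ('x \<Rightarrow> 'i list \<Rightarrow> ratfun) \<Rightarrow> bool" where
  "freely_generated A X g \<longleftrightarrow>
     subalgebra_conc A \<and> g ` X \<subseteq> A \<and> bij_betw (eval_hom g) (free_alg X) A"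

end

theory Submission
  imports Defs
begin

text \<open>
  Put q = y^2 and T_k = - R_k, where R_k is R acting on the letters k and k + 1 (counted from 0).
  The T_k satisfy the braid relations and (T_k + 1) (T_k - q) = 0, and the operator sigma acting on
  the r letters from position k on is S_k = 1 + T_k + T_k T_{k+1} + ... + T_k ... T_{k+r-2}. The
  relation (T_k - q) S_{k+1} S_k = 0 shows that T_j Q_k = q Q_k for j + 1 < k, where
  Q_k = S_{k-1} ... S_1 S_0. Filtering M \<otimes> V^n by the kernels of the Q_k splits it as the direct sum
  over p of E_p, the set of all f with T_j f = q f for j + 1 < p and S_p f = 0. The first condition
  says that f is alternating in its first p letters and the second one that the remaining letters lie
  in the kernel of sigma, so E_p = M \<otimes> [V]_p \<otimes> ker sigma_{n-p}. On E_p the operator S_0 is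
  multiplication by the q-integer [p], which makes the differential act on the first factor only.
  Dividing by q-factorials turns the differential of the finite complex into that of the Koszul
  complex.

  For freeness, let I be the span of the products of brackets [A], A nonempty, with kernel elements,
  so that T(V) is the direct sum of the kernels and I. Every tensor of positive degree is a unique
  sum of products v_i [A] c with c in a kernel, and a bracket [B] expands into such terms with leading
  term v_i [A], where i = min B and A = B - {i}. Hence modulo I only the pairs (i, A) with i not
  below A survive, and the kernel components of the tensors v_i [A] for these pairs generate freely.
\<close>


section \<open>Hecke operators on functions on words\<close>

text \<open>Passing to T = - R removes every alternating sign: sigma and the differential become
  plain sums of products of the T_k, and the q-eigenvectors of T_j turn out to be antisymmetric with
  no trace of q, which is why [V]_n is spanned by ordinary signed sums. Splitting off the E_p
  requires dividing by the eigenvalues of the Q_k, which are products of q-integers; these do not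
  vanish, because at y = 1 they become products of positive integers. Freeness amounts to the
  statement that the part of B(V) of positive degree is a free right B(V)-module on the generators.
  The obstacle is that the products v_i [A] c do not lie in the kernels, so they are handled modulo
  I, for which stability under right multiplication by kernel elements is enough. The same picture
  explains the generating function: in a variable t the pairs (i, A) contribute m t (1 + t)^m, the
  discarded ones correspond to the nonempty subsets and contribute (1 + t)^m - 1, and 1 minus the
  difference is (1 - m t) (1 + t)^m.\<close>

definition qq :: ratfun where
  "qq = yvar\<^sup>2"

text \<open>The q-integer [n] = 1 + q + ... + q^(n - 1), in the recursive form that the eigenvalue
  computation \<open>hsum_eigenpart\<close> produces.\<close>

fun qint :: "nat \<Rightarrow> ratfun" where
  "qint 0 = 0"
| "qint (Suc n) = 1 + qq * qint n"

definition qfact :: "nat \<Rightarrow> ratfun" where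
  "qfact n = (\<Prod>i<n. qint (Suc i))"

text \<open>Setting y = 1 turns [n] into n, which is nonzero for n > 0 in characteristic 0. The
  polynomial representative makes the evaluation legitimate, since a rational function need not have
  a value at a point.\<close>

lemma qint_eq_Fract: "\<exists>p. qint n = Fract p 1 \<and> poly p 1 = of_nat n"
proof (induction n)
  case 0
  show ?case by (intro exI[of _ 0]) (simp add: Zero_fract_def)
next
  case (Suc n)
  then obtain p where "qint n = Fract p 1" "poly p 1 = of_nat n" by blast
  then show ?case
    by (intro exI[of _ "1 + [:0, 1:]\<^sup>2 * p"])
      (simp add: qq_def yvar_def power2_eq_square One_fract_def)
qed

lemma qint_nonzero: "qint (Suc n) \<noteq> 0"
proof
  assume eq: "qint (Suc n) = 0"
  obtain p where p: "qint (Suc n) = Fract p 1" "poly p 1 = of_nat (Suc n)"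
    using qint_eq_Fract[of "Suc n"] by blast
  have "p = 0" using p(1) eq by (simp add: Zero_fract_def eq_fract)
  then show False using p(2) by (simp del: of_nat_Suc)
qed

lemma qfact_nonzero: "qfact n \<noteq> 0"
  by (simp add: qfact_def qint_nonzero del: qint.simps)

lemma one_plus_qq_nonzero: "1 + qq \<noteq> 0"
  using qint_nonzero[of 1] by simp

lemma qq_nonzero: "qq \<noteq> 0"
  by (simp add: qq_def yvar_def Zero_fract_def eq_fract power2_eq_square)

text \<open>The operator T_k = - R_k, in terms of the coordinate function of a tensor.\<close>

fun hecke :: "(ratfun \<Rightarrow> 'a::ab_group_add \<Rightarrow> 'a) \<Rightarrow> nat \<Rightarrow> (nat list \<Rightarrow> 'a) \<Rightarrow> nat list \<Rightarrow> 'a" where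
  "hecke s 0 f (a # b # u) =
     (if a < b then s (qq - 1) (f (a # b # u)) - f (b # a # u)
      else if a = b then - f (a # b # u) else - s qq (f (b # a # u)))"
| "hecke s 0 f [a] = 0"
| "hecke s k f [] = 0"
| "hecke s (Suc k) f (a # u) = hecke s k (\<lambda>w. f (a # w)) u"

text \<open>
  The sum 1 + T_k + T_k T_{k+1} + ... with \<open>r\<close> terms, that is, sigma acting on the \<open>r\<close> letters from
  position \<open>k\<close> on.
\<close>

fun hsum ::
    "(ratfun \<Rightarrow> 'a::ab_group_add \<Rightarrow> 'a) \<Rightarrow> nat \<Rightarrow> nat \<Rightarrow> (nat list \<Rightarrow> 'a) \<Rightarrow> nat list \<Rightarrow> 'a" where
  "hsum s k 0 f = 0"
| "hsum s k (Suc r) f = f + hecke s k (hsum s (Suc k) r f)"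

lemma hsum_0: "hsum s k 0 f = 0" and hsum_Suc: "hsum s k (Suc r) f = f + hecke s k (hsum s (Suc k) r f)"
  by (simp_all add: fun_eq_iff)

declare hsum.simps [simp del]
declare hsum_0 [simp] hsum_Suc [simp]

section \<open>Tensors as functions on words\<close>

lemma tens_iff: "f \<in> tens m n \<longleftrightarrow> (\<forall>w. w \<notin> words m n \<longrightarrow> f w = 0)"
  by (auto simp: tens_def)

lemma tens_eq_0: "f \<in> tens m n \<Longrightarrow> u \<notin> words m n \<Longrightarrow> f u = 0"
  by (auto simp: tens_def)

lemma tens_length: "f \<in> tens m n \<Longrightarrow> length u \<noteq> n \<Longrightarrow> f u = 0"
  by (auto simp: tens_def words_def)

lemma Cons_words_iff: "a # u \<in> words m (Suc n) \<longleftrightarrow> a \<in> {1..m} \<and> u \<in> words m n"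
  by (auto simp: words_def)

lemma append_words_iff:
  "length u = p \<Longrightarrow> u @ v \<in> words m (p + r) \<longleftrightarrow> u \<in> words m p \<and> v \<in> words m r"
  by (auto simp: words_def)

lemma tens_slice: "f \<in> tens m (Suc n) \<Longrightarrow> (\<lambda>w. f (a # w)) \<in> tens m n"
  by (simp add: tens_iff Cons_words_iff)

lemma tens_slices: "f \<in> tens m (p + r) \<Longrightarrow> length u = p \<Longrightarrow> (\<lambda>w. f (u @ w)) \<in> tens m r"
  by (simp add: tens_iff append_words_iff)

lemma finite_words [simp]: "finite (words m n)"
  unfolding words_def using finite_lists_length_eq[of "{1..m}" n] by (simp add: conj_commute)

lemma tens_zero [simp]: "0 \<in> tens m n"
  by (simp add: tens_def)

lemma finite_support: "f \<in> tens m n \<Longrightarrow> finite {w. f w \<noteq> 0}"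
  by (rule finite_subset[OF _ finite_words[of m n]]) (auto simp: tens_def)

text \<open>Coefficients lie in an arbitrary space, so that M \<otimes> V^n and V^n are covered by
  the same statements; the interpretation \<open>K\<close> below is the case of scalars.\<close>

locale ratfun_space = vector_space scale
  for scale :: "ratfun \<Rightarrow> 'a::ab_group_add \<Rightarrow> 'a"
begin

notation scale (infixr "*s" 75)

abbreviation pscale :: "ratfun \<Rightarrow> (nat list \<Rightarrow> 'a) \<Rightarrow> nat list \<Rightarrow> 'a" (infixr "\<cdot>" 75) where
  "c \<cdot> f \<equiv> pointwise scale c f"

abbreviation T :: "nat \<Rightarrow> (nat list \<Rightarrow> 'a) \<Rightarrow> nat list \<Rightarrow> 'a" where
  "T \<equiv> hecke scale"

abbreviation S :: "nat \<Rightarrow> nat \<Rightarrow> (nat list \<Rightarrow> 'a) \<Rightarrow> nat list \<Rightarrow> 'a" where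
  "S \<equiv> hsum scale"

sublocale F: vector_space "pointwise scale :: ratfun \<Rightarrow> ('i \<Rightarrow> 'a) \<Rightarrow> 'i \<Rightarrow> 'a"
  by unfold_locales (auto simp: pointwise_def fun_eq_iff scale_right_distrib scale_left_distrib)

lemma tens_add: "f \<in> tens m n \<Longrightarrow> g \<in> tens m n \<Longrightarrow> (f + g :: nat list \<Rightarrow> 'a) \<in> tens m n"
  by (simp add: tens_iff)

lemma tens_scale: "f \<in> tens m n \<Longrightarrow> c \<cdot> f \<in> tens m n"
  by (simp add: tens_iff pointwise_def)

lemma tens_diff: "f \<in> tens m n \<Longrightarrow> g \<in> tens m n \<Longrightarrow> (f - g :: nat list \<Rightarrow> 'a) \<in> tens m n"
  by (simp add: tens_iff)

lemma tens_sum: "(\<And>i. i \<in> I \<Longrightarrow> f i \<in> tens m n) \<Longrightarrow> (\<Sum>i\<in>I. f i :: nat list \<Rightarrow> 'a) \<in> tens m n"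
  by (induction I rule: infinite_finite_induct) (auto intro: tens_add)

section \<open>Linearity of the T_k and the Hecke relations\<close>

lemma hecke_add: "T k (f + g) = T k f + T k g"
proof
  show "T k (f + g) u = (T k f + T k g) u" for u
  proof (induction k arbitrary: f g u)
    case 0
    show ?case by (cases u rule: remdups_adj.cases) (auto simp: scale_right_distrib)
  next
    case (Suc k)
    show ?case
    proof (cases u)
      case (Cons a v)
      then show ?thesis
        using Suc[of "\<lambda>w. f (a # w)" "\<lambda>w. g (a # w)" v] by (simp add: plus_fun_def)
    qed simp
  qed
qed

lemma hecke_scale: "T k (c \<cdot> f) = c \<cdot> T k f"
proof
  show "T k (c \<cdot> f) u = (c \<cdot> T k f) u" for u
  proof (induction k arbitrary: f u)
    case 0
    show ?case
      by (cases u rule: remdups_adj.cases)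
        (auto simp: pointwise_def scale_right_diff_distrib mult.commute)
  next
    case (Suc k)
    show ?case
    proof (cases u)
      case (Cons a v)
      then show ?thesis
        using Suc[of "\<lambda>w. f (a # w)" v] by (simp add: pointwise_def)
    qed (simp add: pointwise_def)
  qed
qed

lemma hecke_zero [simp]: "T k 0 = 0"
  using hecke_scale[of k 0 0] by simp

lemma hecke_diff: "T k (f - g) = T k f - T k g"
  using hecke_add[of k "f - g" g] by simp

lemma hecke_tens: "f \<in> tens m n \<Longrightarrow> T k f \<in> tens m n"
proof -
  have "T k f u = 0" if "f \<in> tens m n" "u \<notin> words m n" for u
    using that
  proof (induction k arbitrary: f n u)
    case 0
    show ?case
    proof (cases u rule: remdups_adj.cases)
      case (3 a b v)
      have "b # a # v \<notin> words m n" using 0(2) 3 by (auto simp: words_def)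
      then show ?thesis using 0 3 by (auto simp: tens_eq_0)
    qed simp_all
  next
    case (Suc k)
    show ?case
    proof (cases u)
      case (Cons a v)
      show ?thesis
      proof (cases "\<exists>n'. n = Suc n' \<and> a \<in> {1..m}")
        case True
        then obtain n' where n: "n = Suc n'" "a \<in> {1..m}" by blast
        show ?thesis using Suc.IH[of "\<lambda>w. f (a # w)" n' v] Suc.prems n Cons
          by (auto simp: tens_slice Cons_words_iff)
      next
        case False
        then have "(\<lambda>w. f (a # w)) = 0"
          using Suc.prems(1) by (cases n) (auto simp: fun_eq_iff tens_def words_def)
        then show ?thesis using Cons by simp
      qed
    qed simp
  qed
  then show "f \<in> tens m n \<Longrightarrow> T k f \<in> tens m n" unfolding tens_def by blast
qed

text \<open>Peeling off letters reduces to the first two, where (T + 1) (T - q) = 0 is checked for a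
  < b, a = b and a > b. The bound on \<open>k\<close> matters: on words too short for T_k the
  operator returns 0, while q f need not vanish.\<close>

lemma hecke_quadratic:
  assumes "f \<in> tens m n" "Suc k < n"
  shows "T k (T k f) = (qq - 1) \<cdot> T k f + qq \<cdot> f"
proof
  show "T k (T k f) u = ((qq - 1) \<cdot> T k f + qq \<cdot> f) u" for u
    using assms
  proof (induction k arbitrary: f n u)
    case 0
    show ?case
    proof (cases u rule: remdups_adj.cases)
      case (3 a b v)
      then show ?thesis
        by (cases a b rule: linorder_cases)
          (simp_all add: pointwise_def scale_right_diff_distrib scale_left_diff_distrib
            algebra_simps)
    qed (use 0 in \<open>auto simp: pointwise_def tens_length\<close>)
  next
    case (Suc k)
    then obtain n' where n: "n = Suc n'" by (cases n) auto
    show ?case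
    proof (cases u)
      case Nil
      then show ?thesis using Suc.prems by (simp add: pointwise_def tens_length)
    next
      case (Cons a v)
      then show ?thesis
        using Suc.IH[of "\<lambda>w. f (a # w)" n' v] Suc.prems n by (simp add: pointwise_def tens_slice)
    qed
  qed
qed

text \<open>Only the three letters from position k on are involved, and there the identity depends
  on nothing but their relative order. Words that are too short cause no trouble here: every term
  contains T_(k+1), which returns 0 on them.\<close>

lemma hecke_braid:
  assumes "f \<in> tens m n"
  shows "T k (T (Suc k) (T k f)) = T (Suc k) (T k (T (Suc k) f))"
proof
  show "T k (T (Suc k) (T k f)) u = T (Suc k) (T k (T (Suc k) f)) u" for u
    using assms
  proof (induction k arbitrary: f n u)
    case 0
    consider "length u < 3" | a b c v where "u = a # b # c # v"
      by (metis One_nat_def Suc_length_conv le_eq_less_or_eq linorder_not_less list.exhaust list.size(3) list.size(4) not_less_eq numeral_3_eq_3 zero_less_Suc)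
    then show ?case
    proof cases
      case 1
      then show ?thesis
        by (cases u rule: remdups_adj.cases) auto
    next
      case 2
      show ?thesis
        unfolding 2
        by (cases a b rule: linorder_cases; cases b c rule: linorder_cases;
            cases a c rule: linorder_cases)
          (simp_all add: scale_right_diff_distrib scale_left_diff_distrib algebra_simps)
    qed
  next
    case (Suc k)
    show ?case
    proof (cases u)
      case (Cons a v)
      show ?thesis
      proof (cases n)
        case 0
        \<comment> \<open>There is no smaller degree to descend to, but a tensor of degree 0 has no
          coordinate at a word beginning with \<open>a\<close>.\<close>
        then have f0: "(\<lambda>w. f (a # w)) = 0" using Suc.prems by (auto simp: fun_eq_iff tens_length)
        show ?thesis unfolding Cons hecke.simps by (subst (1 2) f0) simp
      next
        case (Suc n')
        then show ?thesis
          using Suc.IH[of "\<lambda>w. f (a # w)" n' v] Suc.prems Cons by (simp add: tens_slice)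
      qed
    qed simp
  qed
qed

text \<open>Peeling off the first k letters moves T_k to the front, where it forms a linear
  combination of the slices at a b and b a. The other operator acts behind these letters, so that
  only its linearity matters.\<close>

lemma hecke_far: "T k (T (Suc (Suc (k + j))) f) = T (Suc (Suc (k + j))) (T k f)"
proof
  show "T k (T (Suc (Suc (k + j))) f) u = T (Suc (Suc (k + j))) (T k f) u" for u
  proof (induction k arbitrary: f u)
    case 0
    show ?case
    proof (cases u rule: remdups_adj.cases)
      case (3 a b v)
      have 1: "T j (\<lambda>w. - f (x # y # w)) v = - T j (\<lambda>w. f (x # y # w)) v" for x y
        using hecke_scale[of j "-1" "\<lambda>w. f (x # y # w)"]
        by (simp add: fun_eq_iff pointwise_def)
      have 2: "T j (\<lambda>w. c *s f (x # y # w)) v = c *s T j (\<lambda>w. f (x # y # w)) v" for c x y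
        using hecke_scale[of j c "\<lambda>w. f (x # y # w)"]
        by (simp add: fun_eq_iff pointwise_def)
      have 3: "T j (\<lambda>w. g w - h w) v = T j g v - T j h v" for g h
        using hecke_diff[of j g h] by (simp add: fun_eq_iff fun_diff_def)
      have 4: "T j (\<lambda>w. - (c *s f (x # y # w))) v = - (c *s T j (\<lambda>w. f (x # y # w)) v)" for c x y
        using 2[of "- c"] by simp
      show ?thesis unfolding \<open>u = _\<close>
        by (cases a b rule: linorder_cases) (simp_all add: 1 2 3 4)
    qed simp_all
  next
    case (Suc k)
    show ?case
      by (cases u) (use Suc.IH in simp_all)
  qed
qed

section \<open>The sums S_k\<close>

lemma hsum_add: "S k r (f + g) = S k r f + S k r g"
  by (induction r arbitrary: k) (simp_all add: hecke_add)

lemma hsum_scale: "S k r (c \<cdot> f) = c \<cdot> S k r f"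
  by (induction r arbitrary: k) (simp_all add: hecke_scale F.scale_right_distrib)

lemma hsum_zero [simp]: "S k r 0 = 0"
  by (induction r arbitrary: k) simp_all

lemma hsum_sum: "S k r (\<Sum>i\<in>I. f i) = (\<Sum>i\<in>I. S k r (f i))"
proof (induction I rule: infinite_finite_induct)
  case (insert x I)
  have "S k r (f x + (\<Sum>i\<in>I. f i)) = S k r (f x) + (\<Sum>i\<in>I. S k r (f i))"
    by (simp only: hsum_add insert.IH)
  then show "S k r (\<Sum>i\<in>insert x I. f i) = (\<Sum>i\<in>insert x I. S k r (f i))"
    by (simp only: sum.insert[OF insert.hyps])
qed (simp_all only: sum.infinite sum.empty hsum_zero not_False_eq_True)

lemma hsum_tens: "f \<in> tens m n \<Longrightarrow> S k r f \<in> tens m n"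
  by (induction r arbitrary: k) (auto intro: tens_add hecke_tens)

lemma hecke_hsum_far: "T k (S (Suc (Suc (k + j))) r f) = S (Suc (Suc (k + j))) r (T k f)"
proof (induction r arbitrary: j)
  case (Suc r)
  show "T k (S (Suc (Suc (k + j))) (Suc r) f) = S (Suc (Suc (k + j))) (Suc r) (T k f)"
    using Suc[of "Suc j"] by (simp only: hsum_Suc hecke_add hecke_far add_Suc_right)
qed simp

text \<open>By induction on r. Write V = T_k, U = T_(k+1), B = S_(k+2) f and C = S_(k+2) U B, so
  that B + C = S_(k+2) S_(k+1) f. Since S_(k+2) commutes with V, S_(k+1) S_k f = (1 + V) f + (1 + V)
  U B + U V (B + C). The first two terms are q-eigenvectors of V by the quadratic relation. For the
  third, V U V = U V U meets U (B + C) = q (B + C), the induction hypothesis one position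
  further.\<close>

lemma hecke_hsum_hsum:
  assumes "f \<in> tens m (k + Suc r)"
  shows "T k (S (Suc k) r (S k (Suc r) f)) = qq \<cdot> S (Suc k) r (S k (Suc r) f)"
  using assms
proof (induction r arbitrary: k)
  case 0
  show "T k (S (Suc k) 0 (S k (Suc 0) f)) = qq \<cdot> S (Suc k) 0 (S k (Suc 0) f)" by simp
next
  case (Suc r)
  define B where "B = S (Suc (Suc k)) r f"
  have Bt: "B \<in> tens m (k + Suc (Suc r))" unfolding B_def using Suc.prems by (rule hsum_tens)
  have ft: "f \<in> tens m (k + Suc (Suc r))" using Suc.prems .
  define U where "U = T (Suc k)"
  define V where "V = T k"
  define C where "C = S (Suc (Suc k)) r (T (Suc k) B)"
  have Ct: "C \<in> tens m (k + Suc (Suc r))" unfolding C_def using Bt by (intro hsum_tens hecke_tens)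
  have "T (Suc k) (S (Suc (Suc k)) r (S (Suc k) (Suc r) f))
      = qq \<cdot> S (Suc (Suc k)) r (S (Suc k) (Suc r) f)"
    by (rule Suc.IH) (use Suc.prems in simp)
  then have IH: "U (B + C) = qq \<cdot> (B + C)"
    by (simp add: U_def B_def C_def hsum_add)
  have A: "S (Suc k) (Suc r) g = g + U (S (Suc (Suc k)) r g)" for g
    by (simp add: U_def)
  have far: "S (Suc (Suc k)) r (V g) = V (S (Suc (Suc k)) r g)" for g
    using hecke_hsum_far[of k 0 r g] by (simp add: V_def)
  have lin: "V (g + h) = V g + V h" "U (g + h) = U g + U h" "V (c \<cdot> g) = c \<cdot> V g"
    "U (c \<cdot> g) = c \<cdot> U g" for g h c
    by (simp_all add: U_def V_def hecke_add hecke_scale)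
  have quad: "V (V g) = (qq - 1) \<cdot> V g + qq \<cdot> g" if "g \<in> tens m (k + Suc (Suc r))" for g
    unfolding V_def using hecke_quadratic[OF that, of k] by simp
  have braid: "V (U (V g)) = U (V (U g))" if "g \<in> tens m (k + Suc (Suc r))" for g
    unfolding V_def U_def using hecke_braid[OF that] by simp
  have Vkill: "V (g + V g) = qq \<cdot> (g + V g)" if "g \<in> tens m (k + Suc (Suc r))" for g
    by (simp add: lin quad[OF that] F.scale_left_diff_distrib F.scale_right_distrib algebra_simps)
  have UBt: "U B \<in> tens m (k + Suc (Suc r))" unfolding U_def using Bt by (rule hecke_tens)
  define X where "X = S (Suc k) (Suc r) (S k (Suc (Suc r)) f)"
  have X: "X = (f + V f) + (U B + V (U B)) + U (V (B + C))"
  proof -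
    have "S k (Suc (Suc r)) f = f + V (f + U B)"
      by (simp add: V_def U_def B_def)
    then show ?thesis
      by (simp add: X_def A hsum_add far lin B_def[symmetric] C_def U_def[symmetric] algebra_simps)
  qed
  moreover have "V (U (V (B + C))) = qq \<cdot> U (V (B + C))"
    using braid[of "B + C"] tens_add[OF Bt Ct] by (simp add: IH lin(3,4))
  ultimately have "V X = qq \<cdot> X"
    using Vkill[OF ft] Vkill[OF UBt] by (simp only: lin F.scale_right_distrib)
  then show "T k (S (Suc k) (Suc r) (S k (Suc (Suc r)) f))
      = qq \<cdot> S (Suc k) (Suc r) (S k (Suc (Suc r)) f)"
    by (simp only: X_def V_def)
qed

end


section \<open>The decomposition of tensor powers\<close>

text \<open>The degree n is a parameter because S_k has to run over all n - k letters from position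
  k to the end.\<close>

fun hseq ::
    "(ratfun \<Rightarrow> 'a::ab_group_add \<Rightarrow> 'a) \<Rightarrow> nat \<Rightarrow> nat \<Rightarrow> (nat list \<Rightarrow> 'a) \<Rightarrow> nat list \<Rightarrow> 'a" where
  "hseq s n 0 f = f"
| "hseq s n (Suc k) f = hsum s k (n - k) (hseq s n k f)"

definition eigenpart ::
    "(ratfun \<Rightarrow> 'a::ab_group_add \<Rightarrow> 'a) \<Rightarrow> nat \<Rightarrow> nat \<Rightarrow> nat \<Rightarrow> (nat list \<Rightarrow> 'a) set" where
  "eigenpart s m n p = {f \<in> tens m n. (\<forall>j. Suc j < p \<longrightarrow> hecke s j f = pointwise s qq f) \<and>
     hsum s p (n - p) f = 0}"

lemma two_nonzero: "(2 :: ratfun) \<noteq> 0"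
  unfolding one_add_one[symmetric] One_fract_def by (simp add: Zero_fract_def eq_fract)

context ratfun_space
begin

abbreviation Q :: "nat \<Rightarrow> nat \<Rightarrow> (nat list \<Rightarrow> 'a) \<Rightarrow> nat list \<Rightarrow> 'a" where
  "Q \<equiv> hseq scale"

abbreviation E :: "nat \<Rightarrow> nat \<Rightarrow> nat \<Rightarrow> (nat list \<Rightarrow> 'a) set" where
  "E \<equiv> eigenpart scale"

lemma hseq_tens: "f \<in> tens m n \<Longrightarrow> Q n' k f \<in> tens m n"
  by (induction k) (simp_all add: hsum_tens)

lemma hseq_add: "Q n k (f + g) = Q n k f + Q n k g"
proof (induction k)
  case (Suc k)
  show "Q n (Suc k) (f + g) = Q n (Suc k) f + Q n (Suc k) g"
    by (simp only: hseq.simps Suc hsum_add)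
qed simp

lemma hseq_scale: "Q n k (c \<cdot> f) = c \<cdot> Q n k f"
proof (induction k)
  case (Suc k)
  show "Q n (Suc k) (c \<cdot> f) = c \<cdot> Q n (Suc k) f"
    by (simp only: hseq.simps Suc hsum_scale)
qed simp

lemma hseq_zero [simp]: "Q n k 0 = 0"
  using hseq_scale[of n k 0 0] by simp

lemma hseq_diff: "Q n k (f - g) = Q n k f - Q n k g"
  using hseq_add[of n k "f - g" g] by simp

lemma hseq_sum: "Q n k (\<Sum>i\<in>I. f i) = (\<Sum>i\<in>I. Q n k (f i))"
proof (induction I rule: infinite_finite_induct)
  case (insert x I)
  have "Q n k (f x + (\<Sum>i\<in>I. f i)) = Q n k (f x) + (\<Sum>i\<in>I. Q n k (f i))"
    by (simp only: hseq_add insert.IH)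
  then show "Q n k (\<Sum>i\<in>insert x I. f i) = (\<Sum>i\<in>insert x I. Q n k (f i))"
    by (simp only: sum.insert[OF insert.hyps])
qed (simp_all only: sum.infinite sum.empty hseq_zero not_False_eq_True)

text \<open>The factor S_(j+1), applied after S_j, produces the eigenvalue by
  \<open>hecke_hsum_hsum\<close>; every later factor S_k has k at least j + 2 and commutes with
  T_j.\<close>

lemma hecke_hseq:
  assumes "f \<in> tens m n" "k \<le> n" "Suc j < k"
  shows "T j (Q n k f) = qq \<cdot> Q n k f"
  using assms(2,3)
proof (induction k)
  case (Suc k)
  consider "k = Suc j" | i where "k = Suc (Suc (j + i))"
  proof (cases "k = Suc j")
    case False
    then have "k = Suc (Suc (j + (k - Suc (Suc j))))" using Suc.prems by simp
    then show ?thesis using that(2) by blast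
  qed (use that in blast)
  then show "T j (Q n (Suc k) f) = qq \<cdot> Q n (Suc k) f"
  proof cases
    case 1
    define g where "g = Q n j f"
    have n: "n - j = Suc (n - Suc j)" using Suc.prems 1 by simp
    have "g \<in> tens m (j + Suc (n - Suc j))"
      using hseq_tens[OF assms(1), of n j] n Suc.prems 1 by (simp add: g_def)
    then have "T j (S (Suc j) (n - Suc j) (S j (Suc (n - Suc j)) g))
        = qq \<cdot> S (Suc j) (n - Suc j) (S j (Suc (n - Suc j)) g)"
      by (rule hecke_hsum_hsum)
    then show ?thesis by (simp only: 1 hseq.simps n g_def)
  next
    case 2
    have "T j (Q n k f) = qq \<cdot> Q n k f" using Suc 2 by simp
    then show ?thesis
      using hecke_hsum_far[of j i "n - k" "Q n k f"]
      by (simp only: 2 hseq.simps hsum_scale)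
  qed
qed simp

text \<open>Descend from S_p f = 0: each step applies T_j, which multiplies by q, and then adds f,
  matching [i + 1] = 1 + q [i].\<close>

lemma hsum_eigenpart:
  assumes "f \<in> E m n p" "p \<le> n" "j \<le> p"
  shows "S j (n - j) f = qint (p - j) \<cdot> f"
  using assms(3)
proof (induction j rule: inc_induct)
  case base
  show ?case using assms(1) by (simp add: eigenpart_def)
next
  case (step j)
  have n: "n - j = Suc (n - Suc j)" and p: "p - j = Suc (p - Suc j)"
    using step.hyps assms(2) by simp_all
  have "T j (qint (p - Suc j) \<cdot> f) = (qq * qint (p - Suc j)) \<cdot> f"
  proof (cases "Suc j < p")
    case True
    then have "T j f = qq \<cdot> f" using assms(1) by (simp add: eigenpart_def)
    then show ?thesis by (simp add: hecke_scale mult.commute)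
  next
    \<comment> \<open>For j = p - 1 nothing is known about T_j f, but here the operator is applied
      to [0] f = 0.\<close>
    case False
    then have "p - Suc j = 0" using step.hyps by simp
    then show ?thesis by (simp only: qint.simps F.scale_zero_left hecke_zero mult_zero_right)
  qed
  then show "S j (n - j) f = qint (p - j) \<cdot> f"
    by (simp only: n p hsum_Suc step.IH qint.simps F.scale_left_distrib F.scale_one)
qed

text \<open>The scalar [p] [p - 1] ... [p - k + 1] by which Q_k acts on E_p.\<close>

definition pfact :: "nat \<Rightarrow> nat \<Rightarrow> ratfun" where
  "pfact p k = (\<Prod>i<k. qint (p - i))"

lemma pfact_nonzero:
  assumes "k \<le> p"
  shows "pfact p k \<noteq> 0"
proof -
  have "qint (p - i) \<noteq> 0" if "i < k" for i
    using that assms qint_nonzero[of "p - Suc i"] by (simp add: Suc_diff_Suc)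
  then show ?thesis by (simp add: pfact_def)
qed

lemma hseq_eigenpart:
  assumes "f \<in> E m n p" "p \<le> n"
  shows "k \<le> p \<Longrightarrow> Q n k f = pfact p k \<cdot> f"
proof (induction k)
  case 0
  show ?case by (simp add: pfact_def)
next
  case (Suc k)
  have "S k (n - k) f = qint (p - k) \<cdot> f" using hsum_eigenpart[OF assms, of k] Suc.prems by simp
  moreover have "Q n k f = pfact p k \<cdot> f" using Suc by simp
  ultimately show "Q n (Suc k) f = pfact p (Suc k) \<cdot> f"
    by (simp add: hsum_scale pfact_def mult.commute)
qed

lemma hseq_eigenpart_0:
  assumes "f \<in> E m n p" "p \<le> n" "p < k"
  shows "Q n k f = 0"
proof -
  have "Q n (Suc p) f = 0"
    using hseq_eigenpart[OF assms(1,2), of p] assms(1) by (simp add: hsum_scale eigenpart_def)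
  moreover have "Q n (Suc p) f = 0 \<Longrightarrow> Q n (Suc p + i) f = 0" for i
    by (induction i) auto
  ultimately show ?thesis using assms(3) by (metis less_iff_Suc_add add_Suc)
qed

lemma eigenpart_scale: "f \<in> E m n p \<Longrightarrow> c \<cdot> f \<in> E m n p"
  by (auto simp: eigenpart_def tens_scale hecke_scale hsum_scale mult.commute)

text \<open>If Q_(k+1) f = 0, then Q_k f lies in E_k: \<open>hecke_hseq\<close> gives the
  eigenvalues and Q_(k+1) = S_k Q_k the vanishing. As Q_k acts on E_k by a nonzero scalar, a
  multiple h of Q_k f satisfies Q_k h = Q_k f, and the induction hypothesis applies to f -
  h.\<close>

lemma hseq_zero_decompose:
  "f \<in> tens m n \<Longrightarrow> k \<le> Suc n \<Longrightarrow> Q n k f = 0 \<Longrightarrow>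
    \<exists>y. (\<forall>p<k. y p \<in> E m n p) \<and> f = (\<Sum>p<k. y p)"
proof (induction k arbitrary: f)
  case 0
  then show ?case by (auto simp: zero_fun_def)
next
  case (Suc k)
  define h where "h = inverse (pfact k k) \<cdot> Q n k f"
  have "Q n (Suc k) f = 0" by (rule Suc.prems(3))
  then have Qf: "S k (n - k) (Q n k f) = 0" by (simp only: hseq.simps)
  have "Q n k f \<in> E m n k"
    unfolding eigenpart_def using hseq_tens[OF Suc.prems(1), of n k] Qf
      hecke_hseq[OF Suc.prems(1), of k] Suc.prems(2) by auto
  then have hE: "h \<in> E m n k" unfolding h_def by (rule eigenpart_scale)
  have "Q n k h = pfact k k \<cdot> h" by (rule hseq_eigenpart[OF hE]) (use Suc.prems in auto)
  then have "Q n k h = Q n k f" by (simp add: h_def pfact_nonzero)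
  then have "Q n k (f - h) = 0" by (simp only: hseq_diff diff_self)
  moreover have "f - h \<in> tens m n" using Suc.prems(1) hE by (simp add: tens_diff eigenpart_def)
  ultimately obtain y where y: "\<forall>p<k. y p \<in> E m n p" "f - h = (\<Sum>p<k. y p)"
    by (metis (no_types) Suc.IH Suc.prems(2) Suc_leD)
  have "f = (f - h) + h" by simp
  also have "\<dots> = (\<Sum>p<Suc k. (y(k := h)) p)"
    unfolding y(2) by simp
  finally show ?case using y(1) hE by (intro exI[of _ "y(k := h)"]) auto
qed

theorem eigenpart_decompose:
  assumes "f \<in> tens m n"
  shows "\<exists>y. (\<forall>p\<le>n. y p \<in> E m n p) \<and> f = (\<Sum>p\<le>n. y p)"
proof -
  \<comment> \<open>S_n has n - n = 0 terms and is therefore 0, so the last step of the filtration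
    is the whole space.\<close>
  have "Q n (Suc n) f = 0" by simp
  then show ?thesis
    using hseq_zero_decompose[OF assms, of "Suc n"] by (simp add: lessThan_Suc_atMost less_Suc_eq_le)
qed

text \<open>From the largest index downwards: Q_p kills E_p' for p' < p and is a nonzero scalar on
  E_p, so applying it to the sum isolates y_p.\<close>

theorem eigenpart_independent:
  assumes "\<forall>p\<le>n. y p \<in> E m n p" "(\<Sum>p\<le>n. y p) = 0" "p \<le> n"
  shows "y p = 0"
  using assms(3)
proof (induction "n - p" arbitrary: p rule: less_induct)
  case less
  have "Q n p (y p') = (if p' = p then pfact p p \<cdot> y p else 0)" if "p' \<le> n" for p'
  proof (cases p' p rule: linorder_cases)
    case greater
    then have "y p' = 0" using less.hyps[of p'] that less.prems by simp
    then have "Q n p (y p') = 0" by (simp only: hseq_zero)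
    then show ?thesis using greater by simp
  next
    case less': less
    have "Q n p (y p') = 0" by (rule hseq_eigenpart_0[of _ m n p']) (use assms(1) that less' in auto)
    then show ?thesis using less' by simp
  qed (use assms(1) less.prems hseq_eigenpart[of "y p" m n p p] in auto)
  then have "(\<Sum>p'\<le>n. Q n p (y p')) = (\<Sum>p'\<le>n. if p' = p then pfact p p \<cdot> y p else 0)"
    by (intro sum.cong) auto
  then have "pfact p p \<cdot> y p = 0"
    using arg_cong[OF assms(2), of "Q n p"] less.prems by (simp add: hseq_sum)
  then show "y p = 0" using pfact_nonzero[of p p] F.scale_eq_0_iff by blast
qed

section \<open>Eigenvectors of T_j and antisymmetry\<close>

lemma add_self_eq_0: "x + x = 0 \<Longrightarrow> x = (0::'a)"
proof -
  assume "x + x = 0"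
  then have "2 *s x = 0" using scale_left_distrib[of 1 1 x] by simp
  then show "x = 0" by (simp add: scale_eq_0_iff two_nonzero)
qed

lemma eq_neg_self: "x = - x \<Longrightarrow> x = (0::'a)"
  using add_self_eq_0[of x] by (simp add: eq_neg_iff_add_eq_0)

lemma hecke_append: "T (length u + k) f (u @ w) = T k (\<lambda>x. f (u @ x)) w" for u :: "nat list"
  by (induction u arbitrary: f) simp_all

lemma hsum_append: "S (length u + k) r f (u @ w) = S k r (\<lambda>x. f (u @ x)) w" for u :: "nat list"
proof (induction r arbitrary: k w)
  case (Suc r)
  have *: "(\<lambda>x. S (Suc (length u + k)) r f (u @ x)) = S (Suc k) r (\<lambda>x. f (u @ x))"
    using Suc[of "Suc k"] by auto
  show "S (length u + k) (Suc r) f (u @ w) = S k (Suc r) (\<lambda>x. f (u @ x)) w"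
    by (simp add: hecke_append *)
qed simp

text \<open>For a < b the eigenvalue equation reads (q - 1) f(ab) - f(ba) = q f(ab), in which q
  cancels. For a = b it reads - f(aa) = q f(aa), which forces f(aa) = 0 because 1 + q is
  nonzero.\<close>

lemma hecke_eigen_iff:
  fixes f :: "nat list \<Rightarrow> 'a"
  assumes "f \<in> tens m n" "Suc j < n"
  shows "T j f = qq \<cdot> f \<longleftrightarrow>
    (\<forall>u a b v. length u = j \<longrightarrow> f (u @ a # b # v) = - f (u @ b # a # v))"
proof
  assume eq: "T j f = qq \<cdot> f"
  show "\<forall>u a b v. length u = j \<longrightarrow> f (u @ a # b # v) = - f (u @ b # a # v)"
  proof (intro allI impI)
    fix u v :: "nat list" and a b assume u: "length u = j"
    have ev: "T 0 (\<lambda>x. f (u @ x)) (a # b # v) = qq *s f (u @ a # b # v)" for a b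
      using fun_cong[OF eq, of "u @ a # b # v"] hecke_append[of u 0 f "a # b # v"] u
      by (simp add: pointwise_def)
    have lt: "f (u @ a # b # v) = - f (u @ b # a # v)" if "a < b" for a b
      using ev[of a b] that by (simp add: scale_left_diff_distrib algebra_simps eq_neg_iff_add_eq_0)
    show "f (u @ a # b # v) = - f (u @ b # a # v)"
    proof (cases a b rule: linorder_cases)
      case equal
      have "(1 + qq) *s f (u @ a # a # v) = 0"
        using ev[of a a] by (simp add: scale_left_distrib neg_eq_iff_add_eq_0)
      then show ?thesis using equal one_plus_qq_nonzero by simp
    qed (use lt[of a b] lt[of b a] in auto)
  qed
next
  assume asym: "\<forall>u a b v. length u = j \<longrightarrow> f (u @ a # b # v) = - f (u @ b # a # v)"
  show "T j f = qq \<cdot> f"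
  proof
    fix w
    show "T j f w = (qq \<cdot> f) w"
    proof (cases "length w = n")
      case True
      define u where "u = take j w"
      have "w = u @ (w ! j) # (w ! Suc j) # drop (Suc (Suc j)) w"
        using assms(2) True by (simp add: u_def id_take_nth_drop[symmetric] Cons_nth_drop_Suc)
      then obtain a b v where w: "w = u @ a # b # v" by blast
      have u: "length u = j" using assms(2) True by (simp add: u_def)
      have sw: "f (u @ x # y # v) = - f (u @ y # x # v)" for x y using asym u by blast
      have "T j f w = T 0 (\<lambda>x. f (u @ x)) (a # b # v)"
        using hecke_append[of u 0 f "a # b # v"] u w by simp
      also have "\<dots> = qq *s f (u @ a # b # v)"
      proof (cases a b rule: linorder_cases)
        case less
        then show ?thesis using sw[of b a] by (simp add: scale_left_diff_distrib)
      next
        case equal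
        have "f (u @ a # a # v) = 0" using sw[of a a] by (rule eq_neg_self)
        then show ?thesis using equal by simp
      next
        case greater
        then show ?thesis using sw[of a b] by simp
      qed
      finally show ?thesis by (simp add: pointwise_def w)
    next
      case False
      then show ?thesis
        using tens_length[OF assms(1)] tens_length[OF hecke_tens[OF assms(1)]]
        by (simp add: pointwise_def)
    qed
  qed
qed

end


section \<open>Alternating tensors\<close>

text \<open>Exchanges of neighbours are what the single operators T_j detect, and they generate all
  permutations.\<close>

definition alternating :: "('i list \<Rightarrow> 'a::ab_group_add) \<Rightarrow> bool" where
  "alternating f \<longleftrightarrow> (\<forall>u a b v. f (u @ a # b # v) = - f (u @ b # a # v))"

definition alt_tens :: "nat \<Rightarrow> nat \<Rightarrow> (nat list \<Rightarrow> 'a::ab_group_add) set" where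
  "alt_tens m n = {f \<in> tens m n. alternating f}"

text \<open>Read as increasing words, these sets index a basis of [V]_n.\<close>

definition nsubsets :: "nat \<Rightarrow> nat \<Rightarrow> nat set set" where
  "nsubsets m n = {A. A \<subseteq> {1..m} \<and> card A = n}"

abbreviation sl :: "nat set \<Rightarrow> nat list" where
  "sl \<equiv> sorted_list_of_set"

lemma finite_nsubsets [simp]: "finite (nsubsets m n)"
  by (rule finite_subset[of _ "Pow {1..m}"]) (auto simp: nsubsets_def)

lemma nsubsets_finite: "A \<in> nsubsets m n \<Longrightarrow> finite A"
  using finite_subset[of A "{1..m}"] by (simp add: nsubsets_def)

lemma sl_words: "A \<in> nsubsets m n \<Longrightarrow> sl A \<in> words m n"
  using nsubsets_finite[of A m n] by (auto simp: nsubsets_def words_def)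

lemma alternatingI: "(\<And>u a b v. f (u @ a # b # v) = - f (u @ b # a # v)) \<Longrightarrow> alternating f"
  unfolding alternating_def by blast

lemma alternatingD: "alternating f \<Longrightarrow> f (u @ a # b # v) = - f (u @ b # a # v)"
  unfolding alternating_def by (elim allE) assumption

lemma alternating_slice: "alternating f \<Longrightarrow> alternating (\<lambda>w. f (u @ w))"
proof (rule alternatingI)
  fix p v a b
  assume "alternating f"
  from alternatingD[OF this, of "u @ p" a b v]
  show "f (u @ p @ a # b # v) = - f (u @ p @ b # a # v)" by (simp only: append_assoc)
qed

lemma alternating_slice_Cons: "alternating f \<Longrightarrow> alternating (\<lambda>w. f (x # w))"
  using alternating_slice[of f "[x]"] by simp

lemma alternating_swap_hd: "alternating f \<Longrightarrow> f (a # b # v) = - f (b # a # v)"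
  using alternatingD[of f "[]" a b v] by (simp only: append_Nil)

text \<open>The sign is left open, which suffices for arguments about vanishing;
  \<open>alternating_insort\<close> records it.\<close>

lemma alternating_insort_pm:
  "alternating f \<Longrightarrow> f (a # xs) = f (insort a xs) \<or> f (a # xs) = - f (insort a xs)"
proof (induction xs arbitrary: f)
  case (Cons x xs)
  show ?case
    using Cons.IH[OF alternating_slice_Cons[OF Cons.prems, of x]]
      alternating_swap_hd[OF Cons.prems, of a x xs] by auto
qed simp

lemma alternating_sort_pm: "alternating f \<Longrightarrow> f u = f (sort u) \<or> f u = - f (sort u)"
proof (induction u arbitrary: f)
  case (Cons a u)
  show ?case
    using Cons.IH[OF alternating_slice_Cons[OF Cons.prems, of a]]
      alternating_insort_pm[OF Cons.prems, of a "sort u"] by auto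
qed simp

lemma sorted_not_distinct_decomp:
  "sorted xs \<Longrightarrow> \<not> distinct xs \<Longrightarrow> \<exists>u a v. xs = u @ a # a # v" for xs :: "'b::linorder list"
proof (induction xs)
  case (Cons x xs)
  show ?case
  proof (cases "x \<in> set xs")
    case True
    then obtain y ys where xs: "xs = y # ys" by (cases xs) auto
    then have "x = y" using Cons.prems True by force
    then show ?thesis using xs by (metis append_Nil)
  next
    case False
    then obtain u a v where "xs = u @ a # a # v" using Cons by auto
    then show ?thesis by (metis append_Cons)
  qed
qed simp

lemma sl_set: "sorted xs \<Longrightarrow> distinct xs \<Longrightarrow> sl (set xs) = xs"
  by (rule sorted_list_of_set.idem_if_sorted_distinct)

lemma alt_tensD: "f \<in> alt_tens m n \<Longrightarrow> alternating f" "f \<in> alt_tens m n \<Longrightarrow> f \<in> tens m n"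
  by (simp_all add: alt_tens_def)

lemma sum_fun_apply: "(\<Sum>i\<in>I. f i) x = (\<Sum>i\<in>I. f i x :: 'b::comm_monoid_add)"
  by (induction I rule: infinite_finite_induct) simp_all

section \<open>Brackets of words\<close>

lemma permute_list_transpose:
  "permute_list (transpose (length u) (Suc (length u))) (u @ a # b # v) = u @ b # a # v"
proof (rule nth_equalityI)
  fix i assume i: "i < length (permute_list (transpose (length u) (Suc (length u))) (u @ a # b # v))"
  then have eq: "permute_list (transpose (length u) (Suc (length u))) (u @ a # b # v) ! i
      = (u @ a # b # v) ! transpose (length u) (Suc (length u)) i"
    by (intro permute_list_nth permutes_swap_id) auto
  consider "i < length u" | "i = length u" | "i = Suc (length u)" | j where "i = Suc (Suc (length u + j))"
  proof (cases "i \<le> Suc (length u)")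
    case True
    then show ?thesis using that(1-3) by linarith
  next
    case False
    then have "i = Suc (Suc (length u + (i - Suc (Suc (length u)))))" by simp
    then show ?thesis using that(4) by blast
  qed
  then show "permute_list (transpose (length u) (Suc (length u))) (u @ a # b # v) ! i
      = (u @ b # a # v) ! i"
  proof cases
    case 1
    then have "transpose (length u) (Suc (length u)) i = i" by (intro transpose_apply_other) auto
    then show ?thesis unfolding eq using 1 by (simp add: nth_append)
  next
    case (4 j)
    then have "transpose (length u) (Suc (length u)) i = i" by (intro transpose_apply_other) auto
    then show ?thesis unfolding eq using 4 by (simp add: nth_append)
  qed (unfold eq, simp_all add: nth_append)
qed (simp only: length_permute_list length_append list.size)

text \<open>Composing every permutation with the transposition of the two positions permutes the
  summands, exchanges the two letters of the word and flips each sign.\<close>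

lemma bracket_alternating: "alternating (bracket is)"
  unfolding alternating_def
proof (intro allI)
  fix u v :: "nat list" and a b
  let ?u = "u @ a # b # v" and ?u' = "u @ b # a # v"
  let ?n = "length is"
  let ?t = "transpose (length u) (Suc (length u))"
  show "bracket is ?u = - bracket is ?u'"
  proof (cases "length ?u = ?n")
    case False
    then have "pure 1 (permute_list \<tau> is) ?u = (0::ratfun)"
      "pure 1 (permute_list \<tau> is) ?u' = (0::ratfun)" for \<tau>
      by (auto simp: pure_def dest!: arg_cong[where f = length])
    then show ?thesis by (simp add: bracket_def)
  next
    case True
    have t: "?t permutes {..<?n}" using True by (intro permutes_swap_id) auto
    have perm: "permute_list ?t ?u = ?u'" "permute_list ?t ?u' = ?u"
      by (rule permute_list_transpose)+
    have key: "of_int (sign (\<tau> \<circ> ?t)) * pure 1 (permute_list (\<tau> \<circ> ?t) is) ?u'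
        = - (of_int (sign \<tau>) * pure 1 (permute_list \<tau> is) ?u :: ratfun)"
      if "\<tau> permutes {..<?n}" for \<tau>
    proof -
      have "permute_list (\<tau> \<circ> ?t) is = permute_list ?t (permute_list \<tau> is)"
        by (rule permute_list_compose[OF t])
      \<comment> \<open>The transposition is an involution, so it can be moved to the other side of
        the equation between words.\<close>
      then have "?u' = permute_list (\<tau> \<circ> ?t) is \<longleftrightarrow> ?u = permute_list \<tau> is"
      proof -
        have "permute_list ?t (permute_list ?t w) = w" if "length w = ?n" for w
        proof -
          have "permute_list (?t \<circ> ?t) w = permute_list ?t (permute_list ?t w)"
            using permute_list_compose[of ?t w ?t] t that by simp
          then show ?thesis by (simp add: o_def)
        qed
        then show ?thesis
          using perm \<open>permute_list (\<tau> \<circ> ?t) is = _\<close> by (metis length_permute_list)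
      qed
      moreover have "sign (\<tau> \<circ> ?t) = - sign \<tau>"
        using that t by (subst sign_compose)
          (auto simp: sign_swap_id permutation_permutes intro!: exI[of _ "{..<?n}"])
      ultimately show ?thesis by (simp add: pure_def)
    qed
    have "bracket is ?u' = (\<Sum>\<tau> | \<tau> permutes {..<?n}.
        of_int (sign (\<tau> \<circ> ?t)) * pure 1 (permute_list (\<tau> \<circ> ?t) is) ?u')"
      unfolding bracket_def by (rule sum_permutations_compose_right[OF t])
    also have "\<dots> = - bracket is ?u"
      unfolding bracket_def sum_negf[symmetric] by (rule sum.cong) (use key in auto)
    finally show ?thesis by simp
  qed
qed

lemma bracket_alt_tens: "is \<in> words m n \<Longrightarrow> bracket is \<in> alt_tens m n"
proof -
  assume w: "is \<in> words m n"
  have "bracket is u = 0" if "u \<notin> words m n" for u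
    unfolding bracket_def
  proof (rule sum.neutral, rule ballI)
    fix \<tau> assume "\<tau> \<in> {\<tau>. \<tau> permutes {..<length is}}"
    then have "set (permute_list \<tau> is) = set is" by simp
    then have "permute_list \<tau> is \<in> words m n" using w by (simp add: words_def)
    then show "of_int (sign \<tau>) * pure 1 (permute_list \<tau> is) u = (0::ratfun)"
      using that by (auto simp: pure_def)
  qed
  then show ?thesis by (simp add: alt_tens_def tens_iff bracket_alternating)
qed

text \<open>The letters are distinct, so only the identity permutation leaves the sorted word
  sorted. Thus evaluation at increasing words is dual to the brackets of increasing words.\<close>

lemma bracket_sl:
  assumes "finite A" "finite B"
  shows "bracket (sl A) (sl B) = (if A = B then 1 else 0)"
proof -
  have "of_int (sign \<tau>) * pure 1 (permute_list \<tau> (sl A)) (sl B)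
      = (if \<tau> = id then (if A = B then 1 else 0) else (0::ratfun))"
    if "\<tau> permutes {..<length (sl A)}" for \<tau>
  proof (cases "sl B = permute_list \<tau> (sl A)")
    case True
    then have AB: "B = A"
      using set_permute_list[OF that] assms by (metis set_sorted_list_of_set)
    have "\<tau> i = i" for i
    proof (cases "i < length (sl A)")
      case True
      have "sl A ! \<tau> i = sl A ! i"
        using \<open>sl B = _\<close> AB permute_list_nth[OF that True] by simp
      moreover have "\<tau> i < length (sl A)" using that True by (metis lessThan_iff permutes_in_image)
      ultimately show ?thesis
        using True nth_eq_iff_index_eq[OF distinct_sorted_list_of_set] by blast
    next
      case False
      then show ?thesis using that by (meson lessThan_iff permutes_not_in)
    qed
    then have "\<tau> = id" by auto
    then show ?thesis using AB by (simp add: pure_def)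
  next
    case False
    then show ?thesis by (auto simp: pure_def)
  qed
  then have "bracket (sl A) (sl B) = (\<Sum>\<tau> | \<tau> permutes {..<length (sl A)}.
      (if \<tau> = id then (if A = B then 1 else 0) else (0::ratfun)))"
    unfolding bracket_def by (intro sum.cong) auto
  also have "\<dots> = (if A = B then 1 else 0)"
    by (subst sum.delta) (auto simp: finite_permutations permutes_id)
  finally show ?thesis .
qed

context ratfun_space
begin

lemma alternating_eq: "alternating f \<Longrightarrow> f (u @ a # a # v) = (0::'a)"
  using alternatingD[of f u a a v] by (rule eq_neg_self)

text \<open>Each smaller letter that is passed contributes a sign; this count becomes the sign of
  the Koszul differential.\<close>

lemma alternating_insort:
  "alternating f \<Longrightarrow> sorted xs \<Longrightarrow> distinct xs \<Longrightarrow> i \<notin> set xs \<Longrightarrow>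
    (f (i # xs) :: 'a) = (-1) ^ card {j \<in> set xs. j < i} *s f (insort i xs)"
proof (induction xs arbitrary: f)
  case (Cons x xs)
  show ?case
  proof (cases "i \<le> x")
    case True
    then have none: "{j \<in> set (x # xs). j < i} = {}" using Cons.prems by auto
    show ?thesis unfolding none using True by simp
  next
    case False
    then have "{j \<in> set (x # xs). j < i} = insert x {j \<in> set xs. j < i}" by auto
    then have c: "card {j \<in> set (x # xs). j < i} = Suc (card {j \<in> set xs. j < i})"
      using Cons.prems by simp
    show ?thesis
      using Cons.IH[OF alternating_slice_Cons[OF Cons.prems(1), of x]] Cons.prems False
        alternating_swap_hd[OF Cons.prems(1), of i x xs]
      unfolding c by simp
  qed
qed simp

text \<open>If u repeats a letter, its sorted form has two equal neighbours and f vanishes there;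
  otherwise the sorted form is covered by the assumption. For a word with repeated letters the
  assumption is vacuous, because no distinct word has both its length and its letters.\<close>

lemma alternating_vanish:
  assumes "alternating f" "\<And>xs. length xs = length u \<Longrightarrow> set xs = set u \<Longrightarrow> sorted xs \<Longrightarrow> distinct xs \<Longrightarrow> f xs = 0"
  shows "f u = (0::'a)"
proof -
  have "f (sort u) = 0"
  proof (cases "distinct u")
    case True
    then show ?thesis by (intro assms(2)) auto
  next
    case False
    then obtain p a v where "sort u = p @ a # a # v"
      using sorted_not_distinct_decomp[of "sort u"] by auto
    then show ?thesis using alternating_eq[OF assms(1)] by simp
  qed
  then show ?thesis using alternating_sort_pm[OF assms(1), of u] by auto
qed

lemma alternating_add: "alternating f \<Longrightarrow> alternating g \<Longrightarrow> alternating (f + g :: 'i list \<Rightarrow> 'a)"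
proof (rule alternatingI)
  fix u v :: "'i list" and a b
  assume "alternating f" "alternating g"
  from this[THEN alternatingD, of u a b v]
  show "(f + g) (u @ a # b # v) = - (f + g) (u @ b # a # v)" unfolding plus_fun_apply by simp
qed

lemma alternating_scale: "alternating f \<Longrightarrow> alternating (pointwise scale c f :: 'i list \<Rightarrow> 'a)"
proof (rule alternatingI)
  fix u v :: "'i list" and a b
  assume "alternating f"
  from this[THEN alternatingD, of u a b v]
  show "pointwise scale c f (u @ a # b # v) = - pointwise scale c f (u @ b # a # v)"
    unfolding pointwise_def by simp
qed

lemma alt_tens_add: "f \<in> alt_tens m n \<Longrightarrow> g \<in> alt_tens m n \<Longrightarrow> (f + g :: nat list \<Rightarrow> 'a) \<in> alt_tens m n"
  by (simp add: alt_tens_def tens_add alternating_add)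

lemma alt_tens_scale: "f \<in> alt_tens m n \<Longrightarrow> c \<cdot> f \<in> alt_tens m n"
  by (simp add: alt_tens_def tens_scale alternating_scale)

lemma alt_tens_zero: "(0 :: nat list \<Rightarrow> 'a) \<in> alt_tens m n"
  by (simp add: alt_tens_def alternating_def)

lemma alt_tens_diff: "f \<in> alt_tens m n \<Longrightarrow> g \<in> alt_tens m n \<Longrightarrow> (f - g :: nat list \<Rightarrow> 'a) \<in> alt_tens m n"
  using alt_tens_add[of f m n "(-1) \<cdot> g"] alt_tens_scale[of g m n "-1"]
  by (simp only: F.scale_minus_left F.scale_one add_uminus_conv_diff)

lemma alt_tens_sum: "(\<And>i. i \<in> I \<Longrightarrow> f i \<in> alt_tens m n) \<Longrightarrow> (\<Sum>i\<in>I. f i :: nat list \<Rightarrow> 'a) \<in> alt_tens m n"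
  by (induction I rule: infinite_finite_induct) (auto intro: alt_tens_add alt_tens_zero)

lemma subspace_alt_tens: "F.subspace (alt_tens m n :: (nat list \<Rightarrow> 'a) set)"
  by (simp add: F.subspace_def alt_tens_add alt_tens_scale alt_tens_zero)

lemma alt_tens_eq_0:
  assumes "f \<in> alt_tens m n" "\<And>A. A \<in> nsubsets m n \<Longrightarrow> f (sl A) = 0"
  shows "f = (0 :: nat list \<Rightarrow> 'a)"
proof
  fix u
  have "f xs = 0" if "sorted xs" "distinct xs" for xs
  proof (cases "xs \<in> words m n")
    case True
    then have "set xs \<in> nsubsets m n"
      using that by (auto simp: nsubsets_def words_def distinct_card)
    then show ?thesis using assms(2)[of "set xs"] that by (simp add: sl_set)
  next
    case False
    then show ?thesis using assms(1) by (auto simp: alt_tens_def tens_eq_0)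
  qed
  then show "f u = 0 u"
    using alternating_vanish[OF alt_tensD(1)[OF assms(1)], of u] by simp
qed

lemma alt_tens_eqI:
  assumes "f \<in> alt_tens m n" "g \<in> alt_tens m n" "\<And>A. A \<in> nsubsets m n \<Longrightarrow> f (sl A) = g (sl A)"
  shows "f = (g :: nat list \<Rightarrow> 'a)"
proof -
  have "f - g = 0" by (rule alt_tens_eq_0[of _ m n]) (use assms in \<open>auto simp: alt_tens_diff\<close>)
  then show ?thesis by simp
qed

lemma bracket_smult_alt_tens:
  assumes "h \<in> alt_tens m n"
  shows "(\<lambda>u. h u *s x) \<in> alt_tens m n"
proof -
  have "alternating (\<lambda>u. h u *s x)"
  proof (rule alternatingI)
    fix u v a b
    show "h (u @ a # b # v) *s x = - (h (u @ b # a # v) *s x)"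
      using alternatingD[OF alt_tensD(1)[OF assms], of u a b v] by simp
  qed
  then show ?thesis using assms by (simp add: alt_tens_def tens_iff)
qed

lemma bracket_expansion_alt_tens:
  "(\<lambda>u. \<Sum>A\<in>nsubsets m n. bracket (sl A) u *s x A) \<in> alt_tens m n"
proof -
  have "(\<lambda>u. \<Sum>A\<in>nsubsets m n. bracket (sl A) u *s x A)
      = (\<Sum>A\<in>nsubsets m n. (\<lambda>u. bracket (sl A) u *s x A))"
    by (simp add: fun_eq_iff sum_fun_apply)
  then show ?thesis
    by (simp add: alt_tens_sum bracket_smult_alt_tens bracket_alt_tens sl_words)
qed

lemma bracket_expansion_sl:
  assumes "B \<in> nsubsets m n"
  shows "(\<Sum>A\<in>nsubsets m n. bracket (sl A) (sl B) *s x A) = x B"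
proof -
  have "(\<Sum>A\<in>nsubsets m n. bracket (sl A) (sl B) *s x A)
      = (\<Sum>A\<in>nsubsets m n. if A = B then x A else 0)"
    using assms by (intro sum.cong refl) (simp add: bracket_sl nsubsets_finite)
  then show ?thesis using assms by simp
qed

lemma alt_tens_expand:
  assumes "f \<in> alt_tens m n"
  shows "f u = (\<Sum>A\<in>nsubsets m n. bracket (sl A) u *s f (sl A))"
proof -
  have "f = (\<lambda>u. \<Sum>A\<in>nsubsets m n. bracket (sl A) u *s f (sl A))"
    by (rule alt_tens_eqI[OF assms bracket_expansion_alt_tens]) (simp add: bracket_expansion_sl)
  then show ?thesis by (rule fun_cong)
qed

end

interpretation K: ratfun_space "(*) :: ratfun \<Rightarrow> ratfun \<Rightarrow> ratfun"
  by unfold_locales (simp_all add: algebra_simps)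

text \<open>Replaces generators by equations, the form in which the eigenvalue conditions of E_p
  describe [V]_p. The coefficients of the expansion are the values at increasing words.\<close>

lemma bracket_space_eq: "bracket_space m n = alt_tens m n"
proof
  show "bracket_space m n \<subseteq> alt_tens m n"
    unfolding bracket_space_def
    by (rule K.F.span_minimal) (auto simp: bracket_alt_tens K.subspace_alt_tens)
  show "alt_tens m n \<subseteq> bracket_space m n"
  proof
    fix f :: "nat list \<Rightarrow> ratfun" assume f: "f \<in> alt_tens m n"
    have "f = (\<Sum>A\<in>nsubsets m n. pointwise (*) (f (sl A)) (bracket (sl A)))"
    proof
      show "f u = (\<Sum>A\<in>nsubsets m n. pointwise (*) (f (sl A)) (bracket (sl A))) u" for u
        by (rule trans[OF K.alt_tens_expand[OF f]]) (simp add: sum_fun_apply pointwise_def mult.commute)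
    qed
    also have "\<dots> \<in> bracket_space m n"
      unfolding bracket_space_def
      by (intro K.F.span_sum K.F.span_scale K.F.span_base) (auto simp: sl_words)
    finally show "f \<in> bracket_space m n" .
  qed
qed

context ratfun_space
begin

lemma M_bracket_eq: "M_bracket m scale n = alt_tens m n"
proof
  show "M_bracket m scale n \<subseteq> alt_tens m n"
    unfolding M_bracket_def bracket_space_eq
    by (rule F.span_minimal) (auto simp: bracket_smult_alt_tens subspace_alt_tens)
  show "alt_tens m n \<subseteq> M_bracket m scale n"
  proof
    fix f :: "nat list \<Rightarrow> 'a" assume f: "f \<in> alt_tens m n"
    have "f = (\<Sum>A\<in>nsubsets m n. (\<lambda>u. bracket (sl A) u *s f (sl A)))"
    proof
      show "f u = (\<Sum>A\<in>nsubsets m n. (\<lambda>u. bracket (sl A) u *s f (sl A))) u" for u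
        by (rule trans[OF alt_tens_expand[OF f]]) (simp add: sum_fun_apply)
    qed
    also have "\<dots> \<in> M_bracket m scale n"
      unfolding M_bracket_def bracket_space_eq
      by (intro F.span_sum F.span_base CollectI)
        (blast intro: bracket_alt_tens sl_words)
    finally show "f \<in> M_bracket m scale n" .
  qed
qed

lemma alt_tens_trivial:
  assumes "m < n"
  shows "alt_tens m n = {0 :: nat list \<Rightarrow> 'a}"
proof -
  have le: "card A \<le> m" if "A \<subseteq> {1..m}" for A
    using card_mono[OF _ that] by simp
  have none: "A \<notin> nsubsets m n" for A
  proof
    assume "A \<in> nsubsets m n"
    then have "A \<subseteq> {1..m}" "card A = n" by (simp_all only: nsubsets_def mem_Collect_eq simp_thms)
    then show False using le[of A] assms by linarith
  qed
  show ?thesis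
  proof (intro equalityI subsetI)
    fix f :: "nat list \<Rightarrow> 'a" assume "f \<in> alt_tens m n"
    then have "f = 0" by (rule alt_tens_eq_0) (use none in simp)
    then show "f \<in> {0}" by (simp only: singleton_iff)
  next
    fix f :: "nat list \<Rightarrow> 'a" assume "f \<in> {0}"
    then show "f \<in> alt_tens m n" by (simp only: singleton_iff alt_tens_zero)
  qed
qed

text \<open>In degree n the T_j with j + 1 < n reach every pair of neighbours, and at words of
  another length both sides of the antisymmetry are 0.\<close>

lemma alt_tens_hecke:
  assumes "f \<in> tens m n"
  shows "f \<in> alt_tens m n \<longleftrightarrow> (\<forall>j. Suc j < n \<longrightarrow> T j f = qq \<cdot> f)"
proof
  assume "f \<in> alt_tens m n"
  then have asym: "f (u @ a # b # v) = - f (u @ b # a # v)" for u v a b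
    by (rule alternatingD[OF alt_tensD(1)])
  show "\<forall>j. Suc j < n \<longrightarrow> T j f = qq \<cdot> f"
    by (intro allI impI, subst hecke_eigen_iff[OF assms], assumption) (intro allI impI asym)
next
  assume eig: "\<forall>j. Suc j < n \<longrightarrow> T j f = qq \<cdot> f"
  have "f (u @ a # b # v) = - f (u @ b # a # v)" for u a b v
  proof (cases "Suc (length u) < n")
    case True
    then show ?thesis using eig hecke_eigen_iff[OF assms True] by blast
  next
    case False
    then show ?thesis using tens_length[OF assms] by simp
  qed
  then have "alternating f" by (rule alternatingI)
  then show "f \<in> alt_tens m n" using assms by (simp only: alt_tens_def mem_Collect_eq simp_thms)
qed

end


section \<open>Tensor products of modules\<close>

text \<open>
  Unlike \<open>frag_extend\<close>, this extends a map into an arbitrary abelian group, not only into a free one.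
\<close>

definition frag_lift :: "('p \<Rightarrow> 'n::ab_group_add) \<Rightarrow> ('p \<Rightarrow>\<^sub>0 int) \<Rightarrow> 'n" where
  "frag_lift \<beta> = (SOME h. (\<forall>x y. h (x + y) = h x + h y) \<and> (\<forall>p. h (frag_of p) = \<beta> p))"

text \<open>The universal property of free abelian groups, with the additive group of the type of
  values repackaged as a monoid record.\<close>

lemma frag_lift_exists:
  fixes \<beta> :: "'p \<Rightarrow> 'n::ab_group_add"
  shows "\<exists>h. (\<forall>x y. h (x + y) = h x + h y) \<and> (\<forall>p. h (frag_of p) = \<beta> p)"
proof -
  let ?G = "\<lparr>carrier = UNIV :: 'n set, monoid.mult = (+), one = 0\<rparr>"
  have "comm_group ?G"
  proof (rule comm_groupI)
    show "\<And>x. x \<in> carrier ?G \<Longrightarrow> \<exists>y\<in>carrier ?G. y \<otimes>\<^bsub>?G\<^esub> x = \<one>\<^bsub>?G\<^esub>"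
      by (auto intro: exI[of _ "- _"] left_minus)
  qed (auto simp: ac_simps)
  then interpret G: comm_group ?G .
  obtain h where h: "h \<in> hom (free_Abelian_group (UNIV :: 'p set)) ?G"
    and hf: "\<And>p. p \<in> UNIV \<Longrightarrow> h (frag_of p) = \<beta> p"
    using G.free_Abelian_group_universal[of \<beta> UNIV] by auto
  have "h (x + y) = h x + h y" for x y
    using h hom_mult[OF h, of x y] by simp
  then show ?thesis using hf by blast
qed

lemma
  shows frag_lift_add: "frag_lift \<beta> (x + y) = frag_lift \<beta> x + frag_lift \<beta> y"
    and frag_lift_of [simp]: "frag_lift \<beta> (frag_of p) = \<beta> p"
proof -
  have "(\<forall>x y. frag_lift \<beta> (x + y) = frag_lift \<beta> x + frag_lift \<beta> y) \<and>
      (\<forall>p. frag_lift \<beta> (frag_of p) = \<beta> p)"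
    unfolding frag_lift_def by (rule someI_ex[OF frag_lift_exists])
  then show "frag_lift \<beta> (x + y) = frag_lift \<beta> x + frag_lift \<beta> y"
    and "frag_lift \<beta> (frag_of p) = \<beta> p" by blast+
qed

lemma frag_lift_0 [simp]: "frag_lift \<beta> 0 = 0"
  using frag_lift_add[of \<beta> 0 0] by simp

lemma frag_lift_minus: "frag_lift \<beta> (- x) = - frag_lift \<beta> x"
  using frag_lift_add[of \<beta> x "- x"] by (simp add: eq_neg_iff_add_eq_0 add.commute)

lemma frag_lift_diff: "frag_lift \<beta> (x - y) = frag_lift \<beta> x - frag_lift \<beta> y"
  using frag_lift_add[of \<beta> x "- y"] by (simp add: frag_lift_minus)

lemma frag_lift_sum: "frag_lift \<beta> (\<Sum>i\<in>I. f i) = (\<Sum>i\<in>I. frag_lift \<beta> (f i))"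
  by (induction I rule: infinite_finite_induct) (simp_all add: frag_lift_add)

abbreviation "flift \<beta> \<equiv> frag_lift (case_prod \<beta>)"

text \<open>The map out of the tensor product induced by \<open>\<beta>\<close>: all members of the
  coset X have one common image once \<open>\<beta>\<close> is balanced.\<close>

definition tlift :: "('a \<Rightarrow> 'b \<Rightarrow> 'n::ab_group_add) \<Rightarrow> ('a \<times> 'b \<Rightarrow>\<^sub>0 int) set \<Rightarrow> 'n" where
  "tlift \<beta> X = the_elem (flift \<beta> ` X)"

lemma mk_module_simps [simp]:
  "carrier (mk_module s A) = A" "\<zero>\<^bsub>mk_module s A\<^esub> = 0"
  "x \<oplus>\<^bsub>mk_module s A\<^esub> y = x + y" "c \<odot>\<^bsub>mk_module s A\<^esub> x = s c x"
  by (simp_all add: mk_module_def)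

text \<open>Additive subgroups stable under R: this keeps the tensor relations inside the free group
  on A \<times> B and lets one compute with cosets of the relation subgroup
  \<open>N\<close>.\<close>

locale module_pair =
  fixes R :: "'r ring"
    and sA :: "'r \<Rightarrow> 'a::ab_group_add \<Rightarrow> 'a" and A :: "'a set"
    and sB :: "'r \<Rightarrow> 'b::ab_group_add \<Rightarrow> 'b" and B :: "'b set"
  assumes A_zero: "0 \<in> A" and A_diff: "\<And>a a'. a \<in> A \<Longrightarrow> a' \<in> A \<Longrightarrow> a - a' \<in> A"
    and A_smult: "\<And>r a. r \<in> carrier R \<Longrightarrow> a \<in> A \<Longrightarrow> sA r a \<in> A"
    and B_zero: "0 \<in> B" and B_diff: "\<And>b b'. b \<in> B \<Longrightarrow> b' \<in> B \<Longrightarrow> b - b' \<in> B"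
    and B_smult: "\<And>r b. r \<in> carrier R \<Longrightarrow> b \<in> B \<Longrightarrow> sB r b \<in> B"
begin

abbreviation "MA \<equiv> mk_module sA A"
abbreviation "MB \<equiv> mk_module sB B"
abbreviation "G \<equiv> free_Abelian_group (A \<times> B)"
abbreviation "N \<equiv> tensor_sub R MA MB"
abbreviation "cls x \<equiv> N #>\<^bsub>G\<^esub> x"

lemma A_add: "a \<in> A \<Longrightarrow> a' \<in> A \<Longrightarrow> a + a' \<in> A"
  using A_diff[of a "0 - a'"] A_diff[OF A_zero, of a'] by simp

lemma B_add: "b \<in> B \<Longrightarrow> b' \<in> B \<Longrightarrow> b + b' \<in> B"
  using B_diff[of b "0 - b'"] B_diff[OF B_zero, of b'] by simp

lemma B_sum: "(\<And>i. i \<in> I \<Longrightarrow> f i \<in> B) \<Longrightarrow> sum f I \<in> B"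
  by (induction I rule: infinite_finite_induct) (auto intro: B_add B_zero)

lemma keys_diff_closed:
  "Poly_Mapping.keys x \<subseteq> Z \<Longrightarrow> Poly_Mapping.keys y \<subseteq> Z \<Longrightarrow> Poly_Mapping.keys (x - y) \<subseteq> Z"
  for x y :: "'z \<Rightarrow>\<^sub>0 int"
  using keys_diff[of x y] by blast

lemma keys_add_closed:
  "Poly_Mapping.keys x \<subseteq> Z \<Longrightarrow> Poly_Mapping.keys y \<subseteq> Z \<Longrightarrow> Poly_Mapping.keys (x + y) \<subseteq> Z"
  for x y :: "'z \<Rightarrow>\<^sub>0 int"
  using keys_add[of x y] by blast

lemma tensor_free_eq: "tensor_free MA MB = G"
  by (simp add: tensor_free_def)

lemma tensor_rel_subset: "tensor_rel R MA MB \<subseteq> carrier G"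
proof
  fix x assume "x \<in> tensor_rel R MA MB"
  then have "Poly_Mapping.keys x \<subseteq> A \<times> B"
    unfolding tensor_rel_def mk_module_simps
    by (elim UnE CollectE exE conjE) (simp_all only:, (intro keys_diff_closed;
      simp add: keys_frag_of A_add B_add A_smult B_smult)+)
  then show "x \<in> carrier G" by (simp only: carrier_free_Abelian_group_iff)
qed

lemma N_generate: "N = generate G (tensor_rel R MA MB)"
  by (simp add: tensor_sub_def tensor_free_eq)

lemma subgroup_N: "subgroup N G"
  unfolding N_generate by (rule group.generate_is_subgroup[OF group_free_Abelian_group tensor_rel_subset])

lemma N_keys: "x \<in> N \<Longrightarrow> Poly_Mapping.keys x \<subseteq> A \<times> B"
  using subsetD[OF subgroup.subset[OF subgroup_N]] by (simp only: carrier_free_Abelian_group_iff)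

lemma N_zero: "0 \<in> N"
  using subgroup.one_closed[OF subgroup_N] by simp

lemma N_add: "x \<in> N \<Longrightarrow> y \<in> N \<Longrightarrow> x + y \<in> N"
  using subgroup.m_closed[OF subgroup_N, of x y] by simp

lemma N_minus: "x \<in> N \<Longrightarrow> - x \<in> N"
  using subgroup.m_inv_closed[OF subgroup_N, of x] N_keys[of x] by simp

lemma N_diff: "x \<in> N \<Longrightarrow> y \<in> N \<Longrightarrow> x - y \<in> N"
  using N_add[of x "- y"] N_minus[of y] by simp

lemma N_sum: "(\<And>i. i \<in> I \<Longrightarrow> f i \<in> N) \<Longrightarrow> sum f I \<in> N"
  by (induction I rule: infinite_finite_induct) (auto intro: N_add N_zero)

lemma N_rel: "x \<in> tensor_rel R MA MB \<Longrightarrow> x \<in> N"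
  unfolding N_generate by (rule generate.incl)

lemma N_rel_left: "a \<in> A \<Longrightarrow> a' \<in> A \<Longrightarrow> b \<in> B \<Longrightarrow> frag_of (a + a', b) - frag_of (a, b) - frag_of (a', b) \<in> N"
  by (rule N_rel) (auto simp: tensor_rel_def)

lemma N_rel_right: "a \<in> A \<Longrightarrow> b \<in> B \<Longrightarrow> b' \<in> B \<Longrightarrow> frag_of (a, b + b') - frag_of (a, b) - frag_of (a, b') \<in> N"
  by (rule N_rel) (auto simp: tensor_rel_def)

lemma N_rel_smult: "r \<in> carrier R \<Longrightarrow> a \<in> A \<Longrightarrow> b \<in> B \<Longrightarrow> frag_of (sA r a, b) - frag_of (a, sB r b) \<in> N"
  by (rule N_rel) (auto simp: tensor_rel_def)

text \<open>Closure under 0 and differences yields inverses and products together, so an additive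
  map needs to be examined on the defining relations only.\<close>

lemma N_induct [consumes 1, case_names left right smult zero diff]:
  assumes "x \<in> N"
    and "\<And>a a' b. a \<in> A \<Longrightarrow> a' \<in> A \<Longrightarrow> b \<in> B \<Longrightarrow> P (frag_of (a + a', b) - frag_of (a, b) - frag_of (a', b))"
    and "\<And>a b b'. a \<in> A \<Longrightarrow> b \<in> B \<Longrightarrow> b' \<in> B \<Longrightarrow> P (frag_of (a, b + b') - frag_of (a, b) - frag_of (a, b'))"
    and "\<And>r a b. r \<in> carrier R \<Longrightarrow> a \<in> A \<Longrightarrow> b \<in> B \<Longrightarrow> P (frag_of (sA r a, b) - frag_of (a, sB r b))"
    and zero: "P 0" and diff: "\<And>x y. P x \<Longrightarrow> P y \<Longrightarrow> P (x - y)"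
  shows "P x"
proof -
  have rel: "P h" if "h \<in> tensor_rel R MA MB" for h
    using that assms(2-4) unfolding tensor_rel_def by auto
  have minus: "P (- h)" if "P h" for h using diff[OF zero that] by simp
  show ?thesis
    using assms(1) unfolding N_generate
  proof (induction rule: generate.induct)
    case (inv h)
    then have "inv\<^bsub>G\<^esub> h = - h"
      using subsetD[OF tensor_rel_subset inv] by (intro inv_free_Abelian_group) simp
    then show ?case using rel[OF inv] minus by simp
  next
    case (eng h1 h2)
    then show ?case using diff[of h1 "- h2"] minus[of h2] by simp
  qed (simp_all add: zero rel)
qed

lemma cls_eq_iff:
  assumes "Poly_Mapping.keys x \<subseteq> A \<times> B" "Poly_Mapping.keys y \<subseteq> A \<times> B"
  shows "cls x = cls y \<longleftrightarrow> x - y \<in> N"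
proof
  assume "cls x = cls y"
  then have "x \<in> cls y"
    using group.repr_independenceD[OF group_free_Abelian_group subgroup_N, of x y] assms by simp
  then obtain h where "h \<in> N" "x = h + y" by (auto simp: r_coset_def)
  then show "x - y \<in> N" by simp
next
  assume "x - y \<in> N"
  then have "x \<in> cls y" unfolding r_coset_def by (auto intro: bexI[of _ "x - y"])
  then show "cls x = cls y"
    using group.repr_independence[OF group_free_Abelian_group _ _ subgroup_N, of x y] assms
    by simp
qed

lemma normal_N: "N \<lhd> G"
  by (rule comm_group.subgroup_imp_normal[OF abelian_free_Abelian_group subgroup_N])

lemma tensor_carrier: "carrier (tensor R MA MB) = cls ` {x. Poly_Mapping.keys x \<subseteq> A \<times> B}"
  by (auto simp: tensor_def tensor_free_eq FactGroup_def RCOSETS_def Let_def)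

lemma cls_in_carrier: "Poly_Mapping.keys x \<subseteq> A \<times> B \<Longrightarrow> cls x \<in> carrier (tensor R MA MB)"
  by (auto simp: tensor_carrier)

lemma tensor_zero: "\<zero>\<^bsub>tensor R MA MB\<^esub> = cls 0"
  by (simp add: tensor_def tensor_free_eq FactGroup_def Let_def r_coset_def)

lemma tensor_add:
  assumes "Poly_Mapping.keys x \<subseteq> A \<times> B" "Poly_Mapping.keys y \<subseteq> A \<times> B"
  shows "cls x \<oplus>\<^bsub>tensor R MA MB\<^esub> cls y = cls (x + y)"
  using normal.rcos_sum[OF normal_N, of x y] assms
  by (simp add: tensor_def tensor_free_eq FactGroup_def Let_def)

lemma tensor_smult: "r \<odot>\<^bsub>tensor R MA MB\<^esub> X = tensor_map R MA MB (sA r) (\<lambda>b. b) X"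
  by (simp add: tensor_def Let_def)

definition balanced :: "('a \<Rightarrow> 'b \<Rightarrow> 'n::ab_group_add) \<Rightarrow> bool" where
  "balanced \<beta> \<longleftrightarrow>
     (\<forall>a\<in>A. \<forall>a'\<in>A. \<forall>b\<in>B. \<beta> (a + a') b = \<beta> a b + \<beta> a' b) \<and>
     (\<forall>a\<in>A. \<forall>b\<in>B. \<forall>b'\<in>B. \<beta> a (b + b') = \<beta> a b + \<beta> a b') \<and>
     (\<forall>r\<in>carrier R. \<forall>a\<in>A. \<forall>b\<in>B. \<beta> (sA r a) b = \<beta> a (sB r b))"

lemma flift_N: "balanced \<beta> \<Longrightarrow> x \<in> N \<Longrightarrow> flift \<beta> x = 0"
  by (rotate_tac, induction rule: N_induct) (auto simp: frag_lift_diff balanced_def)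

lemma tlift_cls:
  assumes "balanced \<beta>"
  shows "tlift \<beta> (cls x) = flift \<beta> x"
proof -
  have "flift \<beta> ` cls x = {flift \<beta> x}"
  proof -
    have "flift \<beta> (h + x) = flift \<beta> x" if "h \<in> N" for h
      using flift_N[OF assms that] by (simp add: frag_lift_add)
    moreover have "cls x = (\<lambda>h. h + x) ` N" by (auto simp: r_coset_def)
    ultimately show ?thesis using N_zero by auto
  qed
  then show ?thesis by (simp add: tlift_def)
qed

end

text \<open>The extension \<open>F\<close> of \<open>f\<close> and \<open>g\<close> to the free
  groups sends each defining relation to a relation. Hence the members of a coset have images in one
  coset, which \<open>the_elem\<close> in \<open>tensor_map\<close> returns.\<close>

lemma tensor_map_cls:
  assumes P: "module_pair R sA A sB B" and P': "module_pair R sA' A' sB' B'"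
    and f: "\<And>a. a \<in> A \<Longrightarrow> f a \<in> A'" "\<And>a a'. a \<in> A \<Longrightarrow> a' \<in> A \<Longrightarrow> f (a + a') = f a + f a'"
      "\<And>r a. r \<in> carrier R \<Longrightarrow> a \<in> A \<Longrightarrow> f (sA r a) = sA' r (f a)"
    and g: "\<And>b. b \<in> B \<Longrightarrow> g b \<in> B'" "\<And>b b'. b \<in> B \<Longrightarrow> b' \<in> B \<Longrightarrow> g (b + b') = g b + g b'"
      "\<And>r b. r \<in> carrier R \<Longrightarrow> b \<in> B \<Longrightarrow> g (sB r b) = sB' r (g b)"
    and x: "Poly_Mapping.keys x \<subseteq> A \<times> B"
  defines "F \<equiv> frag_extend (\<lambda>(a, b). frag_of (f a, g b))"
  shows "tensor_map R (mk_module sA' A') (mk_module sB' B') f g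
      (tensor_sub R (mk_module sA A) (mk_module sB B) #>\<^bsub>free_Abelian_group (A \<times> B)\<^esub> x)
    = tensor_sub R (mk_module sA' A') (mk_module sB' B') #>\<^bsub>free_Abelian_group (A' \<times> B')\<^esub> F x"
    and "Poly_Mapping.keys (F x) \<subseteq> A' \<times> B'"
proof -
  interpret P: module_pair R sA A sB B by (rule P)
  interpret P': module_pair R sA' A' sB' B' by (rule P')
  have keys: "Poly_Mapping.keys (F y) \<subseteq> A' \<times> B'" if "Poly_Mapping.keys y \<subseteq> A \<times> B" for y
    using keys_frag_extend[of "\<lambda>(a, b). frag_of (f a, g b)" y] that f(1) g(1)
    by (fastforce simp: F_def keys_frag_of split: prod.splits)
  show "Poly_Mapping.keys (F x) \<subseteq> A' \<times> B'" using keys[OF x] .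
  have Fdiff: "F (y - z) = F y - F z" for y z by (simp add: F_def frag_extend_diff)
  have FN: "F h \<in> P'.N" if "h \<in> P.N" for h
    using that
  proof (induction rule: P.N_induct)
    case (left a a' b)
    then show ?case using P'.N_rel_left[of "f a" "f a'" "g b"] by (simp add: F_def frag_extend_diff f g)
  next
    case (right a b b')
    then show ?case using P'.N_rel_right[of "f a" "g b" "g b'"] by (simp add: F_def frag_extend_diff f g)
  next
    case (smult r a b)
    then show ?case using P'.N_rel_smult[of r "f a" "g b"] by (simp add: F_def frag_extend_diff f g)
  next
    case zero
    show ?case by (simp add: F_def P'.N_zero)
  next
    case (diff y z)
    then show ?case by (simp add: Fdiff P'.N_diff)
  qed
  have "(\<lambda>y. P'.cls (F y)) ` P.cls x = {P'.cls (F x)}"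
  proof -
    have "P'.cls (F (h + x)) = P'.cls (F x)" if "h \<in> P.N" for h
    proof -
      have "Poly_Mapping.keys (h + x) \<subseteq> A \<times> B"
        by (rule P.keys_add_closed[OF P.N_keys[OF that] x])
      moreover have "F (h + x) - F x \<in> P'.N"
        using FN[OF that] Fdiff[of "h + x" x] by simp
      ultimately show ?thesis by (simp only: P'.cls_eq_iff keys x)
    qed
    moreover have "P.cls x = (\<lambda>h. h + x) ` P.N" by (auto simp: r_coset_def)
    moreover have "0 \<in> P.N" by (rule P.N_zero)
    ultimately show ?thesis by (auto simp: image_iff intro!: bexI[of _ 0])
  qed
  then show "tensor_map R (mk_module sA' A') (mk_module sB' B') f g (P.cls x) = P'.cls (F x)"
    by (simp add: tensor_map_def P'.tensor_free_eq F_def)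
qed

text \<open>A generating family e of B reduces A \<otimes> B to the sums of x_j \<otimes> e_j; a
  balanced map \<open>\<beta>\<close> that is injective on these sums with image I identifies the
  tensor product with I. It is applied over K to a basis of ker sigma_r, and over F(V) to the
  standard basis of a Koszul term.\<close>

locale module_pair_basis = module_pair R sA A sB B
  for R :: "'r ring" and sA :: "'r \<Rightarrow> 'a::ab_group_add \<Rightarrow> 'a" and A
    and sB :: "'r \<Rightarrow> 'b::ab_group_add \<Rightarrow> 'b" and B +
  fixes J :: "'j set" and e :: "'j \<Rightarrow> 'b" and \<beta> :: "'a \<Rightarrow> 'b \<Rightarrow> 'n::ab_group_add" and I :: "'n set"
  assumes finite_J: "finite J" and e_in: "\<And>j. j \<in> J \<Longrightarrow> e j \<in> B"
    and spanning: "\<And>b. b \<in> B \<Longrightarrow> \<exists>c. (\<forall>j\<in>J. c j \<in> carrier R) \<and> b = (\<Sum>j\<in>J. sB (c j) (e j))"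
    and balanced: "balanced \<beta>"
    and independent: "\<And>x. (\<And>j. j \<in> J \<Longrightarrow> x j \<in> A) \<Longrightarrow> (\<Sum>j\<in>J. \<beta> (x j) (e j)) = 0 \<Longrightarrow> \<forall>j\<in>J. x j = 0"
    and image: "\<And>y. y \<in> I \<longleftrightarrow> (\<exists>x. (\<forall>j\<in>J. x j \<in> A) \<and> y = (\<Sum>j\<in>J. \<beta> (x j) (e j)))"
begin

lemma N_zero_left: "b \<in> B \<Longrightarrow> frag_of (0, b) \<in> N"
  using N_minus[OF N_rel_left[OF A_zero A_zero, of b]] by simp

lemma N_zero_right: "a \<in> A \<Longrightarrow> frag_of (a, 0) \<in> N"
  using N_minus[OF N_rel_right[OF _ B_zero B_zero, of a]] by simp

lemma N_diff_left:
  assumes "a \<in> A" "a' \<in> A" "b \<in> B"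
  shows "frag_of (a, b) - frag_of (a', b) - frag_of (a - a', b) \<in> N"
  using N_rel_left[of "a - a'" a' b] A_diff assms by (simp add: algebra_simps)

lemma N_sum_right:
  assumes "a \<in> A" "\<And>j. j \<in> K \<Longrightarrow> f j \<in> B"
  shows "frag_of (a, \<Sum>j\<in>K. f j) - (\<Sum>j\<in>K. frag_of (a, f j)) \<in> N"
  using assms(2)
proof (induction K rule: infinite_finite_induct)
  case (insert k K)
  have "(frag_of (a, f k + sum f K) - frag_of (a, f k) - frag_of (a, sum f K)) +
      (frag_of (a, sum f K) - (\<Sum>j\<in>K. frag_of (a, f j))) \<in> N"
    using insert by (intro N_add N_rel_right assms(1) B_sum) auto
  then show ?case using insert by (simp add: algebra_simps)
qed (use N_zero_right[OF assms(1)] in auto)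

text \<open>For a pure tensor a \<otimes> b, expand b in the e_j and move the coefficients to the
  left factor.\<close>

lemma normal_form:
  assumes "Poly_Mapping.keys z \<subseteq> A \<times> B"
  shows "\<exists>x. (\<forall>j\<in>J. x j \<in> A) \<and> z - (\<Sum>j\<in>J. frag_of (x j, e j)) \<in> N"
  using assms
proof (induction z rule: frag_induction)
  case zero
  have "0 - (\<Sum>j\<in>J. frag_of (0, e j)) \<in> N"
    by (intro N_diff N_zero N_sum N_zero_left e_in)
  then show ?case using A_zero by (intro exI[of _ "\<lambda>_. 0"]) blast
next
  case (one p)
  then obtain a b where p: "p = (a, b)" "a \<in> A" "b \<in> B" by blast
  obtain c where c: "\<forall>j\<in>J. c j \<in> carrier R" "b = (\<Sum>j\<in>J. sB (c j) (e j))"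
    using spanning[OF p(3)] by blast
  have "frag_of (a, b) - (\<Sum>j\<in>J. frag_of (a, sB (c j) (e j))) \<in> N"
    unfolding c(2) using c(1) by (intro N_sum_right p B_smult e_in) auto
  moreover have "(\<Sum>j\<in>J. frag_of (sA (c j) a, e j) - frag_of (a, sB (c j) (e j))) \<in> N"
    using c(1) by (intro N_sum N_rel_smult p e_in) auto
  ultimately have "(frag_of (a, b) - (\<Sum>j\<in>J. frag_of (a, sB (c j) (e j)))) -
      (\<Sum>j\<in>J. frag_of (sA (c j) a, e j) - frag_of (a, sB (c j) (e j))) \<in> N"
    by (rule N_diff)
  then have "frag_of p - (\<Sum>j\<in>J. frag_of (sA (c j) a, e j)) \<in> N"
    by (simp add: sum_subtractf p(1))
  then show ?case using c(1) p A_smult by (intro exI[of _ "\<lambda>j. sA (c j) a"]) auto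
next
  case (diff z z')
  then obtain x x' where x: "\<forall>j\<in>J. x j \<in> A" "z - (\<Sum>j\<in>J. frag_of (x j, e j)) \<in> N"
    and x': "\<forall>j\<in>J. x' j \<in> A" "z' - (\<Sum>j\<in>J. frag_of (x' j, e j)) \<in> N" by blast
  have "(\<Sum>j\<in>J. frag_of (x j, e j) - frag_of (x' j, e j) - frag_of (x j - x' j, e j)) \<in> N"
    using x x' by (intro N_sum N_diff_left e_in) auto
  from N_add[OF N_diff[OF x(2) x'(2)] this]
  have "(z - z') - (\<Sum>j\<in>J. frag_of (x j - x' j, e j)) \<in> N"
    unfolding sum_subtractf by (simp add: algebra_simps)
  then show ?case using x x' A_diff by (intro exI[of _ "\<lambda>j. x j - x' j"]) blast
qed

lemma keys_basis_sum:
  "\<forall>j\<in>J. x j \<in> A \<Longrightarrow> Poly_Mapping.keys (\<Sum>j\<in>J. frag_of (x j, e j)) \<subseteq> A \<times> B"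
  using keys_sum[of "\<lambda>j. frag_of (x j, e j)" J] e_in by (fastforce simp: keys_frag_of)

lemma flift_kernel:
  assumes "Poly_Mapping.keys z \<subseteq> A \<times> B" "flift \<beta> z = 0"
  shows "z \<in> N"
proof -
  obtain x where x: "\<forall>j\<in>J. x j \<in> A" and zx: "z - (\<Sum>j\<in>J. frag_of (x j, e j)) \<in> N"
    using normal_form[OF assms(1)] by blast
  have "(\<Sum>j\<in>J. \<beta> (x j) (e j)) = 0"
    using flift_N[OF balanced zx] assms(2) by (simp add: frag_lift_diff frag_lift_sum)
  then have "\<forall>j\<in>J. x j = 0" using independent x by blast
  then have "(\<Sum>j\<in>J. frag_of (x j, e j)) \<in> N" by (intro N_sum) (auto intro: N_zero_left e_in)
  then show ?thesis using N_add[OF zx] by fastforce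
qed

lemma flift_image:
  assumes "Poly_Mapping.keys z \<subseteq> A \<times> B"
  shows "flift \<beta> z \<in> I"
proof -
  obtain x where x: "\<forall>j\<in>J. x j \<in> A" and zx: "z - (\<Sum>j\<in>J. frag_of (x j, e j)) \<in> N"
    using normal_form[OF assms] by blast
  have "flift \<beta> z = (\<Sum>j\<in>J. \<beta> (x j) (e j))"
    using flift_N[OF balanced zx] by (simp add: frag_lift_diff frag_lift_sum)
  then show ?thesis using x image by blast
qed

lemma tlift_bij: "bij_betw (tlift \<beta>) (carrier (tensor R MA MB)) I"
  unfolding bij_betw_def
proof
  show "inj_on (tlift \<beta>) (carrier (tensor R MA MB))"
  proof (rule inj_onI)
    fix X Y assume "X \<in> carrier (tensor R MA MB)" "Y \<in> carrier (tensor R MA MB)"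
      and eq: "tlift \<beta> X = tlift \<beta> Y"
    then obtain x y where xy: "X = cls x" "Y = cls y"
      "Poly_Mapping.keys x \<subseteq> A \<times> B" "Poly_Mapping.keys y \<subseteq> A \<times> B"
      unfolding tensor_carrier by auto
    then have "flift \<beta> (x - y) = 0" using eq by (simp add: tlift_cls[OF balanced] frag_lift_diff)
    then have "x - y \<in> N" using keys_diff_closed xy by (intro flift_kernel) auto
    then show "X = Y" using cls_eq_iff xy by blast
  qed
  show "tlift \<beta> ` carrier (tensor R MA MB) = I"
  proof (intro equalityI subsetI)
    fix y assume "y \<in> I"
    then obtain x where x: "\<forall>j\<in>J. x j \<in> A" "y = (\<Sum>j\<in>J. \<beta> (x j) (e j))" using image by blast
    have "y = tlift \<beta> (cls (\<Sum>j\<in>J. frag_of (x j, e j)))"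
      by (simp add: tlift_cls[OF balanced] frag_lift_sum x(2))
    then show "y \<in> tlift \<beta> ` carrier (tensor R MA MB)"
      using keys_basis_sum[OF x(1)] cls_in_carrier by blast
  qed (auto simp: tensor_carrier tlift_cls[OF balanced] flift_image)
qed

lemma tensor_add_closed:
  "X \<in> carrier (tensor R MA MB) \<Longrightarrow> Y \<in> carrier (tensor R MA MB) \<Longrightarrow>
    X \<oplus>\<^bsub>tensor R MA MB\<^esub> Y \<in> carrier (tensor R MA MB)"
  by (auto simp: tensor_carrier tensor_add keys_add_closed)

lemma tlift_add:
  "X \<in> carrier (tensor R MA MB) \<Longrightarrow> Y \<in> carrier (tensor R MA MB) \<Longrightarrow>
    tlift \<beta> (X \<oplus>\<^bsub>tensor R MA MB\<^esub> Y) = tlift \<beta> X + tlift \<beta> Y"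
  by (auto simp: tensor_carrier tensor_add tlift_cls[OF balanced] frag_lift_add)

lemma tensor_zero_closed: "\<zero>\<^bsub>tensor R MA MB\<^esub> \<in> carrier (tensor R MA MB)"
  unfolding tensor_zero by (rule cls_in_carrier) simp

lemma tlift_zero: "tlift \<beta> \<zero>\<^bsub>tensor R MA MB\<^esub> = 0"
  unfolding tensor_zero by (simp add: tlift_cls[OF balanced])

end

text \<open>The induced map and D are compared on pure tensors, both sides being additive.
  Additivity of D is asked on I only, since linearity of \<open>yb_diff\<close> is available for
  tensors of the right degree.\<close>

lemma tensor_map_tlift:
  assumes P: "module_pair R sA A sB B" "module_pair.balanced R sA A sB B \<beta>"
    and P': "module_pair R sA' A' sB' B'" "module_pair.balanced R sA' A' sB' B' \<beta>'"
    and f: "\<And>a. a \<in> A \<Longrightarrow> f a \<in> A'" "\<And>a a'. a \<in> A \<Longrightarrow> a' \<in> A \<Longrightarrow> f (a + a') = f a + f a'"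
      "\<And>r a. r \<in> carrier R \<Longrightarrow> a \<in> A \<Longrightarrow> f (sA r a) = sA' r (f a)"
    and g: "\<And>b. b \<in> B \<Longrightarrow> g b \<in> B'" "\<And>b b'. b \<in> B \<Longrightarrow> b' \<in> B \<Longrightarrow> g (b + b') = g b + g b'"
      "\<And>r b. r \<in> carrier R \<Longrightarrow> b \<in> B \<Longrightarrow> g (sB r b) = sB' r (g b)"
    and D: "\<And>a b. a \<in> A \<Longrightarrow> b \<in> B \<Longrightarrow> \<beta>' (f a) (g b) = D (\<beta> a b)"
      "\<And>y z. y \<in> I \<Longrightarrow> z \<in> I \<Longrightarrow> D (y - z) = D y - D z"
    and I: "0 \<in> I" "\<And>y z. y \<in> I \<Longrightarrow> z \<in> I \<Longrightarrow> y - z \<in> I"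
      "\<And>a b. a \<in> A \<Longrightarrow> b \<in> B \<Longrightarrow> \<beta> a b \<in> I"
    and X: "X \<in> carrier (tensor R (mk_module sA A) (mk_module sB B))"
  shows "tensor_map R (mk_module sA' A') (mk_module sB' B') f g X
      \<in> carrier (tensor R (mk_module sA' A') (mk_module sB' B'))"
    and "tlift \<beta>' (tensor_map R (mk_module sA' A') (mk_module sB' B') f g X)
      = D (tlift \<beta> X)"
proof -
  interpret P: module_pair R sA A sB B by (rule P)
  interpret P': module_pair R sA' A' sB' B' by (rule P')
  obtain x where x: "X = P.cls x" "Poly_Mapping.keys x \<subseteq> A \<times> B"
    using X unfolding P.tensor_carrier by auto
  let ?F = "frag_extend (\<lambda>(a, b). frag_of (f a, g b))"
  have tm: "tensor_map R (mk_module sA' A') (mk_module sB' B') f g X = P'.cls (?F x)"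
    "Poly_Mapping.keys (?F x) \<subseteq> A' \<times> B'"
    unfolding x(1) by (rule tensor_map_cls[OF P(1) P'(1)]; use f g x in blast)+
  show "tensor_map R (mk_module sA' A') (mk_module sB' B') f g X
      \<in> carrier (tensor R (mk_module sA' A') (mk_module sB' B'))"
    unfolding tm(1) by (rule P'.cls_in_carrier[OF tm(2)])
  have D0: "D 0 = 0" using D(2)[OF I(1) I(1)] by simp
  have "flift \<beta> x \<in> I \<and> flift \<beta>' (?F x) = D (flift \<beta> x)"
    using x(2)
  proof (induction x rule: frag_induction)
    case (one p)
    then show ?case using I(3) D(1) by auto
  next
    case (diff y z)
    then show ?case using I(2) D(2) by (simp add: frag_lift_diff frag_extend_diff)
  qed (simp add: I(1) D0)
  then show "tlift \<beta>' (tensor_map R (mk_module sA' A') (mk_module sB' B') f g X) = D (tlift \<beta> X)"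
    unfolding tm(1) unfolding x(1) by (simp add: P.tlift_cls[OF P(2)] P'.tlift_cls[OF P'(2)])
qed


section \<open>The one-term Yang-Baxter complex\<close>

text \<open>The product T_k T_(k+1) ... T_(k+r-1); for k = 0 it is d_(r+1) up to the sign
  (-1)^r.\<close>

fun tcomp ::
    "(ratfun \<Rightarrow> 'a::ab_group_add \<Rightarrow> 'a) \<Rightarrow> nat \<Rightarrow> nat \<Rightarrow> (nat list \<Rightarrow> 'a) \<Rightarrow> nat list \<Rightarrow> 'a" where
  "tcomp s k 0 f = f"
| "tcomp s k (Suc r) f = hecke s k (tcomp s (Suc k) r f)"

lemma additive_minus:
  fixes l :: "'a::ab_group_add \<Rightarrow> 'b::ab_group_add"
  assumes "\<And>x y. l (x + y) = l x + l y"
  shows "l 0 = 0" "l (- x) = - l x" "l (x - y) = l x - l y"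
proof -
  show 0: "l 0 = 0" using assms[of 0 0] by simp
  show neg: "l (- x) = - l x" for x
    using assms[of x "- x"] 0 by (simp add: eq_neg_iff_add_eq_0 add.commute)
  show "l (x - y) = l x - l y" using assms[of x "- y"] neg[of y] by simp
qed

lemma additive_sum:
  fixes l :: "'a::ab_group_add \<Rightarrow> 'b::ab_group_add"
  assumes "\<And>x y. l (x + y) = l x + l y"
  shows "l (\<Sum>i\<in>I. f i) = (\<Sum>i\<in>I. l (f i))"
  by (induction I rule: infinite_finite_induct) (simp_all add: assms additive_minus(1)[of l, OF assms])

lemma hecke_local:
  "(\<And>v. length v = length u \<Longrightarrow> f v = g v) \<Longrightarrow> hecke s k f u = hecke s k g u"
proof (induction u arbitrary: f g k)
  case (Cons x u)
  show ?case
  proof (cases k)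
    case 0
    then show ?thesis using Cons.prems by (cases u) auto
  next
    case (Suc k')
    have "hecke s k' (\<lambda>w. f (x # w)) u = hecke s k' (\<lambda>w. g (x # w)) u"
      by (rule Cons.IH) (use Cons.prems in auto)
    then show ?thesis using Suc by simp
  qed
qed simp

text \<open>The operators rearrange words and multiply by scalars, so they commute with every linear
  map of coefficients. The maps used later are coordinate functionals, the actions of the v_j on M,
  and c \<mapsto> c x.\<close>

lemma hecke_linear:
  assumes add: "\<And>x y. l (x + y) = l x + l y" and scale: "\<And>c x. l (s c x) = s' c (l x)"
  shows "hecke s' k (\<lambda>u. l (f u)) u = l (hecke s k f u)"
proof (induction k arbitrary: f u)
  case 0
  show ?case
    by (cases u rule: remdups_adj.cases) (simp_all add: additive_minus[of l, OF add] scale)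
next
  case (Suc k)
  show "hecke s' (Suc k) (\<lambda>u. l (f u)) u = l (hecke s (Suc k) f u)"
    by (cases u) (simp_all add: additive_minus[of l, OF add] Suc)
qed

lemma hsum_linear:
  assumes add: "\<And>x y. l (x + y) = l x + l y" and scale: "\<And>c x. l (s c x) = s' c (l x)"
  shows "hsum s' k r (\<lambda>u. l (f u)) u = l (hsum s k r f u)"
proof (induction r arbitrary: k u)
  case 0
  show ?case by (simp add: additive_minus[of l, OF add])
next
  case (Suc r)
  have "hsum s' (Suc k) r (\<lambda>u. l (f u)) = (\<lambda>u. l (hsum s (Suc k) r f u))"
    using Suc by blast
  then show "hsum s' k (Suc r) (\<lambda>u. l (f u)) u = l (hsum s k (Suc r) f u)"
    by (simp only: hsum_Suc plus_fun_apply add hecke_linear[of l s s', OF add scale])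
qed

section \<open>Comparison of the given operators with their coordinate form\<close>

lemma pure_tens: "w \<in> words m n \<Longrightarrow> pure x w \<in> tens m n"
  by (simp add: tens_iff pure_def)

lemma R_basis_hecke: "R_basis [a, b] u = - hecke (*) 0 (pure 1 [a, b]) u"
proof (cases u rule: remdups_adj.cases)
  case (3 c d v)
  then show ?thesis
    by (cases a b rule: linorder_cases) (auto simp: pure_def qq_def)
qed (auto simp: pure_def)

lemma lin_ext_pure: "lin_ext \<phi> (pure 1 w) = \<phi> w"
proof
  have "{v. pure 1 w v \<noteq> (0::ratfun)} = {w}" by (auto simp: pure_def)
  then show "lin_ext \<phi> (pure 1 w) u = \<phi> w u" for u by (simp add: lin_ext_def pure_def)
qed

lemma lin_ext_superset:
  assumes "finite W" "\<And>w. w \<notin> W \<Longrightarrow> f w = 0"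
  shows "lin_ext \<phi> f u = (\<Sum>w\<in>W. f w * \<phi> w u)"
  unfolding lin_ext_def by (rule sum.mono_neutral_left) (use assms in auto)

lemma conc_pure_left:
  "conc (pure 1 p) g u = (if take (length p) u = p then g (drop (length p) u) else 0)"
proof -
  have "conc (pure 1 p) g u
      = (\<Sum>k\<le>length u. if k = length p then (if take k u = p then g (drop k u) else 0) else 0)"
    unfolding conc_def by (intro sum.cong) (auto simp: pure_def)
  also have "\<dots> = (if take (length p) u = p then g (drop (length p) u) else 0)"
    by (auto simp: sum.delta)
  finally show ?thesis .
qed

lemma conc_homogeneous:
  assumes "\<And>w. length w \<noteq> p \<Longrightarrow> f w = 0"
  shows "conc f g u = (if p \<le> length u then f (take p u) * g (drop p u) else 0)"
proof -
  have "conc f g u = (\<Sum>k\<le>length u. if k = p then f (take p u) * g (drop p u) else 0)"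
    unfolding conc_def by (intro sum.cong) (auto simp: assms)
  then show ?thesis by (simp add: sum.delta)
qed

text \<open>Both sides vanish at u unless u agrees with the basis word outside the two letters a b,
  and on these two letters the claim is \<open>R_basis_hecke\<close>.\<close>

lemma R_at_basis:
  fixes p r :: "nat list" and a b :: nat
  defines "w \<equiv> p @ a # b # r"
  shows "conc (pure 1 (take (length p) w))
      (conc (R_op (pure 1 [w ! length p, w ! (length p + 1)])) (pure 1 (drop (length p + 2) w))) u
    = - hecke (*) (length p) (pure 1 w) u"
proof -
  have w: "take (length p) w = p" "w ! length p = a" "w ! (length p + 1) = b" "drop (length p + 2) w = r"
    by (simp_all add: w_def nth_append)
  have R: "R_op (pure 1 [a, b]) = R_basis [a, b]" unfolding R_op_def by (rule lin_ext_pure)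
  have R_len: "R_basis [a, b] v = 0" if "length v \<noteq> 2" for v
  proof -
    have "v \<noteq> [a, b]" "v \<noteq> [b, a]" using that by auto
    then show ?thesis by (simp add: pure_def)
  qed
  define C where "C = conc (R_basis [a, b]) (pure 1 r)"
  have C: "C v = (if 2 \<le> length v then R_basis [a, b] (take 2 v) * pure 1 r (drop 2 v) else 0)" for v
    unfolding C_def by (rule conc_homogeneous[OF R_len])
  show ?thesis
  proof (cases "length u = length w")
    case False
    have "hecke (*) (length p) (pure 1 w) u = hecke (*) (length p) 0 u"
      by (rule hecke_local) (use False in \<open>auto simp: pure_def\<close>)
    then have 1: "hecke (*) (length p) (pure 1 w) u = 0" by (simp only: K.hecke_zero zero_fun_apply)
    \<comment> \<open>A nonzero value would force u to consist of p, two letters and r, hence to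
      have the length of w.\<close>
    have "C (drop (length p) u) = 0" if "take (length p) u = p"
    proof (rule ccontr)
      assume "C (drop (length p) u) \<noteq> 0"
      then have "2 \<le> length (drop (length p) u)" "drop 2 (drop (length p) u) = r"
        unfolding C by (auto simp: pure_def split: if_splits)
      then have "length (drop (length p) u) = length r + 2" by auto
      moreover have "length u = length p + length (drop (length p) u)"
        using arg_cong[OF that, of length] by simp
      moreover have "length w = length p + length r + 2" by (simp add: w_def)
      ultimately show False using False by linarith
    qed
    then show ?thesis unfolding w R conc_pure_left C_def[symmetric] 1 by simp
  next
    case True
    define p' where "p' = take (length p) u"
    have "2 \<le> length (drop (length p) u)" using True by (simp add: w_def)
    then obtain c d r' where d: "drop (length p) u = c # d # r'"
      by (cases "drop (length p) u" rule: remdups_adj.cases) auto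
    have u: "u = p' @ c # d # r'" unfolding p'_def d[symmetric] by simp
    have lp: "length p' = length p" using True by (simp add: p'_def w_def)
    have "hecke (*) (length p) (pure 1 w) u
        = hecke (*) 0 (\<lambda>x. pure 1 w (p' @ x)) (c # d # r')"
      using K.hecke_append[of p' 0 "pure 1 w" "c # d # r'"] lp u by simp
    also have "(\<lambda>x. pure (1::ratfun) w (p' @ x)) = (\<lambda>x. if p' = p then pure 1 (a # b # r) x else 0)"
      using lp by (auto simp: pure_def w_def fun_eq_iff)
    also have "hecke (*) 0 \<dots> (c # d # r')
        = (if p' = p \<and> r' = r then hecke (*) 0 (pure 1 [a, b]) [c, d] else 0)"
      by (auto simp: pure_def)
    finally have 1: "hecke (*) (length p) (pure 1 w) u
        = (if p' = p \<and> r' = r then hecke (*) 0 (pure 1 [a, b]) [c, d] else 0)" .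
    have 2: "C (drop (length p) u) = (if r' = r then R_basis [a, b] [c, d] else 0)"
      unfolding C d by (simp add: pure_def del: R_basis.simps)
    show ?thesis
      unfolding w R conc_pure_left C_def[symmetric] 1 2 p'_def[symmetric] R_basis_hecke
      by (simp del: hecke.simps)
  qed
qed

lemma R_at_eq:
  assumes "f \<in> tens m n" "Suc k < n"
  shows "R_at k f = - hecke (*) k f"
proof
  fix u
  have f: "f = (\<lambda>u. \<Sum>w\<in>words m n. pure 1 w u * f w)"
  proof
    show "f u = (\<Sum>w\<in>words m n. pure 1 w u * f w)" for u
      using tens_eq_0[OF assms(1), of u]
      by (simp add: pure_def if_distrib[of "\<lambda>x. x * _"] sum.delta cong: if_cong)
  qed
  have "R_at k f u = (\<Sum>w\<in>words m n. f w * (- hecke (*) k (pure 1 w) u))"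
    unfolding R_at_def
  proof (subst lin_ext_superset[OF finite_words[of m n]])
    show "f w = 0" if "w \<notin> words m n" for w using tens_eq_0[OF assms(1) that] .
    show "(\<Sum>w\<in>words m n. f w * conc (pure 1 (take k w))
        (conc (R_op (pure 1 [w ! k, w ! (k + 1)])) (pure 1 (drop (k + 2) w))) u) =
      (\<Sum>w\<in>words m n. f w * (- hecke (*) k (pure 1 w) u))"
    proof (rule sum.cong[OF refl])
      fix w assume "w \<in> words m n"
      then have len: "length w = n" by (simp add: words_def)
      define p a b r where "p = take k w" "a = w ! k" "b = w ! Suc k" "r = drop (Suc (Suc k)) w"
      have "w = p @ a # b # r" "k = length p"
        using assms(2) len by (simp_all add: p_a_b_r_def Cons_nth_drop_Suc)
      then show "f w * conc (pure 1 (take k w))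
          (conc (R_op (pure 1 [w ! k, w ! (k + 1)])) (pure 1 (drop (k + 2) w))) u
        = f w * (- hecke (*) k (pure 1 w) u)"
        using R_at_basis[of p a b r u] by simp
    qed
  qed
  also have "\<dots> = - (\<Sum>w\<in>words m n. hecke (*) k (pure 1 w) u * f w)"
    by (simp add: sum_negf mult.commute)
  also have "(\<Sum>w\<in>words m n. hecke (*) k (pure 1 w) u * f w)
      = (\<Sum>w\<in>words m n. hecke (*) k (\<lambda>u. pure 1 w u * f w) u)"
    by (rule sum.cong[OF refl], rule hecke_linear[of "\<lambda>x. x * f _" "(*)" "(*)", symmetric])
      (simp_all only: distrib_right mult.assoc)
  also have "\<dots> = hecke (*) k (\<lambda>u. \<Sum>w\<in>words m n. pure 1 w u * f w) u"
  proof -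
    have sum: "hecke (*) k (\<Sum>w\<in>W. g w) = (\<Sum>w\<in>W. hecke (*) k (g w))"
      for W :: "nat list set" and g :: "nat list \<Rightarrow> nat list \<Rightarrow> ratfun"
      by (rule additive_sum[of "hecke (*) k", OF K.hecke_add])
    have "(\<lambda>u. \<Sum>w\<in>words m n. pure 1 w u * f w) = (\<Sum>w\<in>words m n. (\<lambda>u. pure 1 w u * f w))"
      by (simp only: fun_eq_iff sum_fun_apply simp_thms)
    then show ?thesis by (simp only: sum sum_fun_apply)
  qed
  also have "\<dots> = hecke (*) k f u" by (simp only: f[symmetric])
  finally show "R_at k f u = (- hecke (*) k f) u" by (simp only: uminus_apply)
qed

context ratfun_space
begin

lemma hecke_sum: "T k (\<Sum>i\<in>I. f i) = (\<Sum>i\<in>I. T k (f i))"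
  by (rule additive_sum[of "hecke scale k", OF hecke_add])

lemma tcomp_tens: "f \<in> tens m n \<Longrightarrow> tcomp scale k r f \<in> tens m n"
  by (induction r arbitrary: k) (simp_all add: hecke_tens)

lemma hsum_tcomp: "S k r f = (\<Sum>i<r. tcomp scale k i f)"
proof (induction r arbitrary: k)
  case (Suc r)
  show "S k (Suc r) f = (\<Sum>i<Suc r. tcomp scale k i f)"
    unfolding sum.lessThan_Suc_shift by (simp only: hsum_Suc Suc hecke_sum tcomp.simps)
qed simp

lemma tens_expand:
  assumes "f \<in> tens m n"
  shows "f u = (\<Sum>w\<in>words m n. pure 1 w u *s f w)"
proof -
  have "(\<Sum>w\<in>words m n. pure 1 w u *s f w) = (\<Sum>w\<in>words m n. if w = u then f w else 0)"
    by (rule sum.cong) (auto simp: pure_def)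
  then show ?thesis using tens_eq_0[OF assms, of u] by simp
qed

text \<open>T_k over M has the same scalar matrix as T_k over K. This is what makes
  \<open>id_tens\<close>, defined through matrix entries, agree with the operators over M.\<close>

lemma hecke_matrix:
  assumes "finite W"
  shows "T k (\<lambda>u. \<Sum>w\<in>W. g w u *s x w) u = (\<Sum>w\<in>W. hecke (*) k (g w) u *s x w)"
proof -
  have "(\<lambda>u. \<Sum>w\<in>W. g w u *s x w) = (\<Sum>w\<in>W. (\<lambda>u. g w u *s x w))"
    by (simp only: fun_eq_iff sum_fun_apply simp_thms)
  moreover have "T k (\<lambda>u. g w u *s x w) u = hecke (*) k (g w) u *s x w" for w
    by (rule hecke_linear[of "\<lambda>c. c *s x w" "(*)" scale]) (simp_all add: scale_left_distrib)
  ultimately show ?thesis by (simp only: hecke_sum sum_fun_apply)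
qed

lemma tcomp_matrix:
  assumes "f \<in> tens m n"
  shows "tcomp scale k r f u = (\<Sum>w\<in>words m n. tcomp (*) k r (pure 1 w) u *s f w)"
proof (induction r arbitrary: k u)
  case 0
  show ?case using tens_expand[OF assms, of u] by simp
next
  case (Suc r)
  have "tcomp scale (Suc k) r f = (\<lambda>u. \<Sum>w\<in>words m n. tcomp (*) (Suc k) r (pure 1 w) u *s f w)"
    using Suc by blast
  then show "tcomp scale k (Suc r) f u = (\<Sum>w\<in>words m n. tcomp (*) k (Suc r) (pure 1 w) u *s f w)"
    by (simp only: tcomp.simps hecke_matrix[OF finite_words])
qed

lemma id_tens_sum:
  assumes "f \<in> tens m n"
  shows "id_tens scale L f u = (\<Sum>w\<in>words m n. L (pure 1 w) u *s f w)"
  unfolding id_tens_def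
  by (rule sum.mono_neutral_left) (use tens_eq_0[OF assms] in \<open>auto simp: \<close>)

end

lemma R_at_comp_eq:
  assumes "f \<in> tens m n" "j + r < n"
  shows "foldr (\<circ>) (map R_at [j..<j + r]) id f = pointwise (*) ((-1) ^ r) (tcomp (*) j r f)"
  using assms(2)
proof (induction r arbitrary: j)
  case 0
  show ?case by (simp add: pointwise_def)
next
  case (Suc r)
  have upt: "[j..<j + Suc r] = j # [Suc j..<Suc j + r]" by (simp add: upt_conv_Cons)
  have IH: "foldr (\<circ>) (map R_at [Suc j..<Suc j + r]) id f
      = pointwise (*) ((-1) ^ r) (tcomp (*) (Suc j) r f)"
    by (rule Suc.IH) (use Suc.prems in simp)
  have "R_at j (pointwise (*) ((-1) ^ r) (tcomp (*) (Suc j) r f))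
      = - hecke (*) j (pointwise (*) ((-1) ^ r) (tcomp (*) (Suc j) r f))"
    by (rule R_at_eq[of _ m n])
      (use Suc.prems in \<open>simp_all add: K.tens_scale K.tcomp_tens assms(1)\<close>)
  also have "\<dots> = pointwise (*) ((-1) ^ Suc r) (tcomp (*) j (Suc r) f)"
    by (simp add: K.hecke_scale)
  finally show "foldr (\<circ>) (map R_at [j..<j + Suc r]) id f
      = pointwise (*) ((-1) ^ Suc r) (tcomp (*) j (Suc r) f)"
    by (simp only: upt list.map foldr.simps comp_apply IH)
qed

lemma d_op_eq:
  assumes "f \<in> tens m n" "1 \<le> k" "k \<le> n"
  shows "d_op k f = pointwise (*) ((-1) ^ (k - 1)) (tcomp (*) 0 (k - 1) f)"
  using R_at_comp_eq[OF assms(1), of 0 "k - 1"] assms(2,3) by (simp add: d_op_def)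

text \<open>The signs of sigma cancel against those in d_k = (-1)^(k-1) T_0 ... T_(k-2).\<close>

lemma sigma_eq:
  assumes "f \<in> tens m n"
  shows "sigma n f = hsum (*) 0 n f"
proof
  fix u
  have "sigma n f u = (\<Sum>k = 1..n. (-1) ^ (k - 1) * d_op k f u)" by (simp add: sigma_def)
  also have "\<dots> = (\<Sum>k = 1..n. tcomp (*) 0 (k - 1) f u)"
    by (intro sum.cong refl) (simp add: d_op_eq[OF assms] pointwise_def flip: mult.assoc power_mult_distrib)
  also have "\<dots> = (\<Sum>i<n. tcomp (*) 0 i f u)"
    by (rule sum.reindex_bij_witness[of _ Suc "\<lambda>k. k - 1"]) auto
  finally show "sigma n f u = hsum (*) 0 n f u" by (simp only: K.hsum_tcomp sum_fun_apply)
qed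

lemma ker_sigma_eq: "ker_sigma m n = {f \<in> tens m n. hsum (*) 0 n f = 0}"
  unfolding ker_sigma_def using sigma_eq by auto

sublocale yb_module \<subseteq> ratfun_space scale
  by unfold_locales

section \<open>The action on M and the contraction\<close>

context yb_module
begin

definition act :: "nat \<Rightarrow> 'a \<Rightarrow> 'a" where
  "act j x = RM (pure x [j])"

text \<open>The contraction R_M \<otimes> id, written with the coordinates of the first letter.\<close>

definition cap :: "(nat list \<Rightarrow> 'a) \<Rightarrow> nat list \<Rightarrow> 'a" where
  "cap f = (\<lambda>u. \<Sum>j\<in>{1..m}. act j (f (j # u)))"

lemma pure1_tens: "j \<in> {1..m} \<Longrightarrow> pure x [j] \<in> tens m 1"
  by (rule pure_tens) (simp add: words_def)

lemma act_add: "j \<in> {1..m} \<Longrightarrow> act j (x + y) = act j x + act j y"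
proof -
  assume j: "j \<in> {1..m}"
  have "pure (x + y) [j] = pure x [j] + pure y [j]" by (auto simp: pure_def fun_eq_iff)
  then show ?thesis unfolding act_def using RM_add[OF pure1_tens[OF j] pure1_tens[OF j]] by simp
qed

lemma act_scale: "j \<in> {1..m} \<Longrightarrow> act j (c *s x) = c *s act j x"
proof -
  assume j: "j \<in> {1..m}"
  have "pure (c *s x) [j] = pointwise scale c (pure x [j])"
    by (auto simp: pure_def pointwise_def fun_eq_iff)
  then show ?thesis unfolding act_def using RM_scale[OF pure1_tens[OF j]] by simp
qed

lemma act_zero: "j \<in> {1..m} \<Longrightarrow> act j 0 = 0"
  using act_scale[of j 0 0] by simp

lemma act_minus: "j \<in> {1..m} \<Longrightarrow> act j (- x) = - act j x"
  using act_scale[of j "-1" x] by simp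

lemma act_sum: "j \<in> {1..m} \<Longrightarrow> act j (\<Sum>i\<in>I. f i) = (\<Sum>i\<in>I. act j (f i))"
  by (rule additive_sum) (rule act_add)

lemma RM_zero: "RM 0 = 0"
  using RM_scale[of 0 0] by simp

lemma RM_sum:
  "(\<And>i. i \<in> I \<Longrightarrow> f i \<in> tens m 1) \<Longrightarrow> RM (\<Sum>i\<in>I. f i) = (\<Sum>i\<in>I. RM (f i))"
proof (induction I rule: infinite_finite_induct)
  case (insert i I)
  have "RM (f i + (\<Sum>i\<in>I. f i)) = RM (f i) + (\<Sum>i\<in>I. RM (f i))"
    using insert by (simp add: RM_add tens_sum)
  then show "RM (\<Sum>i\<in>insert i I. f i) = (\<Sum>i\<in>insert i I. RM (f i))"
    by (simp only: sum.insert[OF insert.hyps(1,2)])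
qed (simp_all only: sum.infinite sum.empty RM_zero not_False_eq_True)

lemma RM_eq:
  assumes "g \<in> tens m 1"
  shows "RM g = (\<Sum>j\<in>{1..m}. act j (g [j]))"
proof -
  have "g = (\<Sum>j\<in>{1..m}. pure (g [j]) [j])"
  proof
    fix u
    show "g u = (\<Sum>j\<in>{1..m}. pure (g [j]) [j]) u"
    proof (cases "\<exists>i\<in>{1..m}. u = [i]")
      case True
      then obtain i where i: "i \<in> {1..m}" "u = [i]" by blast
      have "(\<Sum>j\<in>{1..m}. pure (g [j]) [j] u) = (\<Sum>j\<in>{1..m}. if j = i then g [j] else 0)"
        by (intro sum.cong) (auto simp: pure_def i)
      then show ?thesis using i unfolding sum_fun_apply by simp
    next
      case False
      then have "u \<notin> words m 1" by (auto simp: words_def length_Suc_conv)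
      moreover have "(\<Sum>j\<in>{1..m}. pure (g [j]) [j] u) = 0"
        by (intro sum.neutral) (use False in \<open>auto simp: pure_def\<close>)
      ultimately show ?thesis using assms unfolding sum_fun_apply by (simp add: tens_eq_0)
    qed
  qed
  then have "RM g = RM (\<Sum>j\<in>{1..m}. pure (g [j]) [j])" by (rule arg_cong)
  also have "\<dots> = (\<Sum>j\<in>{1..m}. RM (pure (g [j]) [j]))"
    by (rule RM_sum) (rule pure1_tens)
  finally show ?thesis by (simp only: act_def)
qed

lemma RM_id_eq:
  assumes "g \<in> tens m n"
  shows "RM_id RM g = cap g"
proof
  fix u
  have "(\<lambda>w. if length w = 1 then g (w @ u) else 0) \<in> tens m 1"
    using assms by (auto simp: tens_iff words_def)
  then show "RM_id RM g u = cap g u" by (simp add: RM_id_def RM_eq cap_def)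
qed

lemma cap_tens: "f \<in> tens m (Suc n) \<Longrightarrow> cap f \<in> tens m n"
  unfolding tens_iff cap_def
  by (intro allI impI sum.neutral ballI) (simp add: Cons_words_iff act_zero)

lemma cap_add: "cap (f + g) = cap f + cap g"
  by (simp add: cap_def fun_eq_iff act_add sum.distrib)

lemma cap_scale: "cap (c \<cdot> f) = c \<cdot> cap f"
  by (simp add: cap_def fun_eq_iff act_scale pointwise_def scale_sum_right)

lemma id_tens_R_op:
  assumes "f \<in> tens m 2"
  shows "id_tens scale R_op f = - T 0 f"
proof
  fix u
  have "id_tens scale R_op f u = (\<Sum>w\<in>words m 2. - (hecke (*) 0 (pure 1 w) u *s f w))"
    unfolding id_tens_sum[OF assms]
  proof (rule sum.cong[OF refl])
    fix w assume "w \<in> words m 2"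
    then obtain a b where w: "w = [a, b]" by (auto simp: words_def numeral_2_eq_2 length_Suc_conv)
    show "R_op (pure 1 w) u *s f w = - (hecke (*) 0 (pure 1 w) u *s f w)"
      unfolding R_op_def lin_ext_pure w R_basis_hecke by simp
  qed
  also have "\<dots> = - T 0 (\<lambda>u. \<Sum>w\<in>words m 2. pure 1 w u *s f w) u"
    unfolding hecke_matrix[OF finite_words] by (simp add: sum_negf)
  also have "(\<lambda>u. \<Sum>w\<in>words m 2. pure 1 w u *s f w) = f"
    by (intro ext) (rule tens_expand[OF assms, symmetric])
  finally show "id_tens scale R_op f u = (- T 0 f) u" by (simp only: uminus_apply)
qed

text \<open>The wall condition at x \<otimes> v_i \<otimes> v_j with i < j reads x v_i v_j = (1 - q)
  x v_i v_j + q x v_j v_i, and q can be cancelled. \<open>W\<close> is the composite of the two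
  contractions in coordinates.\<close>

lemma act_commute_less:
  assumes "i \<in> {1..m}" "j \<in> {1..m}" "i < j"
  shows "act j (act i x) = act i (act j x)"
proof -
  define W where "W f = (\<Sum>b\<in>{1..m}. \<Sum>a\<in>{1..m}. act b (act a (f [a, b])))" for f
  have cap2: "RM (RM_id RM f) = W f" if "f \<in> tens m 2" for f
  proof -
    have "cap f \<in> tens m 1" by (rule cap_tens) (use that in \<open>simp add: numeral_2_eq_2\<close>)
    then show ?thesis unfolding RM_id_eq[OF that] RM_eq[OF \<open>cap f \<in> tens m 1\<close>]
      by (simp add: cap_def W_def act_sum)
  qed
  have W_add: "W (f + g) = W f + W g" for f g
    unfolding W_def plus_fun_apply by (simp add: act_add sum.distrib)
  have W_scale: "W (c \<cdot> f) = c *s W f" for c f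
    unfolding W_def pointwise_def by (simp add: act_scale scale_sum_right)
  have W_pure: "W (pure z [a, b]) = act b (act a z)" if "a \<in> {1..m}" "b \<in> {1..m}" for a b z
  proof -
    have "(\<Sum>a'\<in>{1..m}. act b' (act a' (pure z [a, b] [a', b']))) = (if b' = b then act b (act a z) else 0)"
      if "b' \<in> {1..m}" for b'
    proof -
      have "(\<Sum>a'\<in>{1..m}. act b' (act a' (pure z [a, b] [a', b'])))
          = (\<Sum>a'\<in>{1..m}. if a' = a then (if b' = b then act b (act a z) else 0) else 0)"
        by (rule sum.cong[OF refl]) (use that in \<open>auto simp: pure_def act_zero\<close>)
      then show ?thesis using \<open>a \<in> {1..m}\<close> by (simp add: sum.delta)
    qed
    then have "W (pure z [a, b]) = (\<Sum>b'\<in>{1..m}. if b' = b then act b (act a z) else 0)"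
      unfolding W_def by (intro sum.cong) auto
    then show ?thesis using \<open>b \<in> {1..m}\<close> by (simp add: sum.delta)
  qed
  have t: "pure z [a, b] \<in> tens m 2" if "a \<in> {1..m}" "b \<in> {1..m}" for a b and z :: 'a
    by (rule pure_tens) (use that in \<open>simp add: words_def\<close>)
  let ?f = "pure x [i, j]"
  have ft: "?f \<in> tens m 2" by (rule t) fact+
  have "- T 0 ?f = (1 - qq) \<cdot> ?f + qq \<cdot> pure x [j, i]"
  proof
    show "(- T 0 ?f) u = ((1 - qq) \<cdot> ?f + qq \<cdot> pure x [j, i]) u" for u
      by (cases u rule: remdups_adj.cases)
        (use assms(3) in \<open>auto simp: pure_def pointwise_def scale_left_diff_distrib\<close>)
  qed
  moreover have "W ?f = W (- T 0 ?f)"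
    using wall[OF ft] cap2[OF ft] cap2[of "- T 0 ?f"] id_tens_R_op[OF ft]
      tens_scale[OF hecke_tens[OF ft, of 0], of "-1"] by simp
  ultimately have "W ?f = (1 - qq) *s W ?f + qq *s W (pure x [j, i])"
    by (simp only: W_add W_scale)
  then have "qq *s (W ?f) = qq *s W (pure x [j, i])"
    by (simp only: scale_left_diff_distrib scale_one) (simp add: algebra_simps)
  then have "W ?f = W (pure x [j, i])" using qq_nonzero by simp
  then show ?thesis using W_pure assms by simp
qed

lemma act_commute:
  assumes "i \<in> {1..m}" "j \<in> {1..m}"
  shows "act i (act j x) = act j (act i x)"
  using act_commute_less[OF assms, of x] act_commute_less[OF assms(2,1), of x]
  by (cases i j rule: linorder_cases) auto

text \<open>The signs cancel as for sigma, so the differential is the contraction applied after S_0.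
  The degree must be known, because each d_i is identified with a product of T_k only on words that
  are long enough.\<close>

lemma yb_diff_eq:
  assumes "f \<in> tens m n"
  shows "yb_diff scale RM n f = cap (S 0 n f)"
proof
  fix u
  have d: "id_tens scale (d_op i) f = ((-1) ^ (i - 1)) \<cdot> tcomp scale 0 (i - 1) f"
    if "i \<in> {1..n}" for i
  proof
    fix u
    have "id_tens scale (d_op i) f u
        = (\<Sum>w\<in>words m n. ((-1) ^ (i - 1) * tcomp (*) 0 (i - 1) (pure 1 w) u) *s f w)"
      unfolding id_tens_sum[OF assms]
    proof (rule sum.cong[OF refl])
      fix w assume w: "w \<in> words m n"
      have "d_op i (pure 1 w) u = (-1) ^ (i - 1) * tcomp (*) 0 (i - 1) (pure 1 w) u"
        using d_op_eq[OF pure_tens[OF w, of 1], of i] that by (simp add: pointwise_def)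
      then show "d_op i (pure 1 w) u *s f w
          = ((-1) ^ (i - 1) * tcomp (*) 0 (i - 1) (pure 1 w) u) *s f w" by simp
    qed
    then show "id_tens scale (d_op i) f u = (((-1) ^ (i - 1)) \<cdot> tcomp scale 0 (i - 1) f) u"
      unfolding pointwise_def tcomp_matrix[OF assms] scale_sum_right scale_scale .
  qed
  have summand: "(-1) ^ (i - 1) *s RM_id RM (id_tens scale (d_op i) f) u = cap (tcomp scale 0 (i - 1) f) u"
    if "i \<in> {1..n}" for i
  proof -
    have "RM_id RM (id_tens scale (d_op i) f) = ((-1) ^ (i - 1)) \<cdot> cap (tcomp scale 0 (i - 1) f)"
      unfolding d[OF that]
      by (subst RM_id_eq[of _ n]) (simp_all only: tens_scale tcomp_tens assms cap_scale)
    then show ?thesis by (simp add: pointwise_def flip: power_mult_distrib)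
  qed
  have "yb_diff scale RM n f u = (\<Sum>i = 1..n. cap (tcomp scale 0 (i - 1) f) u)"
    unfolding yb_diff_def by (rule sum.cong[OF refl]) (rule summand)
  also have "\<dots> = (\<Sum>i<n. cap (tcomp scale 0 i f) u)"
    by (rule sum.reindex_bij_witness[of _ Suc "\<lambda>k. k - 1"]) auto
  also have "\<dots> = cap (\<Sum>i<n. tcomp scale 0 i f) u"
    unfolding additive_sum[of cap, OF cap_add] sum_fun_apply ..
  finally show "yb_diff scale RM n f u = cap (S 0 n f) u" by (simp only: hsum_tcomp)
qed

text \<open>The contraction deletes the first letter, so positions shift by one.\<close>

lemma hecke_cap: "T k (cap f) = cap (T (Suc k) f)"
proof
  fix u
  have "cap f = (\<Sum>j\<in>{1..m}. (\<lambda>u. act j (f (j # u))))"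
    by (simp only: cap_def fun_eq_iff sum_fun_apply simp_thms)
  moreover have "T k (\<lambda>u. act j (f (j # u))) u = act j (T (Suc k) f (j # u))" if "j \<in> {1..m}" for j
    using hecke_linear[of "act j" scale scale k "\<lambda>u. f (j # u)" u] act_add act_scale that by simp
  ultimately show "T k (cap f) u = cap (T (Suc k) f) u"
    by (simp only: hecke_sum sum_fun_apply cap_def cong: sum.cong)
qed

lemma hsum_cap: "S k r (cap f) = cap (S (Suc k) r f)"
proof (induction r arbitrary: k)
  case 0
  have "cap 0 = 0" using cap_scale[of 0 0] by simp
  then show "S k 0 (cap f) = cap (S (Suc k) 0 f)" by simp
next
  case (Suc r)
  show "S k (Suc r) (cap f) = cap (S (Suc k) (Suc r) f)"
    by (simp only: hsum_Suc Suc cap_add hecke_cap)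
qed

text \<open>The actions of v_i and v_j commute while the coefficient changes sign, so exchanging the
  two summation indices turns the sum into its negative.\<close>

lemma cap_cap:
  assumes "\<And>a b v. g (a # b # v) = - g (b # a # v)"
  shows "cap (cap g) = 0"
proof
  fix u
  let ?h = "\<lambda>i j. act j (act i (g (i # j # u)))"
  have "cap (cap g) u = (\<Sum>j\<in>{1..m}. \<Sum>i\<in>{1..m}. ?h i j)"
    by (simp add: cap_def act_sum)
  moreover have "(\<Sum>j\<in>{1..m}. \<Sum>i\<in>{1..m}. ?h i j) = - (\<Sum>j\<in>{1..m}. \<Sum>i\<in>{1..m}. ?h j i)"
    unfolding sum_negf[symmetric]
  proof (intro sum.cong refl)
    fix i j assume ij: "i \<in> {1..m}" "j \<in> {1..m}"
    show "?h i j = - ?h j i"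
      unfolding assms[of i j u] using ij act_commute[OF ij, of "g (j # i # u)"] by (simp add: act_minus)
  qed
  moreover have "(\<Sum>j\<in>{1..m}. \<Sum>i\<in>{1..m}. ?h j i) = (\<Sum>j\<in>{1..m}. \<Sum>i\<in>{1..m}. ?h i j)"
    by (rule sum.swap)
  ultimately have "cap (cap g) u = - cap (cap g) u" by simp
  then show "cap (cap g) u = 0 u" unfolding zero_fun_apply by (rule eq_neg_self)
qed

lemma yb_diff_tens: "f \<in> tens m (Suc n) \<Longrightarrow> yb_diff scale RM (Suc n) f \<in> tens m n"
  by (simp only: yb_diff_eq cap_tens hsum_tens)

text \<open>Moving S_0 past the first contraction gives two contractions applied to S_1 S_0 f, and
  the relation (T_0 - q) S_1 S_0 = 0 makes this tensor antisymmetric in its first two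
  letters.\<close>

lemma yb_diff_diff:
  assumes "f \<in> tens m (Suc (Suc n))"
  shows "yb_diff scale RM (Suc n) (yb_diff scale RM (Suc (Suc n)) f) = 0"
proof -
  define g where "g = S (Suc 0) (Suc n) (S 0 (Suc (Suc n)) f)"
  have gt: "g \<in> tens m (Suc (Suc n))" unfolding g_def by (intro hsum_tens assms)
  have Tg: "T 0 g = qq \<cdot> g"
    unfolding g_def by (rule hecke_hsum_hsum[of _ m]) (use assms in simp)
  have eig: "\<forall>u a b v. length u = 0 \<longrightarrow> g (u @ a # b # v) = - g (u @ b # a # v)"
    by (rule iffD1[OF hecke_eigen_iff[OF gt] Tg]) simp
  have asym: "g (a # b # v) = - g (b # a # v)" for a b v
    using eig[rule_format, of "[]" a b v] by (simp only: append_Nil list.size simp_thms)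
  have "yb_diff scale RM (Suc n) (yb_diff scale RM (Suc (Suc n)) f) = cap (cap g)"
    using yb_diff_eq[OF yb_diff_tens[OF assms]] yb_diff_eq[OF assms] hsum_cap
    by (simp only: g_def)
  moreover have "cap (cap g) = 0" by (rule cap_cap) (rule asym)
  ultimately show ?thesis by (simp only:)
qed

lemma hsum_alt_tens: "f \<in> alt_tens m n \<Longrightarrow> S 0 n f = qint n \<cdot> f"
proof -
  assume f: "f \<in> alt_tens m n"
  then have "f \<in> E m n n"
    using alt_tens_hecke[of f m n] alt_tensD(2)[OF f] by (simp add: eigenpart_def)
  from hsum_eigenpart[OF this, of 0] show ?thesis by simp
qed

lemma cap_alt_tens: "f \<in> alt_tens m (Suc n) \<Longrightarrow> cap f \<in> alt_tens m n"
proof -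
  assume f: "f \<in> alt_tens m (Suc n)"
  have "alternating (cap f)"
  proof (rule alternatingI)
    fix u v a b
    have "f (j # u @ a # b # v) = - f (j # u @ b # a # v)" for j
      using alternatingD[OF alt_tensD(1)[OF f], of "j # u" a b v] by (simp only: append_Cons)
    then show "cap f (u @ a # b # v) = - cap f (u @ b # a # v)"
      unfolding cap_def sum_negf[symmetric]
      by (intro sum.cong refl) (simp only: act_minus)
  qed
  then show ?thesis using cap_tens[OF alt_tensD(2)[OF f]] by (simp add: alt_tens_def)
qed

lemma yb_diff_alt_tens: "f \<in> alt_tens m n \<Longrightarrow> yb_diff scale RM n f = qint n \<cdot> cap f"
  using yb_diff_eq[OF alt_tensD(2)] by (simp only: hsum_alt_tens cap_scale)

end

section \<open>Modules over K and transport of structure\<close>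

lemma KK_simps [simp]:
  "carrier KK = UNIV" "\<one>\<^bsub>KK\<^esub> = 1" "x \<oplus>\<^bsub>KK\<^esub> y = x + y" "x \<otimes>\<^bsub>KK\<^esub> y = x * y" "\<zero>\<^bsub>KK\<^esub> = 0"
  by (simp_all add: KK_def)

lemma cring_KK: "cring KK"
proof (rule cringI)
  show "abelian_group KK"
    by (rule abelian_groupI) (auto simp: ac_simps intro: exI[of _ "- _"] left_minus)
  show "Group.comm_monoid KK"
    by (rule comm_monoidI) (simp_all only: KK_simps UNIV_I mult_ac mult_1_left mult_1_right)
qed (simp_all add: distrib_right)

lemma (in ratfun_space) module_mk_module:
  fixes V :: "('i \<Rightarrow> 'a) set"
  assumes "F.subspace V"
  shows "Module.module KK (mk_module (pointwise scale) V)"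
proof (rule moduleI)
  show "cring KK" by (rule cring_KK)
  show "abelian_group (mk_module (pointwise scale) V)"
  proof (rule abelian_groupI)
    fix x assume "x \<in> carrier (mk_module (pointwise scale) V)"
    then show "\<exists>y\<in>carrier (mk_module (pointwise scale) V).
        y \<oplus>\<^bsub>mk_module (pointwise scale) V\<^esub> x = \<zero>\<^bsub>mk_module (pointwise scale) V\<^esub>"
      by (intro bexI[of _ "- x"]) (auto simp: F.subspace_neg[OF assms])
  qed (use assms in \<open>auto simp: F.subspace_add F.subspace_0 ac_simps\<close>)
qed (use assms in \<open>auto simp: F.subspace_scale F.scale_left_distrib F.scale_right_distrib\<close>)

text \<open>Tensor products and direct sums come without proofs of the module axioms. A bijection
  onto a module that respects the operations supplies them, each axiom being checked after applying
  \<open>\<theta>\<close>.\<close>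

lemma module_transport:
  assumes X: "Module.module KK X"
    and bij: "bij_betw \<theta> (carrier Y) (carrier X)"
    and zero: "\<zero>\<^bsub>Y\<^esub> \<in> carrier Y" "\<theta> \<zero>\<^bsub>Y\<^esub> = \<zero>\<^bsub>X\<^esub>"
    and add: "\<And>x y. x \<in> carrier Y \<Longrightarrow> y \<in> carrier Y \<Longrightarrow> x \<oplus>\<^bsub>Y\<^esub> y \<in> carrier Y"
      "\<And>x y. x \<in> carrier Y \<Longrightarrow> y \<in> carrier Y \<Longrightarrow> \<theta> (x \<oplus>\<^bsub>Y\<^esub> y) = \<theta> x \<oplus>\<^bsub>X\<^esub> \<theta> y"
    and smult: "\<And>c x. x \<in> carrier Y \<Longrightarrow> c \<odot>\<^bsub>Y\<^esub> x \<in> carrier Y"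
      "\<And>c x. x \<in> carrier Y \<Longrightarrow> \<theta> (c \<odot>\<^bsub>Y\<^esub> x) = c \<odot>\<^bsub>X\<^esub> \<theta> x"
  shows "Module.module KK Y"
proof -
  interpret X: Module.module KK X by (rule X)
  have in_X: "\<theta> x \<in> carrier X" if "x \<in> carrier Y" for x
    using bij that by (auto simp: bij_betw_def)
  have inj: "x = y" if "x \<in> carrier Y" "y \<in> carrier Y" "\<theta> x = \<theta> y" for x y
    using bij that by (auto simp: bij_betw_def dest: inj_onD)
  show ?thesis
  proof (rule moduleI)
    show "cring KK" by (rule cring_KK)
    show "abelian_group Y"
    proof (rule abelian_groupI)
      fix x assume x: "x \<in> carrier Y"
      obtain y where y: "y \<in> carrier Y" "\<theta> y = \<ominus>\<^bsub>X\<^esub> \<theta> x"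
        using bij X.a_inv_closed[OF in_X[OF x]] by (metis bij_betw_def image_iff)
      have "y \<oplus>\<^bsub>Y\<^esub> x = \<zero>\<^bsub>Y\<^esub>"
        by (rule inj) (simp_all add: add zero x y in_X X.l_neg)
      then show "\<exists>y\<in>carrier Y. y \<oplus>\<^bsub>Y\<^esub> x = \<zero>\<^bsub>Y\<^esub>" using y(1) by blast
    qed (auto intro!: inj simp: add zero in_X X.a_ac)
  next
    fix a b :: ratfun and x assume x: "x \<in> carrier Y"
    show "a \<odot>\<^bsub>Y\<^esub> x \<in> carrier Y" using x by (rule smult)
    show "(a \<oplus>\<^bsub>KK\<^esub> b) \<odot>\<^bsub>Y\<^esub> x = a \<odot>\<^bsub>Y\<^esub> x \<oplus>\<^bsub>Y\<^esub> b \<odot>\<^bsub>Y\<^esub> x"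
      by (rule inj) (use X.smult_l_distr[of a b "\<theta> x"] in \<open>simp_all add: add smult in_X x\<close>)
    show "(a \<otimes>\<^bsub>KK\<^esub> b) \<odot>\<^bsub>Y\<^esub> x = a \<odot>\<^bsub>Y\<^esub> (b \<odot>\<^bsub>Y\<^esub> x)"
      by (rule inj) (use X.smult_assoc1[of a b "\<theta> x"] in \<open>simp_all add: smult in_X x\<close>)
    show "\<one>\<^bsub>KK\<^esub> \<odot>\<^bsub>Y\<^esub> x = x"
      by (rule inj) (use X.smult_one[of "\<theta> x"] in \<open>simp_all add: smult in_X x\<close>)
  next
    fix a :: ratfun and x y assume xy: "x \<in> carrier Y" "y \<in> carrier Y"
    show "a \<odot>\<^bsub>Y\<^esub> (x \<oplus>\<^bsub>Y\<^esub> y) = a \<odot>\<^bsub>Y\<^esub> x \<oplus>\<^bsub>Y\<^esub> a \<odot>\<^bsub>Y\<^esub> y"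
      by (rule inj) (use X.smult_r_distr[of a "\<theta> x" "\<theta> y"] in \<open>simp_all add: add smult in_X xy\<close>)
  qed
qed

text \<open>Only X has to be verified as a complex; Y inherits this property. For this reason
  \<open>\<theta>\<close> runs from Y to X, and the isomorphism claimed is its inverse.\<close>

lemma cplx_iso_transport:
  assumes X: "is_cplx X"
    and bij: "\<And>n. bij_betw (\<theta> n) (carrier (fst Y n)) (carrier (fst X n))"
    and zero: "\<And>n. \<zero>\<^bsub>fst Y n\<^esub> \<in> carrier (fst Y n)" "\<And>n. \<theta> n \<zero>\<^bsub>fst Y n\<^esub> = \<zero>\<^bsub>fst X n\<^esub>"
    and add: "\<And>n x y. x \<in> carrier (fst Y n) \<Longrightarrow> y \<in> carrier (fst Y n) \<Longrightarrow>
        x \<oplus>\<^bsub>fst Y n\<^esub> y \<in> carrier (fst Y n)"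
      "\<And>n x y. x \<in> carrier (fst Y n) \<Longrightarrow> y \<in> carrier (fst Y n) \<Longrightarrow>
        \<theta> n (x \<oplus>\<^bsub>fst Y n\<^esub> y) = \<theta> n x \<oplus>\<^bsub>fst X n\<^esub> \<theta> n y"
    and smult: "\<And>n c x. x \<in> carrier (fst Y n) \<Longrightarrow> c \<odot>\<^bsub>fst Y n\<^esub> x \<in> carrier (fst Y n)"
      "\<And>n c x. x \<in> carrier (fst Y n) \<Longrightarrow> \<theta> n (c \<odot>\<^bsub>fst Y n\<^esub> x) = c \<odot>\<^bsub>fst X n\<^esub> \<theta> n x"
    and diff: "\<And>n x. x \<in> carrier (fst Y (Suc n)) \<Longrightarrow> snd Y (Suc n) x \<in> carrier (fst Y n)"
      "\<And>n x. x \<in> carrier (fst Y (Suc n)) \<Longrightarrow>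
        \<theta> n (snd Y (Suc n) x) = snd X (Suc n) (\<theta> (Suc n) x)"
  shows "cplx_iso X Y"
proof -
  have modX: "Module.module KK (fst X n)" for n using X by (simp add: is_cplx_def)
  have linX: "linear_map (fst X (Suc n)) (fst X n) UNIV (snd X (Suc n))" for n
    using X by (simp add: is_cplx_def)
  have modY: "Module.module KK (fst Y n)" for n
    by (rule module_transport[OF modX[of n] bij[of n]]) (fact zero add smult)+
  have in_X: "\<theta> n x \<in> carrier (fst X n)" if "x \<in> carrier (fst Y n)" for n x
    using bij that by (auto simp: bij_betw_def)
  have inj: "x = y" if "x \<in> carrier (fst Y n)" "y \<in> carrier (fst Y n)" "\<theta> n x = \<theta> n y" for n x y
    using bij[of n] that by (auto simp: bij_betw_def dest: inj_onD)
  have Y: "is_cplx Y"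
    unfolding is_cplx_def
  proof (intro conjI allI ballI)
    show "Module.module KK (fst Y n)" for n by (rule modY)
    show "linear_map (fst Y (Suc n)) (fst Y n) UNIV (snd Y (Suc n))" for n
      unfolding linear_map_def
    proof (intro conjI ballI funcsetI)
      fix x assume x: "x \<in> carrier (fst Y (Suc n))"
      show "snd Y (Suc n) x \<in> carrier (fst Y n)" using x by (rule diff)
      show "snd Y (Suc n) (c \<odot>\<^bsub>fst Y (Suc n)\<^esub> x) = c \<odot>\<^bsub>fst Y n\<^esub> snd Y (Suc n) x" for c
        by (rule inj[of _ n])
          (use linX[of n] x in \<open>simp_all add: diff smult in_X linear_map_def\<close>)
      fix x' assume x': "x' \<in> carrier (fst Y (Suc n))"
      show "snd Y (Suc n) (x \<oplus>\<^bsub>fst Y (Suc n)\<^esub> x') = snd Y (Suc n) x \<oplus>\<^bsub>fst Y n\<^esub> snd Y (Suc n) x'"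
        by (rule inj[of _ n])
          (use linX[of n] x x' in \<open>simp_all add: diff add in_X linear_map_def\<close>)
    qed
    show "snd Y (Suc n) (snd Y (Suc (Suc n)) x) = \<zero>\<^bsub>fst Y n\<^esub>"
      if "x \<in> carrier (fst Y (Suc (Suc n)))" for n x
    proof (rule inj[of _ n])
      show "\<theta> n (snd Y (Suc n) (snd Y (Suc (Suc n)) x)) = \<theta> n \<zero>\<^bsub>fst Y n\<^esub>"
        using X in_X[OF that] that by (simp add: diff zero is_cplx_def)
    qed (simp_all add: diff zero that)
  qed
  define \<phi> where "\<phi> n = inv_into (carrier (fst Y n)) (\<theta> n)" for n
  have bij': "bij_betw (\<phi> n) (carrier (fst X n)) (carrier (fst Y n))" for n
    unfolding \<phi>_def by (rule bij_betw_inv_into[OF bij])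
  have in_Y: "\<phi> n x \<in> carrier (fst Y n)" if "x \<in> carrier (fst X n)" for n x
    using bij' that by (auto simp: bij_betw_def)
  have \<theta>\<phi>: "\<theta> n (\<phi> n x) = x" if "x \<in> carrier (fst X n)" for n x
    unfolding \<phi>_def by (rule bij_betw_inv_into_right[OF bij that])
  have eqI: "\<phi> n x = y" if "x \<in> carrier (fst X n)" "y \<in> carrier (fst Y n)" "\<theta> n y = x" for n x y
    using inj[OF in_Y[OF that(1)] that(2)] \<theta>\<phi>[OF that(1)] that(3) by simp
  have lin: "linear_map (fst X n) (fst Y n) UNIV (\<phi> n)" for n
  proof -
    interpret X: Module.module KK "fst X n" by (rule modX)
    show ?thesis unfolding linear_map_def
    proof (intro conjI ballI)
      show "\<phi> n \<in> carrier (fst X n) \<rightarrow> carrier (fst Y n)" using in_Y by blast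
    next
      fix x x' assume "x \<in> carrier (fst X n)" "x' \<in> carrier (fst X n)"
      then show "\<phi> n (x \<oplus>\<^bsub>fst X n\<^esub> x') = \<phi> n x \<oplus>\<^bsub>fst Y n\<^esub> \<phi> n x'"
        by (intro eqI) (simp_all add: add in_Y \<theta>\<phi>)
    next
      fix c :: ratfun and x assume "x \<in> carrier (fst X n)"
      then show "\<phi> n (c \<odot>\<^bsub>fst X n\<^esub> x) = c \<odot>\<^bsub>fst Y n\<^esub> \<phi> n x"
        by (intro eqI) (simp_all add: smult in_Y \<theta>\<phi>)
    qed
  qed
  have chain: "\<phi> n (snd X (Suc n) x) = snd Y (Suc n) (\<phi> (Suc n) x)"
    if "x \<in> carrier (fst X (Suc n))" for n x
  proof (rule eqI)
    show "snd X (Suc n) x \<in> carrier (fst X n)" using linX[of n] that by (auto simp: linear_map_def)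
  qed (simp_all add: diff in_Y \<theta>\<phi> that)
  show ?thesis
    unfolding cplx_iso_def
  proof (intro conjI exI[of _ \<phi>] allI ballI)
    show "\<phi> n (snd X (Suc n) x) = snd Y (Suc n) (\<phi> (Suc n) x)" if "x \<in> carrier (fst X (Suc n))" for n x
      using that by (rule chain)
  qed (fact X Y lin bij')+
qed

context yb_module
begin

lemma subspace_tens: "F.subspace (tens m n :: (nat list \<Rightarrow> 'a) set)"
  by (simp add: F.subspace_def tens_add tens_scale)

lemma yb_diff_linear:
  assumes "f \<in> tens m n" "g \<in> tens m n"
  shows "yb_diff scale RM n (f + g) = yb_diff scale RM n f + yb_diff scale RM n g"
    "yb_diff scale RM n (c \<cdot> f) = c \<cdot> yb_diff scale RM n f"
  using assms
  by (simp_all only: yb_diff_eq tens_add tens_scale hsum_add hsum_scale cap_add cap_scale)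

lemma is_cplx_yb: "is_cplx (yb_complex m scale RM)"
  unfolding is_cplx_def yb_complex_def fst_conv snd_conv
proof (intro conjI allI ballI)
  show "Module.module KK (mk_module (pointwise scale) (tens m n))" for n
    by (rule module_mk_module[OF subspace_tens])
  show "linear_map (mk_module (pointwise scale) (tens m (Suc n))) (mk_module (pointwise scale) (tens m n)) UNIV
      (yb_diff scale RM (Suc n))" for n
    unfolding linear_map_def by (auto simp: yb_diff_tens yb_diff_linear)
  show "yb_diff scale RM (Suc n) (yb_diff scale RM (Suc (Suc n)) f) = \<zero>\<^bsub>mk_module (pointwise scale) (tens m n)\<^esub>"
    if "f \<in> carrier (mk_module (pointwise scale) (tens m (Suc (Suc n))))" for n f
    using yb_diff_diff[of f n] that by simp
qed

lemma is_cplx_finite: "is_cplx (finite_complex m scale RM)"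
  unfolding is_cplx_def finite_complex_def fst_conv snd_conv M_bracket_eq
proof (intro conjI allI ballI)
  show "Module.module KK (mk_module (pointwise scale) (alt_tens m n))" for n
    by (rule module_mk_module[OF subspace_alt_tens])
  show "linear_map (mk_module (pointwise scale) (alt_tens m (Suc n))) (mk_module (pointwise scale) (alt_tens m n)) UNIV
      (yb_diff scale RM (Suc n))" for n
    unfolding linear_map_def
    by (auto simp: yb_diff_alt_tens alt_tens_scale cap_alt_tens cap_scale mult.commute yb_diff_linear[OF alt_tensD(2) alt_tensD(2)]
        simp del: qint.simps)
  show "yb_diff scale RM (Suc n) (yb_diff scale RM (Suc (Suc n)) f) = \<zero>\<^bsub>mk_module (pointwise scale) (alt_tens m n)\<^esub>"
    if "f \<in> carrier (mk_module (pointwise scale) (alt_tens m (Suc (Suc n))))" for n f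
    using yb_diff_diff[OF alt_tensD(2), of f n] that by simp
qed

end

section \<open>The factorisation of E_p as a tensor product\<close>

lemma finite_basis_ker_sigma:
  obtains C where "finite C" "C \<subseteq> ker_sigma m r" "K.F.independent C" "ker_sigma m r \<subseteq> K.F.span C"
proof -
  obtain C where C: "C \<subseteq> ker_sigma m r" "K.F.independent C" "ker_sigma m r \<subseteq> K.F.span C"
    using K.F.maximal_independent_subset[of "ker_sigma m r"] by metis
  have "C \<subseteq> K.F.span (pure 1 ` words m r)"
  proof
    fix f assume "f \<in> C"
    then have f: "f \<in> tens m r" using C(1) by (auto simp: ker_sigma_def)
    have "f = (\<Sum>w\<in>words m r. pointwise (*) (f w) (pure 1 w))"
    proof
      show "f u = (\<Sum>w\<in>words m r. pointwise (*) (f w) (pure 1 w)) u" for u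
        by (rule trans[OF K.tens_expand[OF f]]) (simp add: sum_fun_apply pointwise_def mult.commute)
    qed
    also have "\<dots> \<in> K.F.span (pure 1 ` words m r)"
      by (intro K.F.span_sum K.F.span_scale K.F.span_base imageI)
    finally show "f \<in> K.F.span (pure 1 ` words m r)" .
  qed
  then have "finite C"
    using K.F.independent_span_bound[OF _ C(2)] by (metis finite_imageI finite_words)
  then show ?thesis using C that by blast
qed

lemma subspace_ker_sigma: "K.F.subspace (ker_sigma m r)"
  unfolding ker_sigma_eq K.F.subspace_def
  by (auto simp: K.tens_add K.tens_scale K.hsum_add K.hsum_scale)

text \<open>Concatenation with a vector-valued left factor; as that factor has known degree p, no
  sum over the cuts of a word is needed, in contrast to \<open>conc\<close>.\<close>

definition tmul ::
    "(ratfun \<Rightarrow> 'a \<Rightarrow> 'a) \<Rightarrow> nat \<Rightarrow> (nat list \<Rightarrow> 'a) \<Rightarrow> (nat list \<Rightarrow> ratfun) \<Rightarrow> nat list \<Rightarrow> 'a" where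
  "tmul s p f b = (\<lambda>w. s (b (drop p w)) (f (take p w)))"

lemma tmul_append: "length u = p \<Longrightarrow> tmul s p f b (u @ v) = s (b v) (f u)"
  by (simp add: tmul_def)

context ratfun_space
begin

text \<open>Reduces statements about M-valued functions on words to statements about scalar ones.\<close>

lemma coordinate_functionals:
  "\<exists>\<rho> :: 'a \<Rightarrow> 'a \<Rightarrow> ratfun. (\<forall>e x y. \<rho> (x + y) e = \<rho> x e + \<rho> y e) \<and> (\<forall>e c x. \<rho> (c *s x) e = c * \<rho> x e) \<and>
    (\<forall>x. finite {e. \<rho> x e \<noteq> 0}) \<and> (\<forall>x. (\<Sum>e | \<rho> x e \<noteq> 0. \<rho> x e *s e) = x)"
proof -
  obtain C where C: "independent C" "UNIV \<subseteq> span C"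
    using maximal_independent_subset[of UNIV] by metis
  then have span: "x \<in> span C" for x by blast
  show ?thesis
    by (rule exI[of _ "representation C"])
      (simp add: representation_add representation_scale C(1) span finite_representation
        sum_nonzero_representation_eq)
qed

text \<open>Coordinate functionals turn a relation with coefficients in the vector space into scalar
  relations among the elements of C.\<close>

lemma independent_coefficients:
  fixes C :: "(nat list \<Rightarrow> ratfun) set"
  assumes "finite C" "K.F.independent C" "\<And>v. (\<Sum>c\<in>C. c v *s x c) = 0" "c \<in> C"
  shows "x c = 0"
proof -
  obtain \<rho> :: "'a \<Rightarrow> 'a \<Rightarrow> ratfun" where \<rho>_all:
    "(\<forall>e x y. \<rho> (x + y) e = \<rho> x e + \<rho> y e) \<and> (\<forall>e c x. \<rho> (c *s x) e = c * \<rho> x e) \<and>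
      (\<forall>x. finite {e. \<rho> x e \<noteq> 0}) \<and> (\<forall>x. (\<Sum>e | \<rho> x e \<noteq> 0. \<rho> x e *s e) = x)"
    using coordinate_functionals ..
  note \<rho> = \<rho>_all[THEN conjunct1, rule_format] \<rho>_all[THEN conjunct2, THEN conjunct1, rule_format]
    \<rho>_all[THEN conjunct2, THEN conjunct2, THEN conjunct1, rule_format]
    \<rho>_all[THEN conjunct2, THEN conjunct2, THEN conjunct2, rule_format]
  have "\<rho> (x c) e = 0" for e
  proof -
    have \<rho>_sum: "\<rho> (\<Sum>i\<in>I. f i) e = (\<Sum>i\<in>I. \<rho> (f i) e)" for I :: "(nat list \<Rightarrow> ratfun) set" and f
      by (rule additive_sum[of "\<lambda>x. \<rho> x e", OF \<rho>(1)])
    have "(\<Sum>c\<in>C. pointwise (*) (\<rho> (x c) e) c) = 0"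
    proof
      fix v
      have "(\<Sum>c\<in>C. \<rho> (x c) e * c v) = \<rho> (\<Sum>c\<in>C. c v *s x c) e"
        by (rule trans[OF _ \<rho>_sum[symmetric]]) (simp only: \<rho>(2) mult.commute)
      also have "\<dots> = 0" unfolding assms(3) using \<rho>(2)[of 0 0 e] by simp
      finally show "(\<Sum>c\<in>C. pointwise (*) (\<rho> (x c) e) c) v = 0 v"
        by (simp add: sum_fun_apply pointwise_def)
    qed
    then show ?thesis
      using K.F.independentD[OF assms(2,1) subset_refl _ assms(4), of "\<lambda>c. \<rho> (x c) e"] by blast
  qed
  then show ?thesis using \<rho>(4)[of "x c"] by simp
qed

text \<open>Sigma commutes with functionals on the coefficients, so each coordinate of h lies in the
  scalar kernel and expands in C; the coefficients are then reassembled into vectors.\<close>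

lemma kernel_coefficients:
  assumes C: "finite C" "K.F.independent C" "ker_sigma m r \<subseteq> K.F.span C"
    and h: "h \<in> tens m r" "S 0 r h = 0"
  shows "\<exists>x. \<forall>v. h v = (\<Sum>c\<in>C. c v *s x c)"
proof -
  obtain \<rho> :: "'a \<Rightarrow> 'a \<Rightarrow> ratfun" where \<rho>_all:
    "(\<forall>e x y. \<rho> (x + y) e = \<rho> x e + \<rho> y e) \<and> (\<forall>e c x. \<rho> (c *s x) e = c * \<rho> x e) \<and>
      (\<forall>x. finite {e. \<rho> x e \<noteq> 0}) \<and> (\<forall>x. (\<Sum>e | \<rho> x e \<noteq> 0. \<rho> x e *s e) = x)"
    using coordinate_functionals ..
  note \<rho> = \<rho>_all[THEN conjunct1, rule_format] \<rho>_all[THEN conjunct2, THEN conjunct1, rule_format]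
    \<rho>_all[THEN conjunct2, THEN conjunct2, THEN conjunct1, rule_format]
    \<rho>_all[THEN conjunct2, THEN conjunct2, THEN conjunct2, rule_format]
  have \<rho>0: "\<rho> 0 e = 0" for e using \<rho>(2)[of 0 0 e] by simp
  \<comment> \<open>Finitely many basis vectors suffice, since h has finitely many nonzero
    values.\<close>
  define D where "D = (\<Union>v\<in>words m r. {e. \<rho> (h v) e \<noteq> 0})"
  have D: "finite D" unfolding D_def using \<rho>(3) by simp
  have h_D: "h v = (\<Sum>e\<in>D. \<rho> (h v) e *s e)" for v
  proof (cases "v \<in> words m r")
    case True
    have "(\<Sum>e\<in>D. \<rho> (h v) e *s e) = (\<Sum>e | \<rho> (h v) e \<noteq> 0. \<rho> (h v) e *s e)"
      by (rule sum.mono_neutral_right) (use D True in \<open>auto simp: D_def\<close>)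
    then show ?thesis using \<rho>(4) by simp
  next
    case False
    then show ?thesis using tens_eq_0[OF h(1) False] by (simp add: \<rho>0)
  qed
  have ker: "(\<lambda>v. \<rho> (h v) e) \<in> ker_sigma m r" for e
  proof -
    have "hsum (*) 0 r (\<lambda>v. \<rho> (h v) e) v = \<rho> (S 0 r h v) e" for v
      by (rule hsum_linear[of "\<lambda>x. \<rho> x e" scale "(*)"]) (simp_all add: \<rho>)
    then have "hsum (*) 0 r (\<lambda>v. \<rho> (h v) e) = 0" by (simp add: h(2) \<rho>0 fun_eq_iff)
    moreover have "(\<lambda>v. \<rho> (h v) e) \<in> tens m r" using h(1) by (simp add: tens_iff \<rho>0)
    ultimately show ?thesis unfolding ker_sigma_eq by blast
  qed
  define \<mu> where "\<mu> e = K.F.representation C (\<lambda>v. \<rho> (h v) e)" for e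
  have \<mu>: "\<rho> (h v) e = (\<Sum>c\<in>C. \<mu> e c * c v)" for e v
  proof -
    have "(\<Sum>c\<in>C. pointwise (*) (\<mu> e c) c) = (\<lambda>v. \<rho> (h v) e)"
      unfolding \<mu>_def
      by (rule K.F.sum_representation_eq[OF C(2) _ C(1) subset_refl]) (use ker C(3) in blast)
    from fun_cong[OF this, of v] show ?thesis by (simp add: sum_fun_apply pointwise_def)
  qed
  have "h v = (\<Sum>c\<in>C. c v *s (\<Sum>e\<in>D. \<mu> e c *s e))" for v
  proof -
    have "h v = (\<Sum>e\<in>D. \<Sum>c\<in>C. (c v * \<mu> e c) *s e)"
      by (rule trans[OF h_D]) (simp add: \<mu> scale_sum_left mult.commute)
    also have "\<dots> = (\<Sum>c\<in>C. c v *s (\<Sum>e\<in>D. \<mu> e c *s e))"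
      by (subst sum.swap) (simp add: scale_sum_right)
    finally show ?thesis .
  qed
  then show ?thesis by (intro exI allI)
qed

lemma tmul_tens:
  assumes "f \<in> tens m p" "b \<in> tens m r"
  shows "tmul scale p f b \<in> tens m (p + r)"
  unfolding tens_iff
proof (intro allI impI)
  fix w assume w: "w \<notin> words m (p + r)"
  have "take p w \<notin> words m p \<or> drop p w \<notin> words m r"
  proof (rule ccontr)
    assume "\<not> ?thesis"
    then have "take p w @ drop p w \<in> words m (p + r)"
      by (subst append_words_iff) (auto simp: words_def)
    then show False using w by simp
  qed
  then show "tmul scale p f b w = 0"
    using tens_eq_0[OF assms(1), of "take p w"] tens_eq_0[OF assms(2), of "drop p w"]
    by (auto simp: tmul_def)
qed

lemma hsum_tmul_ker:
  assumes f: "f \<in> tens m p" and b: "b \<in> ker_sigma m r"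
  shows "S p r (tmul scale p f b) = 0"
proof
  have bt: "b \<in> tens m r" and b0: "hsum (*) 0 r b = 0" using b unfolding ker_sigma_eq by blast+
  have t: "tmul scale p f b \<in> tens m (p + r)" by (rule tmul_tens[OF f bt])
  fix w
  show "S p r (tmul scale p f b) w = 0 w"
  proof (cases "length w = p + r")
    case True
    define u v where "u = take p w" "v = drop p w"
    have w: "w = u @ v" and u: "length u = p" using True by (simp_all add: u_v_def)
    have "S p r (tmul scale p f b) w = S 0 r (\<lambda>v. b v *s f u) v"
      using hsum_append[of u 0 r "tmul scale p f b" v] u w by (simp add: tmul_append)
    also have "\<dots> = hsum (*) 0 r b v *s f u"
      by (rule hsum_linear[of "\<lambda>c. c *s f u" "(*)" scale]) (simp_all add: scale_left_distrib)
    finally show ?thesis by (simp add: b0)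
  next
    case False
    then show ?thesis using tens_length[OF hsum_tens[OF t]] by simp
  qed
qed

lemma tmul_eigenpart:
  assumes f: "f \<in> alt_tens m p" and b: "b \<in> ker_sigma m r"
  shows "tmul scale p f b \<in> E m (p + r) p"
proof -
  have bt: "b \<in> tens m r" using b unfolding ker_sigma_eq by blast
  have t: "tmul scale p f b \<in> tens m (p + r)" by (rule tmul_tens[OF alt_tensD(2)[OF f] bt])
  have "T j (tmul scale p f b) = qq \<cdot> tmul scale p f b" if j: "Suc j < p" for j
  proof (subst hecke_eigen_iff[OF t])
    show "Suc j < p + r" using j by simp
    show "\<forall>u x y v. length u = j \<longrightarrow>
        tmul scale p f b (u @ x # y # v) = - tmul scale p f b (u @ y # x # v)"
    proof (intro allI impI)
      fix u v :: "nat list" and x y assume u: "length u = j"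
      have p: "p = length u + Suc (Suc (p - Suc (Suc j)))" using u j by simp
      have tk: "take p (u @ x # y # v) = u @ x # y # take (p - Suc (Suc j)) v"
        "drop p (u @ x # y # v) = drop (p - Suc (Suc j)) v" for x y
        by (subst p, simp)+
      show "tmul scale p f b (u @ x # y # v) = - tmul scale p f b (u @ y # x # v)"
        unfolding tmul_def tk
        by (subst alternatingD[OF alt_tensD(1)[OF f]]) simp
    qed
  qed
  moreover have "S p r (tmul scale p f b) = 0" by (rule hsum_tmul_ker[OF alt_tensD(2)[OF f] b])
  ultimately show ?thesis using t by (simp add: eigenpart_def)
qed

lemma subspace_eigenpart: "F.subspace (E m n p)"
  by (auto simp: F.subspace_def eigenpart_def tens_add tens_scale hecke_add hecke_scale hsum_add hsum_scale
      F.scale_right_distrib mult.commute)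

text \<open>Fixing the last letters leaves an alternating tensor in the first p ones. The guard on
  the length makes it homogeneous of degree p even when v has the wrong length.\<close>

lemma eigenpart_slice_alt:
  assumes "y \<in> E m (p + r) p"
  shows "(\<lambda>u. if length u = p then y (u @ v) else 0) \<in> alt_tens m p"
proof (cases "v \<in> words m r")
  case True
  let ?g = "\<lambda>u. if length u = p then y (u @ v) else 0"
  have yt: "y \<in> tens m (p + r)" using assms by (simp add: eigenpart_def)
  have "?g \<in> tens m p"
    unfolding tens_iff
  proof (intro allI impI)
    fix w assume "w \<notin> words m p"
    then show "?g w = 0" using tens_eq_0[OF yt, of "w @ v"] append_words_iff[of w p v m r] by auto
  qed
  moreover have "alternating ?g"
  proof (rule alternatingI)
    fix u v' :: "nat list" and a b
    show "?g (u @ a # b # v') = - ?g (u @ b # a # v')"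
    proof (cases "length (u @ a # b # v') = p")
      case True
      then have j: "Suc (length u) < p" by simp
      have "T (length u) y = qq \<cdot> y" using assms j by (simp add: eigenpart_def)
      from iffD1[OF hecke_eigen_iff[OF yt] this] j
      have "y (u @ a # b # (v' @ v)) = - y (u @ b # a # (v' @ v))" by (metis trans_less_add1)
      then show ?thesis using True by simp
    qed simp
  qed
  ultimately show ?thesis by (simp add: alt_tens_def)
next
  case False
  have yt: "y \<in> tens m (p + r)" using assms by (simp add: eigenpart_def)
  have "(\<lambda>u. if length u = p then y (u @ v) else 0) = 0"
  proof
    show "(if length u = p then y (u @ v) else 0) = 0 u" for u
      using tens_eq_0[OF yt, of "u @ v"] append_words_iff[of u p v m r] False by auto
  qed
  then show ?thesis by (simp only: alt_tens_zero)
qed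

text \<open>Expand in the first p letters along increasing words, and each slice, which is killed by
  S_0, along C; exchanging the two sums collects the left factor of each c.\<close>

lemma eigenpart_tmul:
  assumes C: "finite C" "C \<subseteq> ker_sigma m r" "K.F.independent C" "ker_sigma m r \<subseteq> K.F.span C"
    and y: "y \<in> E m (p + r) p"
  shows "\<exists>a. (\<forall>c\<in>C. a c \<in> alt_tens m p) \<and> y = (\<Sum>c\<in>C. tmul scale p (a c) c)"
proof -
  have yt: "y \<in> tens m (p + r)" and y0: "S p r y = 0" using y by (simp_all add: eigenpart_def)
  have ker: "\<exists>x. \<forall>v. y (u @ v) = (\<Sum>c\<in>C. c v *s x c)" if "length u = p" for u
  proof (rule kernel_coefficients[OF C(1,3,4)])
    show "(\<lambda>v. y (u @ v)) \<in> tens m r" by (rule tens_slices[OF yt that])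
    show "S 0 r (\<lambda>v. y (u @ v)) = 0"
    proof
      show "S 0 r (\<lambda>v. y (u @ v)) v = 0 v" for v
        using hsum_append[of u 0 r y v] that y0 by simp
    qed
  qed
  have len: "length (sl A) = p" if "A \<in> nsubsets m p" for A
    using sl_words[OF that] by (simp add: words_def)
  have "\<forall>A\<in>nsubsets m p. \<exists>x. \<forall>v. y (sl A @ v) = (\<Sum>c\<in>C. c v *s x c)"
    using ker len by blast
  then obtain x where x: "\<And>A v. A \<in> nsubsets m p \<Longrightarrow> y (sl A @ v) = (\<Sum>c\<in>C. c v *s x A c)"
    by metis
  define a where "a c = (\<lambda>u. \<Sum>A\<in>nsubsets m p. bracket (sl A) u *s x A c)" for c
  have a: "a c \<in> alt_tens m p" for c unfolding a_def by (rule bracket_expansion_alt_tens)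
  have "y w = (\<Sum>c\<in>C. tmul scale p (a c) c) w" for w
  proof (cases "length w = p + r")
    case True
    define u v where "u = take p w" "v = drop p w"
    have w: "w = u @ v" and u: "length u = p" using True by (simp_all add: u_v_def)
    have "y (u @ v) = (\<Sum>A\<in>nsubsets m p. bracket (sl A) u *s y (sl A @ v))"
      using alt_tens_expand[OF eigenpart_slice_alt[OF y, of v], of u] u len by simp
    also have "\<dots> = (\<Sum>A\<in>nsubsets m p. \<Sum>c\<in>C. c v *s (bracket (sl A) u *s x A c))"
      by (rule sum.cong[OF refl]) (simp add: x scale_sum_right mult.commute)
    also have "\<dots> = (\<Sum>c\<in>C. c v *s a c u)"
      by (subst sum.swap) (simp add: a_def scale_sum_right)
    finally show ?thesis unfolding w by (simp add: sum_fun_apply tmul_append u)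
  next
    case False
    have "(\<Sum>c\<in>C. tmul scale p (a c) c) \<in> tens m (p + r)"
      using C(2) by (intro tens_sum tmul_tens alt_tensD(2)[OF a]) (auto simp: ker_sigma_def)
    then show ?thesis using tens_length[OF yt False] tens_length[OF _ False] by simp
  qed
  then show ?thesis using a by (intro exI[of _ a]) auto
qed

lemma tmul_independent:
  assumes C: "finite C" "K.F.independent C"
    and a: "\<And>c. c \<in> C \<Longrightarrow> a c \<in> alt_tens m p" and sum: "(\<Sum>c\<in>C. tmul scale p (a c) c) = 0"
    and c: "c \<in> C"
  shows "a c = 0"
proof
  fix u
  show "a c u = 0 u"
  proof (cases "length u = p")
    case True
    have "(\<Sum>c\<in>C. c v *s a c u) = 0" for v
      using fun_cong[OF sum, of "u @ v"] by (simp add: sum_fun_apply tmul_append True)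
    from independent_coefficients[OF C this c] show ?thesis by simp
  next
    case False
    then show ?thesis using tens_length[OF alt_tensD(2)[OF a[OF c]]] by simp
  qed
qed

lemma tmul_add_left: "tmul scale p (f + f') b = tmul scale p f b + tmul scale p f' b"
  by (simp add: tmul_def fun_eq_iff scale_right_distrib)

lemma tmul_add_right: "tmul scale p f (b + b') = tmul scale p f b + tmul scale p f b'"
  by (simp add: tmul_def fun_eq_iff scale_left_distrib)

lemma tmul_scale_left: "tmul scale p (c \<cdot> f) b = c \<cdot> tmul scale p f b"
  by (simp add: tmul_def fun_eq_iff pointwise_def mult.commute)

lemma tmul_scale_right: "tmul scale p f (pointwise (*) c b) = c \<cdot> tmul scale p f b"
  by (simp add: tmul_def fun_eq_iff pointwise_def)

lemma module_pair_tmul: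
  "module_pair KK (pointwise scale) (alt_tens m p) (pointwise (*)) (ker_sigma m r)"
  by unfold_locales
    (auto simp: alt_tens_zero alt_tens_diff alt_tens_scale K.F.subspace_0 K.F.subspace_diff
      K.F.subspace_scale subspace_ker_sigma)

lemma balanced_tmul:
  "module_pair.balanced KK (pointwise scale) (alt_tens m p) (pointwise (*)) (ker_sigma m r) (tmul scale p)"
  unfolding module_pair.balanced_def[OF module_pair_tmul]
  by (simp add: tmul_add_left tmul_add_right tmul_scale_left tmul_scale_right)

text \<open>With these data \<open>tlift_bij\<close> identifies (M \<otimes> [V]_p) \<otimes> ker
  sigma_r with E_p in degree p + r.\<close>

lemma module_pair_basis_tmul:
  obtains C where "module_pair_basis KK (pointwise scale) (alt_tens m p) (pointwise (*)) (ker_sigma m r)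
    C (\<lambda>c. c) (tmul scale p) (E m (p + r) p)"
proof -
  obtain C where C: "finite C" "C \<subseteq> ker_sigma m r" "K.F.independent C" "ker_sigma m r \<subseteq> K.F.span C"
    by (rule finite_basis_ker_sigma)
  have "module_pair_basis KK (pointwise scale) (alt_tens m p) (pointwise (*)) (ker_sigma m r)
    C (\<lambda>c. c) (tmul scale p) (E m (p + r) p)"
  proof (rule module_pair_basis.intro[OF module_pair_tmul], unfold_locales)
    show "finite C" by (rule C)
    show "c \<in> C \<Longrightarrow> c \<in> ker_sigma m r" for c using C(2) by blast
    show "\<exists>c. (\<forall>j\<in>C. c j \<in> carrier KK) \<and> b = (\<Sum>j\<in>C. pointwise (*) (c j) j)"
      if "b \<in> ker_sigma m r" for b
    proof (intro exI conjI ballI)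
      show "b = (\<Sum>j\<in>C. pointwise (*) (K.F.representation C b j) j)"
        by (rule K.F.sum_representation_eq[OF C(3) _ C(1) subset_refl, symmetric]) (use that C(4) in blast)
    qed simp
    show "module_pair.balanced KK (pointwise scale) (alt_tens m p) (pointwise (*)) (ker_sigma m r) (tmul scale p)"
      by (rule balanced_tmul)
    show "\<forall>j\<in>C. x j = 0"
      if "\<And>j. j \<in> C \<Longrightarrow> x j \<in> alt_tens m p" "(\<Sum>j\<in>C. tmul scale p (x j) j) = 0" for x
      using tmul_independent[OF C(1,3), of x m p] that by blast
    show "y \<in> E m (p + r) p \<longleftrightarrow> (\<exists>x. (\<forall>j\<in>C. x j \<in> alt_tens m p) \<and> y = (\<Sum>j\<in>C. tmul scale p (x j) j))" for y
    proof
      assume "y \<in> E m (p + r) p"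
      then show "\<exists>x. (\<forall>j\<in>C. x j \<in> alt_tens m p) \<and> y = (\<Sum>j\<in>C. tmul scale p (x j) j)"
        by (rule eigenpart_tmul[OF C])
    next
      assume "\<exists>x. (\<forall>j\<in>C. x j \<in> alt_tens m p) \<and> y = (\<Sum>j\<in>C. tmul scale p (x j) j)"
      then obtain x where x: "\<forall>j\<in>C. x j \<in> alt_tens m p" and y: "y = (\<Sum>j\<in>C. tmul scale p (x j) j)"
        by blast
      show "y \<in> E m (p + r) p"
        unfolding y by (rule F.subspace_sum[OF subspace_eigenpart]) (use x C(2) tmul_eigenpart in blast)
    qed
  qed
  then show ?thesis by (rule that)
qed

end

section \<open>The isomorphism with the tensor product complex\<close>

context yb_module
begin

abbreviation alt_module :: "nat \<Rightarrow> (ratfun, nat list \<Rightarrow> 'a) module" where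
  "alt_module p \<equiv> mk_module (pointwise scale) (alt_tens m p)"

abbreviation ker_module :: "nat \<Rightarrow> (ratfun, nat list \<Rightarrow> ratfun) module" where
  "ker_module r \<equiv> mk_module (pointwise (*)) (ker_sigma m r)"

abbreviation AB :: "nat \<Rightarrow> nat \<Rightarrow> _" where
  "AB p r \<equiv> tensor KK (alt_module p) (ker_module r)"

abbreviation tlm :: "nat \<Rightarrow> _ \<Rightarrow> nat list \<Rightarrow> 'a" where
  "tlm p \<equiv> tlift (tmul scale p)"

text \<open>The contraction consumes a letter of the left factor, which has degree at least 1, and
  leaves b alone.\<close>

lemma cap_scale_slices:
  "cap (tmul scale (Suc p) f b) = tmul scale p (cap f) b"
  by (simp add: cap_def tmul_def fun_eq_iff act_scale scale_sum_right)

lemma cap_sum: "cap (\<Sum>i\<in>I. f i) = (\<Sum>i\<in>I. cap (f i))"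
  by (rule additive_sum[of cap, OF cap_add])

lemma yb_diff_sum:
  assumes "\<And>i. i \<in> I \<Longrightarrow> f i \<in> tens m n"
  shows "yb_diff scale RM n (\<Sum>i\<in>I. f i) = (\<Sum>i\<in>I. yb_diff scale RM n (f i))"
  using assms by (simp only: yb_diff_eq tens_sum hsum_sum cap_sum cong: sum.cong)

lemma yb_diff_eigenpart:
  assumes "y \<in> E m n p" "p \<le> n"
  shows "yb_diff scale RM n y = qint p \<cdot> cap y"
proof -
  have "y \<in> tens m n" using assms(1) by (simp add: eigenpart_def)
  moreover have "S 0 n y = qint p \<cdot> y" using hsum_eigenpart[OF assms, of 0] by simp
  ultimately show ?thesis by (simp only: yb_diff_eq cap_scale)
qed

text \<open>Both differentials are [p + 1] times the contraction, by
  \<open>yb_diff_eigenpart\<close> and \<open>yb_diff_alt_tens\<close>, so the one on the product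
  does not see b. This is why B(V) enters with zero differential.\<close>

lemma yb_diff_tmul:
  assumes "f \<in> alt_tens m (Suc p)" "b \<in> ker_sigma m r"
  shows "tmul scale p (yb_diff scale RM (Suc p) f) b = yb_diff scale RM (Suc (p + r)) (tmul scale (Suc p) f b)"
proof -
  have "tmul scale (Suc p) f b \<in> E m (Suc (p + r)) (Suc p)"
    using tmul_eigenpart[OF assms] by simp
  from yb_diff_eigenpart[OF this]
  show ?thesis using assms(1) by (simp only: yb_diff_alt_tens cap_scale_slices tmul_scale_left)
qed

lemma AB_facts:
  shows tl_bij: "bij_betw (tlm p) (carrier (AB p r)) (E m (p + r) p)"
    and AB_zero: "\<zero>\<^bsub>AB p r\<^esub> \<in> carrier (AB p r)" "tlm p \<zero>\<^bsub>AB p r\<^esub> = 0"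
    and AB_add_closed: "\<And>X Y. X \<in> carrier (AB p r) \<Longrightarrow> Y \<in> carrier (AB p r) \<Longrightarrow> X \<oplus>\<^bsub>AB p r\<^esub> Y \<in> carrier (AB p r)"
    and AB_add: "\<And>X Y. X \<in> carrier (AB p r) \<Longrightarrow> Y \<in> carrier (AB p r) \<Longrightarrow> tlm p (X \<oplus>\<^bsub>AB p r\<^esub> Y) = tlm p X + tlm p Y"
proof -
  obtain C where "module_pair_basis KK (pointwise scale) (alt_tens m p) (pointwise (*)) (ker_sigma m r)
    C (\<lambda>c. c) (tmul scale p) (E m (p + r) p)"
    by (rule module_pair_basis_tmul)
  then interpret B: module_pair_basis KK "pointwise scale" "alt_tens m p" "pointwise (*)" "ker_sigma m r"
    C "\<lambda>c. c" "tmul scale p" "E m (p + r) p" .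
  show "bij_betw (tlm p) (carrier (AB p r)) (E m (p + r) p)" by (rule B.tlift_bij)
  show "\<zero>\<^bsub>AB p r\<^esub> \<in> carrier (AB p r)" by (rule B.tensor_zero_closed)
  show "tlm p \<zero>\<^bsub>AB p r\<^esub> = 0" by (rule B.tlift_zero)
  show "\<And>X Y. X \<in> carrier (AB p r) \<Longrightarrow> Y \<in> carrier (AB p r) \<Longrightarrow> X \<oplus>\<^bsub>AB p r\<^esub> Y \<in> carrier (AB p r)"
    by (rule B.tensor_add_closed)
  show "\<And>X Y. X \<in> carrier (AB p r) \<Longrightarrow> Y \<in> carrier (AB p r) \<Longrightarrow> tlm p (X \<oplus>\<^bsub>AB p r\<^esub> Y) = tlm p X + tlm p Y"
    by (rule B.tlift_add)
qed

lemma tl_in: "X \<in> carrier (AB p r) \<Longrightarrow> tlm p X \<in> E m (p + r) p"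
  using tl_bij by (auto simp: bij_betw_def)

lemma AB_smult:
  assumes X: "X \<in> carrier (AB p r)"
  shows "c \<odot>\<^bsub>AB p r\<^esub> X \<in> carrier (AB p r)" "tlm p (c \<odot>\<^bsub>AB p r\<^esub> X) = c \<cdot> tlm p X"
proof -
  note mp = module_pair_tmul[of m p r] balanced_tmul[of m p r]
  have *: "c \<odot>\<^bsub>AB p r\<^esub> X = tensor_map KK (alt_module p) (ker_module r) (pointwise scale c) (\<lambda>b. b) X"
    by (rule module_pair.tensor_smult[OF mp(1)])
  have D: "tensor_map KK (alt_module p) (ker_module r) (pointwise scale c) (\<lambda>b. b) X \<in> carrier (AB p r) \<and>
    tlm p (tensor_map KK (alt_module p) (ker_module r) (pointwise scale c) (\<lambda>b. b) X) = c \<cdot> tlm p X"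
  proof (rule conjI; rule tensor_map_tlift[where I = "E m (p + r) p" and D = "pointwise scale c",
        OF mp mp _ _ _ _ _ _ _ _ _ _ _ X])
  qed (simp_all add: alt_tens_scale F.scale_right_distrib mult.commute tmul_scale_left
      F.scale_right_diff_distrib tmul_eigenpart F.subspace_0[OF subspace_eigenpart]
      F.subspace_diff[OF subspace_eigenpart])
  show "c \<odot>\<^bsub>AB p r\<^esub> X \<in> carrier (AB p r)" "tlm p (c \<odot>\<^bsub>AB p r\<^esub> X) = c \<cdot> tlm p X"
    unfolding * using D by blast+
qed

lemma AB_diff:
  assumes X: "X \<in> carrier (AB (Suc p) r)"
  shows "tensor_map KK (alt_module p) (ker_module r) (yb_diff scale RM (Suc p)) (\<lambda>b. b) X \<in> carrier (AB p r)"
    "tlm p (tensor_map KK (alt_module p) (ker_module r) (yb_diff scale RM (Suc p)) (\<lambda>b. b) X)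
      = yb_diff scale RM (Suc (p + r)) (tlm (Suc p) X)"
proof -
  note mp = module_pair_tmul[of m "Suc p" r] balanced_tmul[of m "Suc p" r]
  note mp' = module_pair_tmul[of m p r] balanced_tmul[of m p r]
  have t: "y \<in> tens m (Suc (p + r))" if "y \<in> E m (Suc p + r) (Suc p)" for y
    using that by (simp add: eigenpart_def)
  have closed: "yb_diff scale RM (Suc p) f \<in> alt_tens m p" if "f \<in> alt_tens m (Suc p)" for f
    using that by (simp add: yb_diff_alt_tens alt_tens_scale cap_alt_tens del: qint.simps)
  have lin: "yb_diff scale RM (Suc p) (f + g) = yb_diff scale RM (Suc p) f + yb_diff scale RM (Suc p) g"
    "yb_diff scale RM (Suc p) (c \<cdot> f) = c \<cdot> yb_diff scale RM (Suc p) f"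
    if "f \<in> alt_tens m (Suc p)" "g \<in> alt_tens m (Suc p)" for f g c
    by (rule yb_diff_linear[OF alt_tensD(2)[OF that(1)] alt_tensD(2)[OF that(2)]])+
  have diff: "yb_diff scale RM (Suc (p + r)) (y - z)
        = yb_diff scale RM (Suc (p + r)) y - yb_diff scale RM (Suc (p + r)) z"
    if "y \<in> E m (Suc p + r) (Suc p)" "z \<in> E m (Suc p + r) (Suc p)" for y z
    using yb_diff_linear(1)[OF tens_diff[OF t[OF that(1)] t[OF that(2)]] t[OF that(2)]]
    by (simp only: diff_add_cancel) simp
  show "tensor_map KK (alt_module p) (ker_module r) (yb_diff scale RM (Suc p)) (\<lambda>b. b) X \<in> carrier (AB p r)"
    "tlm p (tensor_map KK (alt_module p) (ker_module r) (yb_diff scale RM (Suc p)) (\<lambda>b. b) X)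
      = yb_diff scale RM (Suc (p + r)) (tlm (Suc p) X)"
    by (rule tensor_map_tlift[where I = "E m (Suc p + r) (Suc p)" and D = "yb_diff scale RM (Suc (p + r))",
        OF mp mp' _ _ _ _ _ _ _ _ _ _ _ X];
      (simp only: closed lin diff yb_diff_tmul tmul_eigenpart F.subspace_0[OF subspace_eigenpart]
        F.subspace_diff[OF subspace_eigenpart])?)+
qed

lemma dsum_simps:
  "carrier (dsum I M) = (\<Pi>\<^sub>E p\<in>I. carrier (M p))"
  "\<zero>\<^bsub>dsum I M\<^esub> = (\<lambda>p\<in>I. \<zero>\<^bsub>M p\<^esub>)"
  "x \<oplus>\<^bsub>dsum I M\<^esub> y = (\<lambda>p\<in>I. x p \<oplus>\<^bsub>M p\<^esub> y p)"
  "c \<odot>\<^bsub>dsum I M\<^esub> x = (\<lambda>p\<in>I. c \<odot>\<^bsub>M p\<^esub> x p)"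
  by (simp_all add: dsum_def)

definition total :: "nat \<Rightarrow> (nat \<Rightarrow> _) \<Rightarrow> nat list \<Rightarrow> 'a" where
  "total N z = (\<Sum>p\<le>N. tlm p (z p))"

text \<open>Each summand is E_p by \<open>tl_bij\<close>; injectivity is then
  \<open>eigenpart_independent\<close> and surjectivity \<open>eigenpart_decompose\<close>.\<close>

lemma total_bij: "bij_betw (total N) (\<Pi>\<^sub>E p\<in>{..N}. carrier (AB p (N - p))) (tens m N)"
  unfolding bij_betw_def
proof
  have tlN: "tlm p X \<in> E m N p" if "X \<in> carrier (AB p (N - p))" "p \<le> N" for p X
    using tl_in[OF that(1)] that(2) by simp
  show "inj_on (total N) (\<Pi>\<^sub>E p\<in>{..N}. carrier (AB p (N - p)))"
  proof (rule inj_onI)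
    fix z z' assume z: "z \<in> (\<Pi>\<^sub>E p\<in>{..N}. carrier (AB p (N - p)))"
      and z': "z' \<in> (\<Pi>\<^sub>E p\<in>{..N}. carrier (AB p (N - p)))" and eq: "total N z = total N z'"
    have in_z: "z p \<in> carrier (AB p (N - p))" "z' p \<in> carrier (AB p (N - p))" if "p \<le> N" for p
      using z z' that by (auto simp: PiE_def Pi_def)
    have E: "\<forall>p\<le>N. tlm p (z p) - tlm p (z' p) \<in> E m N p"
      using tlN in_z by (intro allI impI F.subspace_diff[OF subspace_eigenpart]) auto
    have "(\<Sum>p\<le>N. tlm p (z p) - tlm p (z' p)) = 0"
      using eq by (simp add: total_def sum_subtractf)
    from eigenpart_independent[OF E this]
    have "tlm p (z p) = tlm p (z' p)" if "p \<le> N" for p using that by simp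
    then have "z p = z' p" if "p \<le> N" for p
      using tl_bij[of p "N - p"] in_z[OF that] that by (auto simp: bij_betw_def dest: inj_onD)
    then show "z = z'" using z z' by (intro PiE_ext[of z "{..N}" _ z']) auto
  qed
  show "total N ` (\<Pi>\<^sub>E p\<in>{..N}. carrier (AB p (N - p))) = tens m N"
  proof (intro equalityI subsetI)
    fix f assume "f \<in> total N ` (\<Pi>\<^sub>E p\<in>{..N}. carrier (AB p (N - p)))"
    then obtain z where z: "z \<in> (\<Pi>\<^sub>E p\<in>{..N}. carrier (AB p (N - p)))" and f: "f = total N z" by blast
    have "tlm p (z p) \<in> tens m N" if "p \<in> {..N}" for p
      using tlN[of "z p" p] z that by (auto simp: PiE_def Pi_def eigenpart_def)
    then show "f \<in> tens m N" unfolding f total_def by (rule tens_sum)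
  next
    fix f :: "nat list \<Rightarrow> 'a" assume "f \<in> tens m N"
    from eigenpart_decompose[OF this]
    obtain y where y: "\<forall>p\<le>N. y p \<in> E m N p" and f: "f = (\<Sum>p\<le>N. y p)" by blast
    have "\<exists>X. X \<in> carrier (AB p (N - p)) \<and> tlm p X = y p" if "p \<le> N" for p
    proof -
      have "y p \<in> tlm p ` carrier (AB p (N - p))"
        using tl_bij[of p "N - p"] y that by (simp add: bij_betw_def)
      then show ?thesis by (elim imageE) (intro exI conjI, assumption, erule sym)
    qed
    then obtain z where z: "\<And>p. p \<le> N \<Longrightarrow> z p \<in> carrier (AB p (N - p)) \<and> tlm p (z p) = y p" by metis
    have "restrict z {..N} \<in> (\<Pi>\<^sub>E p\<in>{..N}. carrier (AB p (N - p)))" using z by auto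
    moreover have "total N (restrict z {..N}) = f"
      unfolding total_def f by (rule sum.cong) (use z in auto)
    ultimately show "f \<in> total N ` (\<Pi>\<^sub>E p\<in>{..N}. carrier (AB p (N - p)))" by blast
  qed
qed

theorem yb_complex_iso:
  "cplx_iso (yb_complex m scale RM) (tensor_graded (finite_complex m scale RM) (B_graded m))"
proof (rule cplx_iso_transport[where \<theta> = total])
  have fstX: "fst (yb_complex m scale RM) n = mk_module (pointwise scale) (tens m n)"
    and sndX: "snd (yb_complex m scale RM) n = yb_diff scale RM n" for n
    by (simp_all add: yb_complex_def)
  let ?Y = "tensor_graded (finite_complex m scale RM) (B_graded m)"
  have fstY: "fst ?Y N = dsum {..N} (\<lambda>p. AB p (N - p))" for N
    by (simp add: tensor_graded_def finite_complex_def B_graded_def M_bracket_eq)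
  have sndY: "snd ?Y (Suc n) z = (\<lambda>p\<in>{..n}. tensor_map KK (alt_module p) (ker_module (n - p))
      (yb_diff scale RM (Suc p)) (\<lambda>b. b) (z (Suc p)))" for n z
    by (simp add: tensor_graded_def finite_complex_def B_graded_def M_bracket_eq)
  have in_z: "z p \<in> carrier (AB p (n - p))" if "z \<in> carrier (fst ?Y n)" "p \<le> n" for z p n
    using that unfolding fstY dsum_simps by auto
  show "is_cplx (yb_complex m scale RM)" by (rule is_cplx_yb)
  show "bij_betw (total n) (carrier (fst ?Y n)) (carrier (fst (yb_complex m scale RM) n))" for n
    unfolding fstY fstX dsum_simps using total_bij by simp
  show "\<zero>\<^bsub>fst ?Y n\<^esub> \<in> carrier (fst ?Y n)" for n
    unfolding fstY dsum_simps by (auto intro: AB_zero)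
  show "total n \<zero>\<^bsub>fst ?Y n\<^esub> = \<zero>\<^bsub>fst (yb_complex m scale RM) n\<^esub>" for n
    unfolding fstY fstX dsum_simps total_def mk_module_simps
    by (rule sum.neutral) (simp add: AB_zero)
  fix n x assume x: "x \<in> carrier (fst ?Y n)"
  show "c \<odot>\<^bsub>fst ?Y n\<^esub> x \<in> carrier (fst ?Y n)" for c
    using in_z[OF x] unfolding fstY dsum_simps by (auto intro: AB_smult)
  show "total n (c \<odot>\<^bsub>fst ?Y n\<^esub> x) = c \<odot>\<^bsub>fst (yb_complex m scale RM) n\<^esub> total n x" for c
    using in_z[OF x] unfolding fstY fstX dsum_simps total_def mk_module_simps F.scale_sum_right
    by (intro sum.cong refl) (simp add: AB_smult)
  fix y assume y: "y \<in> carrier (fst ?Y n)"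
  show "x \<oplus>\<^bsub>fst ?Y n\<^esub> y \<in> carrier (fst ?Y n)"
    using in_z[OF x] in_z[OF y] unfolding fstY dsum_simps by (auto intro: AB_add_closed)
  show "total n (x \<oplus>\<^bsub>fst ?Y n\<^esub> y) = total n x \<oplus>\<^bsub>fst (yb_complex m scale RM) n\<^esub> total n y"
    using in_z[OF x] in_z[OF y]
    unfolding fstY fstX dsum_simps total_def mk_module_simps sum.distrib[symmetric]
    by (intro sum.cong refl) (simp add: AB_add)
next
  have fstX: "fst (yb_complex m scale RM) n = mk_module (pointwise scale) (tens m n)"
    and sndX: "snd (yb_complex m scale RM) n = yb_diff scale RM n" for n
    by (simp_all add: yb_complex_def)
  let ?Y = "tensor_graded (finite_complex m scale RM) (B_graded m)"
  have fstY: "fst ?Y N = dsum {..N} (\<lambda>p. AB p (N - p))" for N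
    by (simp add: tensor_graded_def finite_complex_def B_graded_def M_bracket_eq)
  have sndY: "snd ?Y (Suc n) z = (\<lambda>p\<in>{..n}. tensor_map KK (alt_module p) (ker_module (n - p))
      (yb_diff scale RM (Suc p)) (\<lambda>b. b) (z (Suc p)))" for n z
    by (simp add: tensor_graded_def finite_complex_def B_graded_def M_bracket_eq)
  fix n z assume "z \<in> carrier (fst ?Y (Suc n))"
  then have in_z: "z p \<in> carrier (AB p (Suc n - p))" if "p \<le> Suc n" for p
    using that unfolding fstY dsum_simps by auto
  have in_zS: "z (Suc p) \<in> carrier (AB (Suc p) (n - p))" if "p \<le> n" for p
    using in_z[of "Suc p"] that by simp
  show "snd ?Y (Suc n) z \<in> carrier (fst ?Y n)"
    unfolding sndY unfolding fstY dsum_simps using AB_diff(1)[OF in_zS] by auto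
  have E: "tlm p (z p) \<in> E m (Suc n) p" if "p \<le> Suc n" for p
    using tl_in[OF in_z[OF that]] that by simp
  then have t: "tlm p (z p) \<in> tens m (Suc n)" if "p \<in> {..Suc n}" for p
    using that by (simp add: eigenpart_def)
  have "total n (snd ?Y (Suc n) z) = (\<Sum>p\<le>n. yb_diff scale RM (Suc n) (tlm (Suc p) (z (Suc p))))"
    unfolding sndY total_def
    by (intro sum.cong refl) (use AB_diff(2)[OF in_zS] in simp)
  \<comment> \<open>The component in E_0 has differential [0] times a contraction, hence 0; adding
    it completes the sum over all components of z.\<close>
  also have "\<dots> = yb_diff scale RM (Suc n) (tlm 0 (z 0)) + \<dots>"
    using yb_diff_eigenpart[OF E[of 0]] by simp
  also have "\<dots> = (\<Sum>p\<le>Suc n. yb_diff scale RM (Suc n) (tlm p (z p)))"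
    by (rule sum.atMost_Suc_shift[symmetric])
  also have "\<dots> = yb_diff scale RM (Suc n) (total (Suc n) z)"
    unfolding total_def by (rule yb_diff_sum[symmetric]) (rule t)
  finally show "total n (snd ?Y (Suc n) z) = snd (yb_complex m scale RM) (Suc n) (total (Suc n) z)"
    by (simp only: sndX)
qed

end


section \<open>The Koszul complex\<close>

lemma funpow_commute:
  assumes "\<And>x. f (g x) = g (f x)"
  shows "(f ^^ a) ((g ^^ b) x) = (g ^^ b) ((f ^^ a) x)"
proof -
  have 1: "f ((g ^^ b) x) = (g ^^ b) (f x)" for x by (induction b) (simp_all add: assms)
  show ?thesis by (induction a) (simp_all add: 1)
qed

lemma fold_commute_elem:
  assumes "\<And>j x. j \<in> set xs \<Longrightarrow> f (G j x) = G j (f x)"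
  shows "f (fold G xs x) = fold G xs (f x)"
  using assms by (induction xs arbitrary: x) simp_all

text \<open>Serves the law that exponents of monomials add: \<open>F\<close>, \<open>G\<close> and
  \<open>H\<close> stand for the powers of one variable given by two exponents and by their
  sum.\<close>

lemma fold_compose_commuting:
  assumes "\<And>i j x. i \<in> set xs \<Longrightarrow> j \<in> set xs \<Longrightarrow> F i (G j x) = G j (F i x)"
    and "\<And>j x. j \<in> set xs \<Longrightarrow> H j x = F j (G j x)"
  shows "fold H xs x = fold F xs (fold G xs x)"
  using assms
proof (induction xs arbitrary: x)
  case (Cons j xs)
  have "fold H (j # xs) x = fold H xs (F j (G j x))" using Cons.prems(2) by simp
  also have "\<dots> = fold F xs (fold G xs (F j (G j x)))" by (rule Cons.IH) (use Cons.prems in auto)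
  also have "fold G xs (F j (G j x)) = F j (fold G xs (G j x))"
    by (rule fold_commute_elem[symmetric]) (use Cons.prems in auto)
  finally show "fold H (j # xs) x = fold F (j # xs) (fold G (j # xs) x)" by simp
qed simp

lemma fold_single:
  assumes "distinct xs" "\<And>j x. j \<in> set xs \<Longrightarrow> F j x = (if j = i then f x else x)"
  shows "fold F xs x = (if i \<in> set xs then f x else x)"
  using assms by (induction xs arbitrary: x) auto

lemma mpoly_expand: "p = (\<Sum>t\<in>Poly_Mapping.keys p. Poly_Mapping.single t (Poly_Mapping.lookup p t))"
  for p :: mpoly
proof (rule poly_mapping_eqI)
  fix t
  have "Poly_Mapping.lookup (\<Sum>t\<in>Poly_Mapping.keys p. Poly_Mapping.single t (Poly_Mapping.lookup p t)) t
      = (\<Sum>u\<in>Poly_Mapping.keys p. if u = t then Poly_Mapping.lookup p u else 0)"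
    unfolding lookup_sum by (intro sum.cong refl) (simp add: lookup_single when_def)
  then show "Poly_Mapping.lookup p t
      = Poly_Mapping.lookup (\<Sum>t\<in>Poly_Mapping.keys p. Poly_Mapping.single t (Poly_Mapping.lookup p t)) t"
    by (simp add: in_keys_iff)
qed

section \<open>Terms and differential of the Koszul complex\<close>

context
  fixes m :: nat
begin

lemma F_carrier: "p \<in> carrier (F_ring m) \<longleftrightarrow> (\<forall>t. Poly_Mapping.lookup p t \<noteq> 0 \<longrightarrow> Poly_Mapping.keys t \<subseteq> {1..m})"
  by (auto simp: F_ring_def in_keys_iff)

lemma F_add: "p \<in> carrier (F_ring m) \<Longrightarrow> q \<in> carrier (F_ring m) \<Longrightarrow> p + q \<in> carrier (F_ring m)"
  unfolding F_carrier lookup_add by (metis add.right_neutral)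

lemma F_diff: "p \<in> carrier (F_ring m) \<Longrightarrow> q \<in> carrier (F_ring m) \<Longrightarrow> p - q \<in> carrier (F_ring m)"
  unfolding F_carrier lookup_minus by (metis diff_self)

lemma F_zero: "0 \<in> carrier (F_ring m)"
  by (simp add: F_carrier)

lemma F_mult: "p \<in> carrier (F_ring m) \<Longrightarrow> q \<in> carrier (F_ring m) \<Longrightarrow> p * q \<in> carrier (F_ring m)"
proof -
  assume p: "p \<in> carrier (F_ring m)" and q: "q \<in> carrier (F_ring m)"
  have "Poly_Mapping.keys t \<subseteq> {1..m}" if t: "t \<in> Poly_Mapping.keys (p * q)" for t
  proof -
    obtain a b where ab: "t = a + b" "a \<in> Poly_Mapping.keys p" "b \<in> Poly_Mapping.keys q"
      using subsetD[OF keys_mult t] by auto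
    then have "Poly_Mapping.keys a \<subseteq> {1..m}" "Poly_Mapping.keys b \<subseteq> {1..m}"
      using p q by (simp_all add: F_ring_def)
    then show ?thesis unfolding ab(1) using keys_add[of a b] by blast
  qed
  then show ?thesis by (simp add: F_ring_def)
qed

lemma F_const: "const_poly c \<in> carrier (F_ring m)"
  by (simp add: F_ring_def const_poly_def)

lemma F_var: "i \<in> {1..m} \<Longrightarrow> var i \<in> carrier (F_ring m)"
  by (simp add: F_ring_def var_def)

lemma F_one: "1 \<in> carrier (F_ring m)"
  using F_const[of 1] by (simp add: const_poly_def)

lemma F_sign: "(-1) ^ k \<in> carrier (F_ring m)"
  using F_diff[OF F_zero F_one] by (induction k) (auto simp: F_one intro: F_diff[OF F_zero, simplified])

lemma F_sum: "(\<And>i. i \<in> I \<Longrightarrow> f i \<in> carrier (F_ring m)) \<Longrightarrow> sum f I \<in> carrier (F_ring m)"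
  by (induction I rule: infinite_finite_induct) (auto intro: F_add F_zero)

definition koszul_space :: "nat \<Rightarrow> (nat set \<Rightarrow> mpoly) set" where
  "koszul_space n = {k. (\<forall>A. k A \<in> carrier (F_ring m)) \<and> (\<forall>A. A \<notin> nsubsets m n \<longrightarrow> k A = 0)}"

lemma koszul_term_eq: "koszul_term m n = mk_module (pointwise (*)) (koszul_space n)"
proof -
  have "koszul_space n =
      {k. (\<forall>S. k S \<in> carrier (F_ring m)) \<and> (\<forall>S. k S \<noteq> 0 \<longrightarrow> S \<subseteq> {1..m} \<and> card S = n)}"
    by (auto simp: koszul_space_def nsubsets_def)
  then show ?thesis by (simp add: koszul_term_def)
qed

lemma koszul_spaceD:
  "k \<in> koszul_space n \<Longrightarrow> k A \<in> carrier (F_ring m)"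
  "k \<in> koszul_space n \<Longrightarrow> A \<notin> nsubsets m n \<Longrightarrow> k A = 0"
  by (simp_all add: koszul_space_def)

lemma insert_nsubsets: "i \<in> {1..m} - A \<Longrightarrow> insert i A \<in> nsubsets m (Suc n) \<longleftrightarrow> A \<in> nsubsets m n"
proof -
  assume i: "i \<in> {1..m} - A"
  show ?thesis
  proof (cases "A \<subseteq> {1..m}")
    case True
    then have "finite A" using finite_subset by blast
    then show ?thesis using i by (simp add: nsubsets_def)
  next
    case False
    then show ?thesis by (simp add: nsubsets_def)
  qed
qed

lemma koszul_diff_space: "k \<in> koszul_space (Suc n) \<Longrightarrow> koszul_diff m k \<in> koszul_space n"
proof -
  assume k: "k \<in> koszul_space (Suc n)"
  have "koszul_diff m k A \<in> carrier (F_ring m)" for A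
    unfolding koszul_diff_def using k
    by (intro F_sum F_mult F_sign F_var) (auto simp: koszul_spaceD)
  moreover have "koszul_diff m k A = 0" if "A \<notin> nsubsets m n" for A
    unfolding koszul_diff_def
    by (rule sum.neutral) (use that koszul_spaceD(2)[OF k] insert_nsubsets in simp)
  ultimately show ?thesis by (simp add: koszul_space_def)
qed

lemma koszul_diff_add: "koszul_diff m (k + k') = koszul_diff m k + koszul_diff m k'"
  by (simp add: koszul_diff_def fun_eq_iff distrib_left sum.distrib)

lemma koszul_diff_smult: "koszul_diff m (pointwise (*) r k) = pointwise (*) r (koszul_diff m k)"
  by (simp add: koszul_diff_def pointwise_def fun_eq_iff sum_distrib_left mult_ac)

end

section \<open>The polynomial action and the comparison with alternating tensors\<close>

context yb_module
begin

abbreviation ma :: "(nat \<Rightarrow>\<^sub>0 nat) \<Rightarrow> 'a \<Rightarrow> 'a" where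
  "ma \<equiv> mono_act m RM"

abbreviation pa :: "mpoly \<Rightarrow> 'a \<Rightarrow> 'a" where
  "pa \<equiv> poly_act m scale RM"

lemma ma_eq: "ma t = fold (\<lambda>j. act j ^^ Poly_Mapping.lookup t j) [1..<m + 1]"
proof -
  have "act j = (\<lambda>x. RM (pure x [j]))" for j by (simp add: act_def fun_eq_iff)
  then show ?thesis by (simp only: mono_act_def)
qed

lemma ma_linear: "ma t (x + y) = ma t x + ma t y" "ma t (c *s x) = c *s ma t x"
proof -
  have 1: "(act j ^^ n) (x + y) = (act j ^^ n) x + (act j ^^ n) y"
    "(act j ^^ n) (c *s x) = c *s (act j ^^ n) x" if "j \<in> {1..m}" for j n x y
    by (induction n) (simp_all add: act_add[OF that] act_scale[OF that])
  have "fold (\<lambda>j. act j ^^ Poly_Mapping.lookup t j) js (x + y)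
      = fold (\<lambda>j. act j ^^ Poly_Mapping.lookup t j) js x + fold (\<lambda>j. act j ^^ Poly_Mapping.lookup t j) js y"
    "fold (\<lambda>j. act j ^^ Poly_Mapping.lookup t j) js (c *s x)
      = c *s fold (\<lambda>j. act j ^^ Poly_Mapping.lookup t j) js x"
    if "set js \<subseteq> {1..m}" for js x y
    using that by (induction js arbitrary: x y) (simp_all add: 1)
  moreover have "set [1..<m + 1] \<subseteq> {1..m}" by auto
  ultimately show "ma t (x + y) = ma t x + ma t y" "ma t (c *s x) = c *s ma t x"
    unfolding ma_eq by blast+
qed

lemma ma_zero: "ma 0 x = x"
proof -
  have "fold (\<lambda>j. act j ^^ 0) js x = x" for js by (induction js) simp_all
  then show ?thesis by (simp add: ma_eq)
qed

lemma ma_add: "ma (t + u) x = ma t (ma u x)"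
  unfolding ma_eq
proof (rule fold_compose_commuting)
  fix i j x assume "i \<in> set [1..<m + 1]" "j \<in> set [1..<m + 1]"
  then have "i \<in> {1..m}" "j \<in> {1..m}" by auto
  then show "(act i ^^ Poly_Mapping.lookup t i) ((act j ^^ Poly_Mapping.lookup u j) x)
      = (act j ^^ Poly_Mapping.lookup u j) ((act i ^^ Poly_Mapping.lookup t i) x)"
    by (intro funpow_commute act_commute)
qed (simp add: lookup_add funpow_add)

lemma ma_single: "i \<in> {1..m} \<Longrightarrow> ma (Poly_Mapping.single i 1) x = act i x"
proof -
  assume i: "i \<in> {1..m}"
  have "fold (\<lambda>j. act j ^^ Poly_Mapping.lookup (Poly_Mapping.single i 1) j) [1..<m + 1] x
      = (if i \<in> set [1..<m + 1] then act i x else x)"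
    by (rule fold_single) (auto simp: lookup_single when_def)
  moreover have "i \<in> set [1..<m + 1]" using i by auto
  ultimately show ?thesis unfolding ma_eq by (simp only: if_True)
qed

lemma pa_superset:
  assumes "finite K" "Poly_Mapping.keys p \<subseteq> K"
  shows "pa p x = (\<Sum>t\<in>K. Poly_Mapping.lookup p t *s ma t x)"
  unfolding poly_act_def by (rule sum.mono_neutral_left) (use assms in \<open>auto simp: in_keys_iff\<close>)

lemma pa_add_left: "pa (p + q) x = pa p x + pa q x"
proof -
  let ?K = "Poly_Mapping.keys p \<union> Poly_Mapping.keys q"
  have "pa (p + q) x = (\<Sum>t\<in>?K. Poly_Mapping.lookup (p + q) t *s ma t x)"
    by (rule pa_superset) (auto dest: subsetD[OF keys_add])
  moreover have "pa p x = (\<Sum>t\<in>?K. Poly_Mapping.lookup p t *s ma t x)"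
    and "pa q x = (\<Sum>t\<in>?K. Poly_Mapping.lookup q t *s ma t x)"
    by (rule pa_superset; simp)+
  ultimately show ?thesis by (simp add: lookup_add scale_left_distrib sum.distrib)
qed

lemma pa_add_right: "pa p (x + y) = pa p x + pa p y"
  by (simp add: poly_act_def ma_linear scale_right_distrib sum.distrib)

lemma pa_scale: "pa p (c *s x) = c *s pa p x"
  by (simp add: poly_act_def ma_linear scale_sum_right mult.commute)

lemma pa_sum_left: "pa (\<Sum>i\<in>I. f i) x = (\<Sum>i\<in>I. pa (f i) x)"
  by (rule additive_sum[of "\<lambda>p. pa p x", OF pa_add_left])

lemma pa_sum_right: "pa p (\<Sum>i\<in>I. f i) = (\<Sum>i\<in>I. pa p (f i))"
  by (rule additive_sum[of "pa p", OF pa_add_right])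

lemma pa_zero: "pa 0 x = 0"
  by (simp add: poly_act_def)

lemma pa_single: "pa (Poly_Mapping.single t c) x = c *s ma t x"
  using pa_superset[of "{t}" "Poly_Mapping.single t c" x] by simp

lemma pa_one: "pa 1 x = x"
  using pa_single[of 0 1 x] by (simp add: ma_zero)

lemma pa_const: "pa (const_poly c) x = c *s x"
  by (simp add: const_poly_def pa_single ma_zero)

lemma pa_var: "i \<in> {1..m} \<Longrightarrow> pa (var i) x = act i x"
  unfolding var_def pa_single scale_one by (rule ma_single)

text \<open>Both factors are split into monomials, whose actions compose by \<open>ma_add\<close>.
  This is the law that makes M a module over F(V).\<close>

lemma pa_mult: "pa (p * q) x = pa p (pa q x)"
proof -
  let ?s = "\<lambda>p t. Poly_Mapping.single t (Poly_Mapping.lookup p t) :: mpoly"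
  have "pa (p * q) x = pa ((\<Sum>t\<in>Poly_Mapping.keys p. ?s p t) * (\<Sum>u\<in>Poly_Mapping.keys q. ?s q u)) x"
    using mpoly_expand[of p] mpoly_expand[of q] by simp
  also have "\<dots> = (\<Sum>t\<in>Poly_Mapping.keys p. \<Sum>u\<in>Poly_Mapping.keys q. pa (?s p t * ?s q u) x)"
    by (simp only: sum_product pa_sum_left)
  also have "\<dots> = (\<Sum>t\<in>Poly_Mapping.keys p. \<Sum>u\<in>Poly_Mapping.keys q. pa (?s p t) (pa (?s q u) x))"
    by (intro sum.cong refl) (simp add: mult_single pa_single ma_add ma_linear)
  also have "\<dots> = pa (\<Sum>t\<in>Poly_Mapping.keys p. ?s p t) (pa (\<Sum>u\<in>Poly_Mapping.keys q. ?s q u) x)"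
    by (simp only: pa_sum_left pa_sum_right) (rule sum.swap)
  also have "\<dots> = pa p (pa q x)" using mpoly_expand[of p] mpoly_expand[of q] by simp
  finally show ?thesis .
qed

lemma pa_commute: "pa p (pa q x) = pa q (pa p x)"
  by (simp only: pa_mult[symmetric] mult.commute)

lemma pa_sign_mult: "pa ((-1) ^ k * p) x = (-1) ^ k *s pa p x"
proof (induction k)
  case 0
  show ?case by simp
next
  case (Suc k)
  have "pa (- q) x = - pa q x" for q
    using additive_minus(2)[of "\<lambda>p. pa p x", OF pa_add_left] .
  then show ?case using Suc by simp
qed

text \<open>
  The factor 1 / [n]! compensates the q-integers in the Yang-Baxter differential, the Koszul
  differential having coefficients 1 and -1.
\<close>

definition kz :: "nat \<Rightarrow> 'a \<Rightarrow> (nat set \<Rightarrow> mpoly) \<Rightarrow> nat list \<Rightarrow> 'a" where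
  "kz n x k = (\<lambda>u. \<Sum>A\<in>nsubsets m n. bracket (sl A) u *s (inverse (qfact n) *s pa (k A) x))"

lemma kz_alt: "kz n x k \<in> alt_tens m n"
  unfolding kz_def by (rule bracket_expansion_alt_tens)

lemma kz_sl: "B \<in> nsubsets m n \<Longrightarrow> kz n x k (sl B) = inverse (qfact n) *s pa (k B) x"
  unfolding kz_def by (rule bracket_expansion_sl)

lemma module_pair_koszul:
  "module_pair (F_ring m) pa UNIV (pointwise (*)) (koszul_space m n)"
  by unfold_locales (auto simp: koszul_space_def F_zero F_diff F_mult pointwise_def)

lemma kz_add_left: "kz n (x + y) k = kz n x k + kz n y k"
  by (simp add: kz_def fun_eq_iff pa_add_right scale_right_distrib sum.distrib)

lemma kz_add_right: "kz n x (k + l) = kz n x k + kz n x l"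
  by (simp add: kz_def fun_eq_iff pa_add_left scale_right_distrib sum.distrib)

lemma balanced_kz:
  "module_pair.balanced (F_ring m) pa UNIV (pointwise (*)) (koszul_space m n) (kz n)"
proof -
  have "kz n (pa r x) k = kz n x (pointwise (*) r k)" for r x k
    unfolding kz_def pointwise_def pa_mult pa_commute[of r] ..
  then show ?thesis
    unfolding module_pair.balanced_def[OF module_pair_koszul] by (simp add: kz_add_left kz_add_right)
qed

definition kunit :: "nat set \<Rightarrow> nat set \<Rightarrow> mpoly" where
  "kunit A = (\<lambda>B. if B = A then 1 else 0)"

lemma kunit_sum_sl:
  assumes "B \<in> nsubsets m n"
  shows "(\<Sum>A\<in>nsubsets m n. kz n (x A) (kunit A)) (sl B) = inverse (qfact n) *s x B"
proof -
  have "(\<Sum>A\<in>nsubsets m n. kz n (x A) (kunit A)) (sl B)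
      = (\<Sum>A\<in>nsubsets m n. if A = B then inverse (qfact n) *s x A else 0)"
    unfolding sum_fun_apply
    by (rule sum.cong[OF refl]) (auto simp: kz_sl[OF assms] kunit_def pa_one pa_zero)
  then show ?thesis using assms by simp
qed

text \<open>K_n is free over F(V) on the n-element subsets, so M \<otimes> K_n is a sum of copies of
  M indexed by them, exactly like M \<otimes> [V]_n.\<close>

lemma module_pair_basis_kz:
  "module_pair_basis (F_ring m) pa UNIV (pointwise (*)) (koszul_space m n)
    (nsubsets m n) kunit (kz n) (alt_tens m n)"
proof (rule module_pair_basis.intro[OF module_pair_koszul], unfold_locales)
  show "finite (nsubsets m n)" by simp
  show "kunit A \<in> koszul_space m n" if "A \<in> nsubsets m n" for A
    using that by (auto simp: koszul_space_def kunit_def F_zero F_one)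
  show "\<exists>c. (\<forall>A\<in>nsubsets m n. c A \<in> carrier (F_ring m)) \<and> k = (\<Sum>A\<in>nsubsets m n. pointwise (*) (c A) (kunit A))"
    if "k \<in> koszul_space m n" for k
  proof (intro exI conjI ballI)
    show "k A \<in> carrier (F_ring m)" for A using that by (simp add: koszul_space_def)
    show "k = (\<Sum>A\<in>nsubsets m n. pointwise (*) (k A) (kunit A))"
    proof
      fix B
      have "(\<Sum>A\<in>nsubsets m n. pointwise (*) (k A) (kunit A)) B
          = (\<Sum>A\<in>nsubsets m n. if A = B then k A else 0)"
        unfolding sum_fun_apply by (rule sum.cong) (auto simp: pointwise_def kunit_def)
      then show "k B = (\<Sum>A\<in>nsubsets m n. pointwise (*) (k A) (kunit A)) B"
        using koszul_spaceD(2)[OF that, of B] by simp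
    qed
  qed
  show "module_pair.balanced (F_ring m) pa UNIV (pointwise (*)) (koszul_space m n) (kz n)"
    by (rule balanced_kz)
  show "\<forall>A\<in>nsubsets m n. x A = 0"
    if "\<And>A. A \<in> nsubsets m n \<Longrightarrow> x A \<in> UNIV" "(\<Sum>A\<in>nsubsets m n. kz n (x A) (kunit A)) = 0" for x
    using kunit_sum_sl[of _ n x] that(2) qfact_nonzero by simp
  show "y \<in> alt_tens m n \<longleftrightarrow> (\<exists>x. (\<forall>A\<in>nsubsets m n. x A \<in> UNIV) \<and> y = (\<Sum>A\<in>nsubsets m n. kz n (x A) (kunit A)))" for y
  proof
    assume y: "y \<in> alt_tens m n"
    \<comment> \<open>The factor [n]! undoes the normalisation in \<open>kz\<close>.\<close>
    have "y = (\<Sum>A\<in>nsubsets m n. kz n (qfact n *s y (sl A)) (kunit A))"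
      by (rule alt_tens_eqI[OF y])
        (simp_all add: alt_tens_sum kz_alt kunit_sum_sl qfact_nonzero)
    then show "\<exists>x. (\<forall>A\<in>nsubsets m n. x A \<in> UNIV) \<and> y = (\<Sum>A\<in>nsubsets m n. kz n (x A) (kunit A))"
      by (intro exI[of _ "\<lambda>A. qfact n *s y (sl A)"] conjI ballI UNIV_I)
  next
    assume "\<exists>x. (\<forall>A\<in>nsubsets m n. x A \<in> UNIV) \<and> y = (\<Sum>A\<in>nsubsets m n. kz n (x A) (kunit A))"
    then obtain x where y: "y = (\<Sum>A\<in>nsubsets m n. kz n (x A) (kunit A))" by blast
    show "y \<in> alt_tens m n" unfolding y by (rule alt_tens_sum) (rule kz_alt)
  qed
qed

text \<open>Both sides are compared at increasing words A. There the contraction applies v_i to the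
  coefficient at the word i A and sums over i: the terms with i in A vanish, and sorting i into A
  yields the Koszul sign of the others. The factor [n + 1] of the differential turns 1 / [n + 1]!
  into 1 / [n]!.\<close>

lemma kz_chain:
  assumes k: "k \<in> koszul_space m (Suc n)"
  shows "kz n x (koszul_diff m k) = yb_diff scale RM (Suc n) (kz (Suc n) x k)"
proof (rule alt_tens_eqI[OF kz_alt])
  let ?f = "kz (Suc n) x k"
  show "yb_diff scale RM (Suc n) ?f \<in> alt_tens m n"
    unfolding yb_diff_alt_tens[OF kz_alt] by (intro alt_tens_scale cap_alt_tens kz_alt)
  fix A assume A: "A \<in> nsubsets m n"
  have fin: "finite A" by (rule nsubsets_finite[OF A])
  have qf: "inverse (qfact n) = qint (Suc n) * inverse (qfact (Suc n))"
    using qint_nonzero[of n] qfact_nonzero[of n] by (simp add: qfact_def del: qint.simps)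
  have f_in: "?f (i # sl A) = 0" if "i \<in> A" for i
  \<comment> \<open>The letter i occurs twice, so no distinct word has the same length and the same
    set of letters.\<close>
  proof (rule alternating_vanish[OF alt_tensD(1)[OF kz_alt]])
    fix xs assume xs: "length xs = length (i # sl A)" "set xs = set (i # sl A)" "distinct xs"
    have "set xs = A" using xs(2) fin that by auto
    then have "length xs = card A" using xs(3) distinct_card by metis
    then show "?f xs = 0" using xs(1) fin by simp
  qed
  have f_out: "?f (i # sl A) = (-1) ^ card {j \<in> A. j < i} *s (inverse (qfact (Suc n)) *s pa (k (insert i A)) x)"
    if "i \<in> {1..m} - A" for i
  proof -
    have "?f (i # sl A) = (-1) ^ card {j \<in> set (sl A). j < i} *s ?f (insort i (sl A))"
      by (rule alternating_insort[OF alt_tensD(1)[OF kz_alt]]) (use that fin in auto)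
    moreover have "A - {i} = A" using that by auto
    moreover from this have "insort i (sl A) = sl (insert i A)" using fin by simp
    moreover have "insert i A \<in> nsubsets m (Suc n)" using insert_nsubsets[OF that] A by blast
    ultimately show ?thesis by (simp only: kz_sl set_sorted_list_of_set[OF fin])
  qed
  have "yb_diff scale RM (Suc n) ?f (sl A) = qint (Suc n) *s (\<Sum>i\<in>{1..m}. act i (?f (i # sl A)))"
    unfolding yb_diff_alt_tens[OF kz_alt] pointwise_def cap_def ..
  also have "(\<Sum>i\<in>{1..m}. act i (?f (i # sl A))) = (\<Sum>i\<in>{1..m} - A. act i (?f (i # sl A)))"
    by (rule sum.mono_neutral_right) (auto simp: f_in act_zero)
  also have "\<dots> = (\<Sum>i\<in>{1..m} - A. inverse (qfact (Suc n)) *s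
      pa ((-1) ^ card {j \<in> A. j < i} * (var i * k (insert i A))) x)"
  proof (rule sum.cong[OF refl])
    fix i assume i: "i \<in> {1..m} - A"
    then have im: "i \<in> {1..m}" by simp
    have "act i (?f (i # sl A))
        = (-1) ^ card {j \<in> A. j < i} *s (inverse (qfact (Suc n)) *s act i (pa (k (insert i A)) x))"
      by (simp only: f_out[OF i] act_scale[OF im])
    then show "act i (?f (i # sl A)) = inverse (qfact (Suc n)) *s
        pa ((-1) ^ card {j \<in> A. j < i} * (var i * k (insert i A))) x"
      unfolding pa_sign_mult by (simp only: pa_mult pa_var[OF im] scale_left_commute)
  qed
  also have "qint (Suc n) *s \<dots> = inverse (qfact n) *s pa (koszul_diff m k A) x"
    unfolding koszul_diff_def
    by (simp only: qf pa_sum_left scale_sum_right[symmetric] scale_scale mult.assoc)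
  finally show "kz n x (koszul_diff m k) (sl A) = yb_diff scale RM (Suc n) ?f (sl A)"
    by (simp only: kz_sl[OF A])
qed

theorem koszul_iso: "cplx_iso (finite_complex m scale RM) (M_tensor_koszul m scale RM)"
proof (rule cplx_iso_transport[where \<theta> = "\<lambda>n. tlift (kz n)"])
  let ?X = "finite_complex m scale RM" and ?Y = "M_tensor_koszul m scale RM"
  let ?MF = "mk_module pa UNIV"
  let ?K = "\<lambda>n. mk_module (pointwise (*)) (koszul_space m n)"
  let ?Q = "\<lambda>n. tensor (F_ring m) ?MF (?K n)"
  have fstX: "fst ?X n = mk_module (pointwise scale) (alt_tens m n)"
    and sndX: "snd ?X n = yb_diff scale RM n" for n
    by (simp_all add: finite_complex_def M_bracket_eq)
  have fstY: "carrier (fst ?Y n) = carrier (?Q n)" "\<zero>\<^bsub>fst ?Y n\<^esub> = \<zero>\<^bsub>?Q n\<^esub>"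
    "x \<oplus>\<^bsub>fst ?Y n\<^esub> y = x \<oplus>\<^bsub>?Q n\<^esub> y" "c \<odot>\<^bsub>fst ?Y n\<^esub> x = const_poly c \<odot>\<^bsub>?Q n\<^esub> x" for n x y c
    by (simp_all add: M_tensor_koszul_def Let_def restrict_scalars_def koszul_term_eq)
  have sndY: "snd ?Y (Suc n) = tensor_map (F_ring m) ?MF (?K n) (\<lambda>x. x) (koszul_diff m)" for n
    by (simp add: M_tensor_koszul_def Let_def koszul_term_eq)
  note B = module_pair_basis_kz
  show "is_cplx ?X" by (rule is_cplx_finite)
  show "bij_betw (tlift (kz n)) (carrier (fst ?Y n)) (carrier (fst ?X n))" for n
    unfolding fstX fstY using module_pair_basis.tlift_bij[OF B] by simp
  show "\<zero>\<^bsub>fst ?Y n\<^esub> \<in> carrier (fst ?Y n)" for n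
    unfolding fstY by (rule module_pair_basis.tensor_zero_closed[OF B])
  show "tlift (kz n) \<zero>\<^bsub>fst ?Y n\<^esub> = \<zero>\<^bsub>fst ?X n\<^esub>" for n
    unfolding fstY fstX using module_pair_basis.tlift_zero[OF B] by simp
  show "x \<oplus>\<^bsub>fst ?Y n\<^esub> y \<in> carrier (fst ?Y n)"
    if "x \<in> carrier (fst ?Y n)" "y \<in> carrier (fst ?Y n)" for n x y
    using that unfolding fstY by (rule module_pair_basis.tensor_add_closed[OF B])
  show "tlift (kz n) (x \<oplus>\<^bsub>fst ?Y n\<^esub> y) = tlift (kz n) x \<oplus>\<^bsub>fst ?X n\<^esub> tlift (kz n) y"
    if "x \<in> carrier (fst ?Y n)" "y \<in> carrier (fst ?Y n)" for n x y
    using that module_pair_basis.tlift_add[OF B] unfolding fstY fstX mk_module_simps by blast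
  note mp = module_pair_koszul balanced_kz
  have smult: "tensor_map (F_ring m) ?MF (?K n) (pa (const_poly c)) (\<lambda>b. b) X \<in> carrier (?Q n)"
    "tlift (kz n) (tensor_map (F_ring m) ?MF (?K n) (pa (const_poly c)) (\<lambda>b. b) X) = c \<cdot> tlift (kz n) X"
    if "X \<in> carrier (?Q n)" for n c X
  proof -
    \<comment> \<open>Scalars act on the tensor product through constant polynomials on the factor
      M.\<close>
    have kzc: "kz n (pa (const_poly c) a) b = c \<cdot> kz n a b" for a b
      unfolding kz_def pa_const pa_scale pointwise_def scale_sum_right
      by (intro ext sum.cong refl) (simp only: scale_left_commute)
    show "tensor_map (F_ring m) ?MF (?K n) (pa (const_poly c)) (\<lambda>b. b) X \<in> carrier (?Q n)"
      "tlift (kz n) (tensor_map (F_ring m) ?MF (?K n) (pa (const_poly c)) (\<lambda>b. b) X) = c \<cdot> tlift (kz n) X"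
      by (rule tensor_map_tlift[where I = "alt_tens m n" and D = "pointwise scale c",
          OF mp mp _ _ _ _ _ _ _ _ _ _ _ that];
        (simp only: UNIV_I pa_add_right pa_commute[of "const_poly c"] kzc F.scale_right_diff_distrib
          alt_tens_zero alt_tens_diff kz_alt)?)+
  qed
  have sm: "c \<odot>\<^bsub>fst ?Y n\<^esub> x = tensor_map (F_ring m) ?MF (?K n) (pa (const_poly c)) (\<lambda>b. b) x" for c n x
    unfolding fstY by (rule module_pair.tensor_smult[OF mp(1)])
  show "c \<odot>\<^bsub>fst ?Y n\<^esub> x \<in> carrier (fst ?Y n)" if "x \<in> carrier (fst ?Y n)" for n c x
    using smult(1)[of x n c] that unfolding sm unfolding fstY by blast
  show "tlift (kz n) (c \<odot>\<^bsub>fst ?Y n\<^esub> x) = c \<odot>\<^bsub>fst ?X n\<^esub> tlift (kz n) x"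
    if "x \<in> carrier (fst ?Y n)" for n c x
    using smult(2)[of x n c] that unfolding sm unfolding fstY fstX mk_module_simps by blast
  have diff: "tensor_map (F_ring m) ?MF (?K n) (\<lambda>x. x) (koszul_diff m) X \<in> carrier (?Q n)"
    "tlift (kz n) (tensor_map (F_ring m) ?MF (?K n) (\<lambda>x. x) (koszul_diff m) X)
      = yb_diff scale RM (Suc n) (tlift (kz (Suc n)) X)"
    if "X \<in> carrier (?Q (Suc n))" for n X
  proof -
    have D: "yb_diff scale RM (Suc n) (y - z) = yb_diff scale RM (Suc n) y - yb_diff scale RM (Suc n) z"
      if "y \<in> alt_tens m (Suc n)" "z \<in> alt_tens m (Suc n)" for y z
      using yb_diff_linear(1)[OF alt_tensD(2)[OF alt_tens_diff[OF that]] alt_tensD(2)[OF that(2)]]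
      by (simp only: diff_add_cancel) simp
    show "tensor_map (F_ring m) ?MF (?K n) (\<lambda>x. x) (koszul_diff m) X \<in> carrier (?Q n)"
      "tlift (kz n) (tensor_map (F_ring m) ?MF (?K n) (\<lambda>x. x) (koszul_diff m) X)
        = yb_diff scale RM (Suc n) (tlift (kz (Suc n)) X)"
      by (rule tensor_map_tlift[where I = "alt_tens m (Suc n)" and D = "yb_diff scale RM (Suc n)",
          OF mp mp _ _ _ _ _ _ _ _ _ _ _ that];
        (simp only: UNIV_I koszul_diff_space koszul_diff_add koszul_diff_smult kz_chain D
          alt_tens_zero alt_tens_diff kz_alt)?)+
  qed
  show "snd ?Y (Suc n) x \<in> carrier (fst ?Y n)" if "x \<in> carrier (fst ?Y (Suc n))" for n x
    using diff(1)[of x n] that unfolding sndY unfolding fstY by blast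
  show "tlift (kz n) (snd ?Y (Suc n) x) = snd ?X (Suc n) (tlift (kz (Suc n)) x)"
    if "x \<in> carrier (fst ?Y (Suc n))" for n x
    using diff(2)[of x n] that unfolding sndY sndX unfolding fstY by blast
qed

end


section \<open>The algebra of kernels\<close>

lemma conc_tmul: "f \<in> tens m p \<Longrightarrow> conc f g = tmul (*) p f g"
proof
  fix u assume f: "f \<in> tens m p"
  have "conc f g u = (if p \<le> length u then f (take p u) * g (drop p u) else 0)"
    by (rule conc_homogeneous) (rule tens_length[OF f])
  then show "conc f g u = tmul (*) p f g u"
    using tens_length[OF f, of u] by (auto simp: tmul_def)
qed

lemma conc_append: "f \<in> tens m p \<Longrightarrow> length u = p \<Longrightarrow> conc f g (u @ v) = f u * g v"
  by (simp add: conc_tmul tmul_append)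

lemma conc_tens: "f \<in> tens m p \<Longrightarrow> g \<in> tens m r \<Longrightarrow> conc f g \<in> tens m (p + r)"
  by (simp add: conc_tmul K.tmul_tens)

lemma conc_add_left: "conc (f + f') g = conc f g + conc f' g"
  by (simp add: conc_def fun_eq_iff distrib_right sum.distrib)

lemma conc_add_right: "conc f (g + g') = conc f g + conc f g'"
  by (simp add: conc_def fun_eq_iff distrib_left sum.distrib)

lemma conc_scale_left: "conc (pointwise (*) c f) g = pointwise (*) c (conc f g)"
  unfolding conc_def pointwise_def sum_distrib_left by (intro ext sum.cong refl) (simp only: mult.assoc)

lemma conc_scale_right: "conc f (pointwise (*) c g) = pointwise (*) c (conc f g)"
  unfolding conc_def pointwise_def sum_distrib_left by (intro ext sum.cong refl) (simp only: mult.left_commute)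

lemma conc_sum_left: "conc (\<Sum>i\<in>I. f i) g = (\<Sum>i\<in>I. conc (f i) g)"
  by (rule additive_sum[of "\<lambda>f. conc f g", OF conc_add_left])

lemma conc_sum_right: "conc f (\<Sum>i\<in>I. g i) = (\<Sum>i\<in>I. conc f (g i))"
  by (rule additive_sum[of "conc f", OF conc_add_right])

lemma conc_zero_right [simp]: "conc f 0 = 0"
  by (simp add: conc_def fun_eq_iff)

lemma conc_diff_left: "conc (f - f') g = conc f g - conc f' g"
  by (rule additive_minus(3)[of "\<lambda>f. conc f g", OF conc_add_left])

lemma conc_diff_right: "conc f (g - g') = conc f g - conc f g'"
  by (rule additive_minus(3)[of "conc f", OF conc_add_right])

lemma conc_assoc:
  assumes "f \<in> tens m p" "g \<in> tens m q"
  shows "conc f (conc g h) = conc (conc f g) h"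
proof
  fix u
  have "conc (conc f g) h u = tmul (*) (p + q) (tmul (*) p f g) h u"
    using conc_tmul[OF conc_tens[OF assms]] conc_tmul[OF assms(1)] by simp
  also have "\<dots> = tmul (*) p f (tmul (*) q g h) u"
  proof -
    have "drop p (take (p + q) u) = take q (drop p u)" by (simp add: drop_take)
    moreover have "take p (take (p + q) u) = take p u" by simp
    moreover have "drop (p + q) u = drop q (drop p u)" by (simp add: add.commute)
    ultimately show ?thesis by (simp only: tmul_def mult.assoc)
  qed
  finally show "conc f (conc g h) u = conc (conc f g) h u"
    using conc_tmul[OF assms(1)] conc_tmul[OF assms(2)] by simp
qed

lemma conc_unit_left: "conc (pure 1 []) g = g"
  by (simp add: conc_pure_left fun_eq_iff)

lemma ker_sigmaD: "f \<in> ker_sigma m n \<Longrightarrow> f \<in> tens m n"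
  by (simp add: ker_sigma_def)

lemmas ker_sigma_add = K.F.subspace_add[OF subspace_ker_sigma]
  and ker_sigma_diff = K.F.subspace_diff[OF subspace_ker_sigma]
  and ker_sigma_scale = K.F.subspace_scale[OF subspace_ker_sigma]
  and ker_sigma_zero = K.F.subspace_0[OF subspace_ker_sigma]
  and ker_sigma_sum = K.F.subspace_sum[OF subspace_ker_sigma]

context ratfun_space
begin

text \<open>The terms of S_k f beyond the first l are T_k ... T_(k+l-1) applied to S_(k+l)
  f.\<close>

lemma hsum_split: "S (k + l) r f = 0 \<Longrightarrow> S k (l + r) f = S k l f"
proof (induction l arbitrary: k)
  case (Suc l)
  have "S (Suc k) (l + r) f = S (Suc k) l f" by (rule Suc.IH) (use Suc.prems in simp)
  then show "S k (Suc l + r) f = S k (Suc l) f" by (simp only: add_Suc hsum_Suc)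
qed simp

lemma hecke_tmul:
  assumes "f \<in> tens m p" "Suc k < p"
  shows "T k (tmul scale p f b) = tmul scale p (T k f) b"
proof
  fix u
  show "T k (tmul scale p f b) u = tmul scale p (T k f) b u"
    using assms
  proof (induction k arbitrary: f p u)
    case 0
    then obtain p' where p: "p = Suc (Suc p')" by (metis less_imp_Suc_add add_Suc)
    show ?case
      by (cases u rule: remdups_adj.cases)
        (simp_all add: tmul_def p scale_right_diff_distrib mult.commute)
  next
    case (Suc k)
    then obtain p' where p: "p = Suc p'" by (cases p) auto
    show "T (Suc k) (tmul scale p f b) u = tmul scale p (T (Suc k) f) b u"
    proof (cases u)
      case Nil
      then show ?thesis by (simp add: tmul_def)
    next
      case (Cons x v)
      have "(\<lambda>w. tmul scale p f b (x # w)) = tmul scale p' (\<lambda>w. f (x # w)) b"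
        by (simp add: tmul_def p fun_eq_iff)
      moreover have "T k (tmul scale p' (\<lambda>w. f (x # w)) b) v = tmul scale p' (T k (\<lambda>w. f (x # w))) b v"
        by (rule Suc.IH[of _ p']) (use Suc.prems p in \<open>auto intro: tens_slice\<close>)
      ultimately show ?thesis using Cons by (simp add: tmul_def p)
    qed
  qed
qed

lemma hsum_tmul:
  assumes "f \<in> tens m p"
  shows "k + l = p \<Longrightarrow> S k l (tmul scale p f b) = tmul scale p (S k l f) b"
proof (induction l arbitrary: k)
  case 0
  show "S k 0 (tmul scale p f b) = tmul scale p (S k 0 f) b" by (simp add: tmul_def fun_eq_iff)
next
  case (Suc l)
  have IH: "S (Suc k) l (tmul scale p f b) = tmul scale p (S (Suc k) l f) b"
    by (rule Suc.IH) (use Suc.prems in simp)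
  have "T k (tmul scale p (S (Suc k) l f) b) = tmul scale p (T k (S (Suc k) l f)) b"
  proof (cases l)
    \<comment> \<open>Here k = p - 1, so T_k would reach across the border between the factors, but
      it is applied to the empty sum.\<close>
    case 0
    have "tmul scale p 0 b = 0" by (simp add: tmul_def fun_eq_iff)
    then show ?thesis by (simp only: 0 hsum_0 hecke_zero)
  next
    case (Suc l')
    then show ?thesis using Suc.prems by (intro hecke_tmul[of _ m] hsum_tens assms) simp
  qed
  then show "S k (Suc l) (tmul scale p f b) = tmul scale p (S k (Suc l) f) b"
    by (simp only: hsum_Suc IH tmul_add_left)
qed

end

text \<open>As S_p kills b behind a, the sum S_0 over p + r letters may stop after p of them; then
  it acts on a alone and gives 0.\<close>

lemma conc_ker_sigma:
  assumes a: "a \<in> ker_sigma m p" and b: "b \<in> ker_sigma m r"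
  shows "conc a b \<in> ker_sigma m (p + r)"
proof -
  have at: "a \<in> tens m p" and a0: "hsum (*) 0 p a = 0" using a unfolding ker_sigma_eq by blast+
  have c: "conc a b = tmul (*) p a b" by (rule conc_tmul[OF at])
  have "hsum (*) 0 (p + r) (conc a b) = hsum (*) 0 p (conc a b)"
    unfolding c by (rule K.hsum_split) (simp add: K.hsum_tmul_ker[OF at b])
  also have "\<dots> = tmul (*) p (hsum (*) 0 p a) b"
    unfolding c by (rule K.hsum_tmul[OF at]) simp
  also have "\<dots> = 0" by (simp add: a0 tmul_def fun_eq_iff)
  finally show ?thesis
    unfolding ker_sigma_eq using conc_tens[OF at ker_sigmaD[OF b]] by blast
qed

section \<open>Decomposition of tensors by brackets with kernel coefficients\<close>

definition subsets_le :: "nat \<Rightarrow> nat \<Rightarrow> nat set set" where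
  "subsets_le m n = {A. A \<subseteq> {1..m} \<and> card A \<le> n}"

lemma finite_subsets_le [simp]: "finite (subsets_le m n)"
  by (rule finite_subset[of _ "Pow {1..m}"]) (auto simp: subsets_le_def)

lemma subsets_le_finite: "A \<in> subsets_le m n \<Longrightarrow> finite A"
  using finite_subset[of A "{1..m}"] by (simp add: subsets_le_def)

lemma subsets_le_card: "A \<in> subsets_le m n \<Longrightarrow> A \<in> nsubsets m (card A)" "A \<in> subsets_le m n \<Longrightarrow> card A \<le> n"
  by (simp_all add: subsets_le_def nsubsets_def)

lemma sum_subsets_le: "(\<Sum>p\<le>n. \<Sum>A\<in>nsubsets m p. h A) = (\<Sum>A\<in>subsets_le m n. h A)"
proof -
  have "(\<Sum>p\<le>n. \<Sum>A\<in>nsubsets m p. h A) = (\<Sum>p\<in>{..n}. \<Sum>A\<in>{A \<in> subsets_le m n. card A = p}. h A)"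
    by (intro sum.cong refl) (auto simp: nsubsets_def subsets_le_def)
  also have "\<dots> = (\<Sum>A\<in>subsets_le m n. h A)"
    by (rule sum.group) (auto simp: subsets_le_def)
  finally show ?thesis .
qed

abbreviation br :: "nat set \<Rightarrow> nat list \<Rightarrow> ratfun" where
  "br A \<equiv> bracket (sl A)"

lemma br_alt: "A \<in> nsubsets m n \<Longrightarrow> br A \<in> alt_tens m n"
  by (simp add: bracket_alt_tens sl_words)

lemma br_tens: "A \<in> nsubsets m n \<Longrightarrow> br A \<in> tens m n"
  by (simp add: br_alt alt_tensD)

lemma br_conc_tens:
  "A \<in> subsets_le m n \<Longrightarrow> b \<in> ker_sigma m (n - card A) \<Longrightarrow> conc (br A) b \<in> tens m n"
  using conc_tens[OF br_tens[of A m "card A"] ker_sigmaD[of b m "n - card A"]]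
  by (simp add: subsets_le_card)

text \<open>This makes the summand of A = {} in the decompositions below the kernel itself.\<close>

lemma bracket_Nil: "bracket [] = pure 1 []"
proof
  have "{\<tau>. \<tau> permutes ({} :: nat set)} = {id}" by (auto simp: fun_eq_iff)
  then show "bracket [] u = pure 1 [] u" for u by (simp add: bracket_def del: permutes_empty)
qed

text \<open>The scalar case of the decomposition into the E_p, with the first p letters expanded in
  brackets of increasing words: for |A| = p the coefficient of [A] is the slice at the word A of the
  component in E_p.\<close>

theorem bracket_decompose:
  assumes "f \<in> tens m n"
  shows "\<exists>b. (\<forall>A\<in>subsets_le m n. b A \<in> ker_sigma m (n - card A)) \<and> f = (\<Sum>A\<in>subsets_le m n. conc (br A) (b A))"
proof -
  obtain y where y: "\<forall>p\<le>n. y p \<in> K.E m n p" and f: "f = (\<Sum>p\<le>n. y p)"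
    using K.eigenpart_decompose[OF assms] by blast
  have yt: "y p \<in> tens m (p + (n - p))" "hsum (*) p (n - p) (y p) = 0" if "p \<le> n" for p
    using y that by (simp_all add: eigenpart_def)
  define b where "b A = (\<lambda>v. y (card A) (sl A @ v))" for A
  have b: "b A \<in> ker_sigma m (n - card A)" if A: "A \<in> subsets_le m n" for A
  proof -
    note fin = subsets_le_finite[OF A] and le = subsets_le_card(2)[OF A]
    have "b A \<in> tens m (n - card A)"
      unfolding b_def by (rule tens_slices[OF yt(1)[OF le]]) (use fin in simp)
    moreover have "hsum (*) 0 (n - card A) (b A) = 0"
    proof
      show "hsum (*) 0 (n - card A) (b A) v = 0 v" for v
        using K.hsum_append[of "sl A" 0 "n - card A" "y (card A)" v] yt(2)[OF le] fin
        by (simp add: b_def)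
    qed
    ultimately show ?thesis unfolding ker_sigma_eq by blast
  qed
  have "y p = (\<Sum>A\<in>nsubsets m p. conc (br A) (b A))" if p: "p \<le> n" for p
  proof
    fix w
    have bA: "conc (br A) (b A) \<in> tens m n" if "A \<in> nsubsets m p" for A
      using that p by (intro br_conc_tens b) (auto simp: nsubsets_def subsets_le_def)
    show "y p w = (\<Sum>A\<in>nsubsets m p. conc (br A) (b A)) w"
    proof (cases "length w = n")
      case True
      define u v where "u = take p w" "v = drop p w"
      have w: "w = u @ v" and u: "length u = p" using True p by (simp_all add: u_v_def)
      have yE: "y p \<in> K.E m (p + (n - p)) p" using y p by simp
      have len: "length (sl A) = p" "card A = p" if "A \<in> nsubsets m p" for A
        using that nsubsets_finite[OF that] by (simp_all add: nsubsets_def)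
      have "y p (u @ v) = (\<Sum>A\<in>nsubsets m p. br A u * y p (sl A @ v))"
        using K.alt_tens_expand[OF K.eigenpart_slice_alt[OF yE, of v], of u] u len by simp
      also have "\<dots> = (\<Sum>A\<in>nsubsets m p. conc (br A) (b A) (u @ v))"
        by (intro sum.cong refl) (simp add: conc_append[OF br_tens _] u b_def len)
      finally show ?thesis by (simp add: w sum_fun_apply)
    next
      case False
      then show ?thesis
        using tens_length[OF yt(1)[OF p]] p tens_length[OF bA] by (simp add: sum_fun_apply)
    qed
  qed
  then have "f = (\<Sum>p\<le>n. \<Sum>A\<in>nsubsets m p. conc (br A) (b A))" unfolding f by (intro sum.cong) auto
  then show ?thesis using b unfolding sum_subsets_le by blast
qed

text \<open>Brackets of different sizes are separated by \<open>eigenpart_independent\<close>; among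
  those of one size, evaluating the first letters at the word B leaves only the coefficient of
  [B].\<close>

theorem bracket_independent:
  assumes b: "\<And>A. A \<in> subsets_le m n \<Longrightarrow> b A \<in> ker_sigma m (n - card A)"
    and sum: "(\<Sum>A\<in>subsets_le m n. conc (br A) (b A)) = 0" and B: "B \<in> subsets_le m n"
  shows "b B = 0"
proof -
  define y where "y p = (\<Sum>A\<in>nsubsets m p. conc (br A) (b A))" for p
  have y: "\<forall>p\<le>n. y p \<in> K.E m n p"
  proof (intro allI impI)
    fix p assume p: "p \<le> n"
    show "y p \<in> K.E m n p"
      unfolding y_def
    proof (rule K.F.subspace_sum[OF K.subspace_eigenpart])
      fix A assume A: "A \<in> nsubsets m p"
      then have "A \<in> subsets_le m n" "card A = p" using p by (auto simp: nsubsets_def subsets_le_def)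
      then have "b A \<in> ker_sigma m (n - p)" using b[of A] by simp
      from K.tmul_eigenpart[OF br_alt[OF A] this]
      show "conc (br A) (b A) \<in> K.E m n p" using p by (simp add: conc_tmul[OF br_tens[OF A]])
    qed
  qed
  have "(\<Sum>p\<le>n. y p) = 0" unfolding y_def sum_subsets_le by (rule sum)
  from K.eigenpart_independent[OF y this subsets_le_card(2)[OF B]]
  have y0: "y (card B) = 0" .
  show ?thesis
  proof
    fix v
    have Bn: "B \<in> nsubsets m (card B)" by (rule subsets_le_card[OF B])
    have "0 = (\<Sum>A\<in>nsubsets m (card B). conc (br A) (b A) (sl B @ v))"
      using fun_cong[OF y0, of "sl B @ v"] by (simp add: y_def sum_fun_apply)
    also have "\<dots> = (\<Sum>A\<in>nsubsets m (card B). br A (sl B) * b A v)"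
      by (intro sum.cong refl) (simp add: conc_append[OF br_tens] subsets_le_finite[OF B])
    also have "\<dots> = b B v" using K.bracket_expansion_sl[OF Bn, of "\<lambda>A. b A v"] by simp
    finally show "b B v = 0 v" by simp
  qed
qed

section \<open>Products of a letter and a bracket\<close>

definition letter_br :: "nat \<times> nat set \<Rightarrow> nat list \<Rightarrow> ratfun" where
  "letter_br x = conc (pure 1 [fst x]) (br (snd x))"

text \<open>The pairs (i, A) that occur in degree n + 1, one letter being used up by v_i.\<close>

definition letter_pairs :: "nat \<Rightarrow> nat \<Rightarrow> (nat \<times> nat set) set" where
  "letter_pairs m n = {1..m} \<times> subsets_le m n"

text \<open>The leading pairs of brackets. Every pair (i, {}) is low, which is why no generator has
  degree 1.\<close>

definition low :: "nat \<times> nat set \<Rightarrow> bool" where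
  "low x \<longleftrightarrow> (\<forall>a\<in>snd x. fst x < a)"

definition ins :: "nat \<times> nat set \<Rightarrow> nat set" where
  "ins x = insert (fst x) (snd x)"

definition gen_pairs :: "nat \<Rightarrow> nat \<Rightarrow> (nat \<times> nat set) set" where
  "gen_pairs m n = {x \<in> letter_pairs m n. \<not> low x}"

definition nonempty_le :: "nat \<Rightarrow> nat \<Rightarrow> nat set set" where
  "nonempty_le m n = subsets_le m n - {{}}"

text \<open>The degree n part of the span I: stable under right multiplication by kernel elements,
  and a complement of the kernel by \<open>ker_plus_ideal\<close> and
  \<open>ker_ideal_trivial\<close>.\<close>

definition bracket_ideal :: "nat \<Rightarrow> nat \<Rightarrow> (nat list \<Rightarrow> ratfun) set" where
  "bracket_ideal m n = {\<Sum>B\<in>nonempty_le m n. conc (br B) (d B) | d.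
     \<forall>B\<in>nonempty_le m n. d B \<in> ker_sigma m (n - card B)}"

lemma finite_letter_pairs [simp]: "finite (letter_pairs m n)"
  by (simp add: letter_pairs_def)

lemma finite_gen_pairs [simp]: "finite (gen_pairs m n)"
  by (simp add: gen_pairs_def)

lemma finite_nonempty_le [simp]: "finite (nonempty_le m n)"
  by (simp add: nonempty_le_def)

lemma gen_pairs_letter: "x \<in> gen_pairs m n \<Longrightarrow> x \<in> letter_pairs m n"
  by (simp add: gen_pairs_def)

lemma letter_tens: "i \<in> {1..m} \<Longrightarrow> pure 1 [i] \<in> tens m 1"
  by (rule pure_tens) (simp add: words_def)

lemma conc_letter: "conc (pure 1 [i]) g (j # u) = (if j = i then g u else 0)"
  "conc (pure 1 [i]) g [] = 0"
  by (simp_all add: conc_pure_left)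

lemma letter_expand:
  assumes "f \<in> tens m (Suc n)"
  shows "f = (\<Sum>i\<in>{1..m}. conc (pure 1 [i]) (\<lambda>u. f (i # u)))"
proof
  fix w
  show "f w = (\<Sum>i\<in>{1..m}. conc (pure 1 [i]) (\<lambda>u. f (i # u))) w"
  proof (cases w)
    case Nil
    then show ?thesis using tens_length[OF assms, of "[]"] by (simp add: sum_fun_apply conc_letter)
  next
    case (Cons j u)
    have "j \<notin> {1..m} \<Longrightarrow> f (j # u) = 0"
      using tens_eq_0[OF assms, of "j # u"] by (auto simp: Cons_words_iff)
    then show ?thesis unfolding Cons sum_fun_apply conc_letter by (auto simp: sum.delta)
  qed
qed

lemma letter_br_tens:
  assumes "x \<in> letter_pairs m n"
  shows "letter_br x \<in> tens m (Suc (card (snd x)))"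
proof -
  have "fst x \<in> {1..m}" "snd x \<in> nsubsets m (card (snd x))"
    using assms subsets_le_card(1)[of "snd x" m n] by (auto simp: letter_pairs_def)
  then show ?thesis
    unfolding letter_br_def using conc_tens[OF letter_tens br_tens] by simp
qed

lemma conc_letter_br:
  assumes "x \<in> letter_pairs m n"
  shows "conc (letter_br x) b = conc (pure 1 [fst x]) (conc (br (snd x)) b)"
proof -
  have "fst x \<in> {1..m}" "snd x \<in> nsubsets m (card (snd x))"
    using assms subsets_le_card(1)[of "snd x" m n] by (auto simp: letter_pairs_def)
  then show ?thesis
    unfolding letter_br_def by (intro conc_assoc[OF letter_tens br_tens, symmetric])
qed

text \<open>Strip the first letter i and decompose the remaining tensor of degree n by
  \<open>bracket_decompose\<close>.\<close>

lemma letter_br_expand: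
  assumes "f \<in> tens m (Suc n)"
  shows "\<exists>b. (\<forall>x\<in>letter_pairs m n. b x \<in> ker_sigma m (n - card (snd x))) \<and>
    f = (\<Sum>x\<in>letter_pairs m n. conc (letter_br x) (b x))"
proof -
  have "\<exists>b. (\<forall>A\<in>subsets_le m n. b A \<in> ker_sigma m (n - card A)) \<and>
      (\<lambda>u. f (i # u)) = (\<Sum>A\<in>subsets_le m n. conc (br A) (b A))" for i
    by (rule bracket_decompose) (rule tens_slice[OF assms])
  then obtain b where b: "\<And>i A. A \<in> subsets_le m n \<Longrightarrow> b i A \<in> ker_sigma m (n - card A)"
    and fb: "\<And>i. (\<lambda>u. f (i # u)) = (\<Sum>A\<in>subsets_le m n. conc (br A) (b i A))" by metis
  have "f = (\<Sum>i\<in>{1..m}. \<Sum>A\<in>subsets_le m n. conc (pure 1 [i]) (conc (br A) (b i A)))"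
    using letter_expand[OF assms] by (simp only: fb conc_sum_right)
  also have "\<dots> = (\<Sum>x\<in>letter_pairs m n. conc (pure 1 [fst x]) (conc (br (snd x)) (b (fst x) (snd x))))"
    unfolding letter_pairs_def sum.cartesian_product by (simp add: case_prod_beta)
  also have "\<dots> = (\<Sum>x\<in>letter_pairs m n. conc (letter_br x) (b (fst x) (snd x)))"
    by (rule sum.cong[OF refl]) (simp add: conc_letter_br)
  finally show ?thesis
    using b by (intro exI[of _ "\<lambda>x. b (fst x) (snd x)"]) (auto simp: letter_pairs_def)
qed

text \<open>The coordinates at words beginning with i single out the pairs (i, A), to which
  \<open>bracket_independent\<close> applies.\<close>

lemma letter_br_independent:
  assumes b: "\<And>x. x \<in> letter_pairs m n \<Longrightarrow> b x \<in> ker_sigma m (n - card (snd x))"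
    and sum: "(\<Sum>x\<in>letter_pairs m n. conc (letter_br x) (b x)) = 0" and x: "x \<in> letter_pairs m n"
  shows "b x = 0"
proof -
  obtain i A where xiA: "x = (i, A)" by (cases x)
  have i: "i \<in> {1..m}" and A: "A \<in> subsets_le m n" using x by (auto simp: xiA letter_pairs_def)
  have "(\<Sum>A\<in>subsets_le m n. conc (br A) (b (i, A))) = 0"
  proof
    fix u
    have "0 = (\<Sum>x\<in>letter_pairs m n. conc (letter_br x) (b x)) (i # u)" by (simp add: sum)
    also have "\<dots> = (\<Sum>x\<in>letter_pairs m n. if fst x = i then conc (br (snd x)) (b x) u else 0)"
      unfolding sum_fun_apply by (rule sum.cong[OF refl]) (simp add: conc_letter_br conc_letter)
    also have "\<dots> = (\<Sum>j\<in>{1..m}. \<Sum>A\<in>subsets_le m n. if j = i then conc (br A) (b (j, A)) u else 0)"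
      unfolding letter_pairs_def sum.cartesian_product by (intro sum.cong) auto
    also have "\<dots> = (\<Sum>j\<in>{1..m}. if j = i then (\<Sum>A\<in>subsets_le m n. conc (br A) (b (j, A)) u) else 0)"
      by (intro sum.cong refl) simp
    also have "\<dots> = (\<Sum>A\<in>subsets_le m n. conc (br A) (b (i, A)) u)" using i by simp
    finally show "(\<Sum>A\<in>subsets_le m n. conc (br A) (b (i, A))) u = 0 u" by (simp add: sum_fun_apply)
  qed
  then have "b (i, A) = 0"
  proof (rule bracket_independent[rotated])
    show "b (i, A) \<in> ker_sigma m (n - card A)" if "A \<in> subsets_le m n" for A
      using b[of "(i, A)"] that i by (simp add: letter_pairs_def)
  qed (rule A)
  then show ?thesis by (simp add: xiA)
qed

lemma br_letter_length:
  assumes "B \<in> subsets_le m n" "finite C" "br B (j # sl C) \<noteq> 0"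
  shows "card B = Suc (card C)"
  using tens_length[OF br_tens[OF subsets_le_card(1)[OF assms(1)]], of "j # sl C"] assms by fastforce

text \<open>Behind a first letter j the bracket [B] is still alternating, and its coefficient along
  [A] is the value of [B] at the word j A. This value is 0 unless |B| = |A| + 1, so the sum may run
  over all pairs.\<close>

lemma br_letter_expand:
  assumes B: "B \<in> nonempty_le m (Suc n)"
  shows "br B = (\<Sum>x\<in>letter_pairs m n. pointwise (*) (br B (fst x # sl (snd x))) (letter_br x))"
proof -
  have Bs: "B \<in> subsets_le m (Suc n)" "B \<noteq> {}" using B by (auto simp: nonempty_le_def)
  have fin: "finite B" by (rule subsets_le_finite[OF Bs(1)])
  then obtain p where p: "card B = Suc p" using Bs(2) by (metis card_0_eq not0_implies_Suc)
  have pn: "p \<le> n" using subsets_le_card(2)[OF Bs(1)] p by simp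
  have alt: "br B \<in> alt_tens m (Suc p)" using br_alt[OF subsets_le_card(1)[OF Bs(1)]] p by simp
  have slice: "(\<lambda>u. br B (j # u)) = (\<Sum>A\<in>subsets_le m n. pointwise (*) (br B (j # sl A)) (br A))" for j
  proof
    fix u
    have "(\<lambda>u. br B (j # u)) \<in> alt_tens m p"
      using tens_slice[OF alt_tensD(2)[OF alt]] alternating_slice_Cons[OF alt_tensD(1)[OF alt]]
      by (simp add: alt_tens_def)
    from K.alt_tens_expand[OF this, of u]
    have "br B (j # u) = (\<Sum>A\<in>nsubsets m p. br A u * br B (j # sl A))" .
    also have "\<dots> = (\<Sum>A\<in>subsets_le m n. br A u * br B (j # sl A))"
    proof (rule sum.mono_neutral_left)
      show "nsubsets m p \<subseteq> subsets_le m n" using pn by (auto simp: nsubsets_def subsets_le_def)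
      show "\<forall>A\<in>subsets_le m n - nsubsets m p. br A u * br B (j # sl A) = 0"
      proof
        fix A assume A: "A \<in> subsets_le m n - nsubsets m p"
        then have "card A \<noteq> p" by (auto simp: nsubsets_def subsets_le_def)
        then have "br B (j # sl A) = 0"
          using br_letter_length[OF Bs(1), of A j] subsets_le_finite A p by fastforce
        then show "br A u * br B (j # sl A) = 0" by simp
      qed
    qed simp
    finally show "br B (j # u) = (\<Sum>A\<in>subsets_le m n. pointwise (*) (br B (j # sl A)) (br A)) u"
      by (simp only: sum_fun_apply pointwise_def mult.commute)
  qed
  have "br B = (\<Sum>i\<in>{1..m}. conc (pure 1 [i]) (\<lambda>u. br B (i # u)))"
    by (rule letter_expand[OF alt_tensD(2)[OF alt]])
  also have "\<dots> = (\<Sum>i\<in>{1..m}. \<Sum>A\<in>subsets_le m n.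
      pointwise (*) (br B (i # sl A)) (letter_br (i, A)))"
    by (simp only: slice conc_sum_right conc_scale_right letter_br_def fst_conv snd_conv)
  also have "\<dots> = (\<Sum>x\<in>letter_pairs m n. pointwise (*) (br B (fst x # sl (snd x))) (letter_br x))"
    unfolding letter_pairs_def sum.cartesian_product by (simp add: case_prod_beta)
  finally show ?thesis .
qed

lemma sl_ins:
  assumes "low x" "finite (snd x)"
  shows "sl (ins x) = fst x # sl (snd x)"
proof -
  have "fst x \<notin> snd x" using assms(1) by (auto simp: low_def)
  then have "sl (ins x) = insort (fst x) (sl (snd x))"
    using assms(2) by (simp add: ins_def)
  also have "\<dots> = fst x # sl (snd x)"
    by (rule insort_is_Cons) (use assms in \<open>auto simp: low_def intro: less_imp_le\<close>)
  finally show ?thesis .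
qed

lemma ins_nonempty_le:
  assumes "x \<in> letter_pairs m n" "low x"
  shows "ins x \<in> nonempty_le m (Suc n)" "card (ins x) = Suc (card (snd x))"
proof -
  have x: "fst x \<in> {1..m}" "snd x \<in> subsets_le m n" using assms(1) by (auto simp: letter_pairs_def)
  have "fst x \<notin> snd x" using assms(2) by (auto simp: low_def)
  then show c: "card (ins x) = Suc (card (snd x))"
    using subsets_le_finite[OF x(2)] by (simp add: ins_def)
  show "ins x \<in> nonempty_le m (Suc n)"
    using x c by (auto simp: nonempty_le_def subsets_le_def ins_def)
qed

text \<open>The smallest element of B is split off.\<close>

lemma nonempty_le_ins:
  assumes "B \<in> nonempty_le m (Suc n)"
  shows "\<exists>x\<in>letter_pairs m n. low x \<and> ins x = B"
proof -
  have B: "B \<subseteq> {1..m}" "card B \<le> Suc n" "B \<noteq> {}" using assms by (auto simp: nonempty_le_def subsets_le_def)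
  have fin: "finite B" using B(1) finite_subset by blast
  let ?x = "(Min B, B - {Min B})"
  have M: "Min B \<in> B" using fin B(3) by simp
  have "Min B \<in> {1..m}" using M B(1) by blast
  then have "?x \<in> letter_pairs m n"
    using B M fin by (auto simp: letter_pairs_def subsets_le_def card_Diff_singleton)
  moreover have "low ?x" using fin by (auto simp: low_def order_less_le)
  moreover have "ins ?x = B" using M by (auto simp: ins_def)
  ultimately show ?thesis by blast
qed

lemma ins_inject:
  assumes "low x" "low y" "finite (snd x)" "finite (snd y)" "ins x = ins y"
  shows "x = y"
proof -
  have "fst x # sl (snd x) = fst y # sl (snd y)"
    using sl_ins[OF assms(1,3)] sl_ins[OF assms(2,4)] assms(5) by simp
  then have "fst x = fst y" "sl (snd x) = sl (snd y)" by simp_all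
  then show ?thesis using assms(3,4) by (metis prod.expand set_sorted_list_of_set)
qed

lemma letter_pairs_finite: "x \<in> letter_pairs m n \<Longrightarrow> finite (snd x)"
  by (auto simp: letter_pairs_def subsets_le_finite)

text \<open>Restricted to low pairs, the expansions of the brackets form an identity matrix. This
  leading-term property allows the low pairs to be eliminated.\<close>

lemma br_low:
  assumes "x \<in> letter_pairs m n" "low x" "finite B"
  shows "br B (fst x # sl (snd x)) = (if B = ins x then 1 else 0)"
proof -
  have fin: "finite (snd x)" using assms(1) by (rule letter_pairs_finite)
  have "finite (ins x)" using fin by (simp add: ins_def)
  then show ?thesis using bracket_sl[OF assms(3)] sl_ins[OF assms(2) fin] by metis
qed

text \<open>The index set Z is left open: \<open>gen_expand\<close> takes the brackets that come
  from low pairs, \<open>gen_independent\<close> all nonempty subsets.\<close>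

lemma bracket_ideal_sum_letters:
  assumes "\<And>B. B \<in> Z \<Longrightarrow> B \<in> nonempty_le m (Suc n)"
  shows "(\<Sum>B\<in>Z. conc (br B) (d B)) = (\<Sum>x\<in>letter_pairs m n.
    conc (letter_br x) (\<Sum>B\<in>Z. pointwise (*) (br B (fst x # sl (snd x))) (d B)))"
proof -
  have "conc (br B) (d B)
      = (\<Sum>x\<in>letter_pairs m n. conc (letter_br x) (pointwise (*) (br B (fst x # sl (snd x))) (d B)))"
    if "B \<in> Z" for B
    by (subst br_letter_expand[OF assms[OF that]])
      (simp only: conc_sum_left conc_scale_left conc_scale_right)
  then have "(\<Sum>B\<in>Z. conc (br B) (d B)) = (\<Sum>B\<in>Z. \<Sum>x\<in>letter_pairs m n.
      conc (letter_br x) (pointwise (*) (br B (fst x # sl (snd x))) (d B)))" by simp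
  also have "\<dots> = (\<Sum>x\<in>letter_pairs m n. \<Sum>B\<in>Z.
      conc (letter_br x) (pointwise (*) (br B (fst x # sl (snd x))) (d B)))" by (rule sum.swap)
  finally show ?thesis by (simp only: conc_sum_right)
qed

lemma bracket_ideal_coeff:
  assumes "x \<in> letter_pairs m n" "\<And>B. B \<in> Z \<Longrightarrow> B \<in> nonempty_le m (Suc n)"
    "\<And>B. B \<in> Z \<Longrightarrow> d B \<in> ker_sigma m (Suc n - card B)"
  shows "(\<Sum>B\<in>Z. pointwise (*) (br B (fst x # sl (snd x))) (d B)) \<in> ker_sigma m (n - card (snd x))"
proof (rule ker_sigma_sum)
  fix B assume B: "B \<in> Z"
  show "pointwise (*) (br B (fst x # sl (snd x))) (d B) \<in> ker_sigma m (n - card (snd x))"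
  proof (cases "br B (fst x # sl (snd x)) = 0")
    case True
    then show ?thesis by (simp add: ker_sigma_zero)
  next
    \<comment> \<open>A nonzero coefficient forces |B| = |A| + 1, so the degrees of the two kernels
      agree.\<close>
    case False
    have "B \<in> subsets_le m (Suc n)" using assms(2)[OF B] by (simp add: nonempty_le_def)
    from br_letter_length[OF this letter_pairs_finite[OF assms(1)] False]
    show ?thesis using assms(3)[OF B] by (simp add: ker_sigma_scale)
  qed
qed

lemma bracket_idealI:
  "(\<And>B. B \<in> nonempty_le m n \<Longrightarrow> d B \<in> ker_sigma m (n - card B)) \<Longrightarrow>
    (\<Sum>B\<in>nonempty_le m n. conc (br B) (d B)) \<in> bracket_ideal m n"
  unfolding bracket_ideal_def by blast

lemma bracket_ideal_zero: "0 \<in> bracket_ideal m n"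
  using bracket_idealI[of m n "\<lambda>_. 0"] by (simp add: ker_sigma_zero)

lemma bracket_ideal_add:
  assumes "f \<in> bracket_ideal m n" "g \<in> bracket_ideal m n"
  shows "f + g \<in> bracket_ideal m n"
proof -
  obtain d e where "\<forall>B\<in>nonempty_le m n. d B \<in> ker_sigma m (n - card B)" "f = (\<Sum>B\<in>nonempty_le m n. conc (br B) (d B))"
    "\<forall>B\<in>nonempty_le m n. e B \<in> ker_sigma m (n - card B)" "g = (\<Sum>B\<in>nonempty_le m n. conc (br B) (e B))"
    using assms unfolding bracket_ideal_def by blast
  then show ?thesis
    using bracket_idealI[of m n "\<lambda>B. d B + e B"] by (simp add: ker_sigma_add conc_add_right sum.distrib)
qed

lemma bracket_ideal_sum:
  "(\<And>i. i \<in> I \<Longrightarrow> f i \<in> bracket_ideal m n) \<Longrightarrow> (\<Sum>i\<in>I. f i) \<in> bracket_ideal m n"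
  by (induction I rule: infinite_finite_induct) (auto intro: bracket_ideal_add bracket_ideal_zero)

lemma bracket_ideal_br:
  assumes B: "B \<in> nonempty_le m n" and h: "h \<in> ker_sigma m (n - card B)"
  shows "conc (br B) h \<in> bracket_ideal m n"
proof -
  have "conc (br B) h = (\<Sum>B'\<in>nonempty_le m n. if B' = B then conc (br B) h else 0)" using B by simp
  also have "\<dots> = (\<Sum>B'\<in>nonempty_le m n. conc (br B') (if B' = B then h else 0))"
    by (intro sum.cong) auto
  also have "\<dots> \<in> bracket_ideal m n"
    by (rule bracket_idealI) (auto simp: h ker_sigma_zero)
  finally show ?thesis .
qed

text \<open>Only the kernel factor of [B] c is changed, and kernels are closed under
  products.\<close>

lemma bracket_ideal_conc:
  assumes "w \<in> bracket_ideal m p" "h \<in> ker_sigma m r"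
  shows "conc w h \<in> bracket_ideal m (p + r)"
proof -
  obtain d where d: "\<forall>B\<in>nonempty_le m p. d B \<in> ker_sigma m (p - card B)"
    and w: "w = (\<Sum>B\<in>nonempty_le m p. conc (br B) (d B))"
    using assms(1) unfolding bracket_ideal_def by blast
  have "conc (conc (br B) (d B)) h \<in> bracket_ideal m (p + r)" if B: "B \<in> nonempty_le m p" for B
  proof -
    have Bs: "B \<in> subsets_le m p" using B by (simp add: nonempty_le_def)
    have dB: "d B \<in> ker_sigma m (p - card B)" using d B by blast
    have "conc (conc (br B) (d B)) h = conc (br B) (conc (d B) h)"
      by (rule conc_assoc[OF br_tens[OF subsets_le_card(1)[OF Bs]] ker_sigmaD[OF dB], symmetric])
    also have "\<dots> \<in> bracket_ideal m (p + r)"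
    proof (rule bracket_ideal_br)
      show "B \<in> nonempty_le m (p + r)" using B by (auto simp: nonempty_le_def subsets_le_def)
      show "conc (d B) h \<in> ker_sigma m (p + r - card B)"
        using conc_ker_sigma[OF dB assms(2)] subsets_le_card(2)[OF Bs] by simp
    qed
    finally show ?thesis .
  qed
  then show ?thesis unfolding w conc_sum_left by (rule bracket_ideal_sum)
qed

lemma subsets_le_insert: "subsets_le m n = insert {} (nonempty_le m n)" "{} \<notin> nonempty_le m n"
  by (auto simp: nonempty_le_def subsets_le_def)

text \<open>In \<open>bracket_decompose\<close> the summand of A = {} is the kernel component, and
  the others lie in I.\<close>

lemma ker_plus_ideal:
  assumes "f \<in> tens m n"
  shows "\<exists>h\<in>ker_sigma m n. f - h \<in> bracket_ideal m n"
proof -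
  obtain b where b: "\<forall>A\<in>subsets_le m n. b A \<in> ker_sigma m (n - card A)"
    and f: "f = (\<Sum>A\<in>subsets_le m n. conc (br A) (b A))"
    using bracket_decompose[OF assms] by blast
  have "f = b {} + (\<Sum>A\<in>nonempty_le m n. conc (br A) (b A))"
    using f subsets_le_insert[of m n] by (simp add: bracket_Nil conc_unit_left)
  moreover have "b {} \<in> ker_sigma m n" using b by (auto simp: subsets_le_def)
  moreover have "(\<Sum>A\<in>nonempty_le m n. conc (br A) (b A)) \<in> bracket_ideal m n"
    by (rule bracket_idealI) (use b in \<open>auto simp: nonempty_le_def\<close>)
  ultimately show ?thesis by (intro bexI[of _ "b {}"]) simp_all
qed

lemma ker_ideal_trivial:
  assumes h: "h \<in> ker_sigma m n" and "h \<in> bracket_ideal m n"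
  shows "h = 0"
proof -
  obtain d where d: "\<forall>B\<in>nonempty_le m n. d B \<in> ker_sigma m (n - card B)"
    and hd: "h = (\<Sum>B\<in>nonempty_le m n. conc (br B) (d B))"
    using assms(2) unfolding bracket_ideal_def by blast
  \<comment> \<open>The element h is brought to the other side as the coefficient of the empty
    bracket, so that a single independence statement applies.\<close>
  define b where "b = d({} := - h)"
  have "b {} = 0"
  proof (rule bracket_independent[of m n b])
    show "b A \<in> ker_sigma m (n - card A)" if "A \<in> subsets_le m n" for A
      using that d h K.F.subspace_neg[OF subspace_ker_sigma h] by (auto simp: b_def nonempty_le_def)
    have "(\<Sum>A\<in>nonempty_le m n. conc (br A) (b A)) = h"
      unfolding hd by (intro sum.cong refl) (auto simp: b_def nonempty_le_def)
    then show "(\<Sum>A\<in>subsets_le m n. conc (br A) (b A)) = 0"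
      using subsets_le_insert[of m n] by (simp add: b_def bracket_Nil conc_unit_left)
    show "{} \<in> subsets_le m n" by (simp add: subsets_le_def)
  qed
  then show ?thesis by (simp add: b_def)
qed

text \<open>The kernel component of \<open>letter_br x\<close>; it is unique by \<open>ker_ideal_trivial\<close>.\<close>

definition gen :: "nat \<Rightarrow> nat \<times> nat set \<Rightarrow> nat list \<Rightarrow> ratfun" where
  "gen m x = (SOME h. h \<in> ker_sigma m (Suc (card (snd x))) \<and>
     letter_br x - h \<in> bracket_ideal m (Suc (card (snd x))))"

lemma gen_props:
  assumes "x \<in> letter_pairs m n"
  shows "gen m x \<in> ker_sigma m (Suc (card (snd x)))"
    "letter_br x - gen m x \<in> bracket_ideal m (Suc (card (snd x)))"
proof -
  have "\<exists>h. h \<in> ker_sigma m (Suc (card (snd x))) \<and> letter_br x - h \<in> bracket_ideal m (Suc (card (snd x)))"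
    using ker_plus_ideal[OF letter_br_tens[OF assms]] by blast
  from someI_ex[OF this]
  show "gen m x \<in> ker_sigma m (Suc (card (snd x)))"
    "letter_br x - gen m x \<in> bracket_ideal m (Suc (card (snd x)))"
    unfolding gen_def by blast+
qed

lemma letter_pairs_card: "x \<in> letter_pairs m n \<Longrightarrow> Suc (card (snd x)) + (n - card (snd x)) = Suc n"
  by (auto simp: letter_pairs_def subsets_le_def)

lemma gen_difference_ideal:
  assumes "\<And>x. x \<in> gen_pairs m n \<Longrightarrow> c x \<in> ker_sigma m (n - card (snd x))"
  shows "(\<Sum>x\<in>gen_pairs m n. conc (letter_br x - gen m x) (c x)) \<in> bracket_ideal m (Suc n)"
proof (rule bracket_ideal_sum)
  fix x assume x: "x \<in> gen_pairs m n"
  show "conc (letter_br x - gen m x) (c x) \<in> bracket_ideal m (Suc n)"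
    using bracket_ideal_conc[OF gen_props(2)[OF gen_pairs_letter[OF x]] assms[OF x]]
      letter_pairs_card[OF gen_pairs_letter[OF x]] by simp
qed

text \<open>An element w of I with the same low coefficients as b is subtracted, so that b - w
  involves only the pairs that are not low. Replacing each v_i [A] there by its kernel component
  changes the sum by an element of I. The resulting h thus differs from b by an element of I that is
  also in the kernel, hence by 0.\<close>

theorem gen_expand:
  assumes b: "b \<in> ker_sigma m (Suc n)"
  shows "\<exists>c. (\<forall>x\<in>gen_pairs m n. c x \<in> ker_sigma m (n - card (snd x))) \<and>
    b = (\<Sum>x\<in>gen_pairs m n. conc (gen m x) (c x))"
proof -
  obtain \<beta> where \<beta>: "\<And>x. x \<in> letter_pairs m n \<Longrightarrow> \<beta> x \<in> ker_sigma m (n - card (snd x))"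
    and b\<beta>: "b = (\<Sum>x\<in>letter_pairs m n. conc (letter_br x) (\<beta> x))"
    using letter_br_expand[OF ker_sigmaD[OF b]] by metis
  define L where "L = {x \<in> letter_pairs m n. low x}"
  have L: "x \<in> letter_pairs m n" "low x" "finite (snd x)" if "x \<in> L" for x
    using that by (auto simp: L_def letter_pairs_finite)
  have inj: "inj_on ins L"
    by (rule inj_onI) (rule ins_inject[OF L(2) L(2) L(3) L(3)])
  \<comment> \<open>The bracket [B] is given the coefficient that b has at the leading pair of
    B.\<close>
  define d where "d B = \<beta> (the_inv_into L ins B)" for B
  have d_ins: "d (ins x) = \<beta> x" if "x \<in> L" for x
    unfolding d_def using the_inv_into_f_f[OF inj that] by simp
  have LB: "B \<in> nonempty_le m (Suc n)" if "B \<in> ins ` L" for B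
    using that ins_nonempty_le(1)[OF L(1,2)] by auto
  have dB: "d B \<in> ker_sigma m (Suc n - card B)" if "B \<in> ins ` L" for B
  proof -
    obtain x where x: "x \<in> L" "B = ins x" using \<open>B \<in> ins ` L\<close> by blast
    then show ?thesis using \<beta>[OF L(1)[OF x(1)]] ins_nonempty_le(2)[OF L(1,2)[OF x(1)]]
      by (simp add: d_ins)
  qed
  define w where "w = (\<Sum>B\<in>ins ` L. conc (br B) (d B))"
  define \<gamma> where "\<gamma> x = (\<Sum>B\<in>ins ` L. pointwise (*) (br B (fst x # sl (snd x))) (d B))" for x
  have w_ideal: "w \<in> bracket_ideal m (Suc n)"
    unfolding w_def by (intro bracket_ideal_sum bracket_ideal_br LB dB)
  have w: "w = (\<Sum>x\<in>letter_pairs m n. conc (letter_br x) (\<gamma> x))"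
    unfolding w_def \<gamma>_def by (rule bracket_ideal_sum_letters[OF LB])
  have \<gamma>: "\<gamma> x \<in> ker_sigma m (n - card (snd x))" if "x \<in> letter_pairs m n" for x
    unfolding \<gamma>_def by (rule bracket_ideal_coeff[OF that LB dB])
  have finL: "finite L" by (simp add: L_def)
  \<comment> \<open>By \<open>br_low\<close> a low pair receives a contribution from its own bracket
    only, so w and b agree there.\<close>
  have \<gamma>_low: "\<gamma> x = \<beta> x" if x: "x \<in> L" for x
  proof -
    have "\<gamma> x = (\<Sum>B\<in>ins ` L. if B = ins x then d B else 0)"
      unfolding \<gamma>_def
    proof (rule sum.cong[OF refl])
      fix B assume "B \<in> ins ` L"
      then have "finite B" using LB[of B] subsets_le_finite by (auto simp: nonempty_le_def)
      then show "pointwise (*) (br B (fst x # sl (snd x))) (d B) = (if B = ins x then d B else 0)"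
        using br_low[OF L(1,2)[OF x]] by simp
    qed
    then show ?thesis using x finL by (simp add: d_ins)
  qed
  define c where "c x = \<beta> x - \<gamma> x" for x
  have c: "c x \<in> ker_sigma m (n - card (snd x))" if "x \<in> gen_pairs m n" for x
    unfolding c_def using \<beta> \<gamma> gen_pairs_letter[OF that] by (simp add: ker_sigma_diff)
  have "b - w = (\<Sum>x\<in>letter_pairs m n. conc (letter_br x) (c x))"
    unfolding b\<beta> w c_def by (simp only: conc_diff_right sum_subtractf)
  also have "\<dots> = (\<Sum>x\<in>gen_pairs m n. conc (letter_br x) (c x))"
    by (rule sum.mono_neutral_right) (auto simp: gen_pairs_def c_def \<gamma>_low L_def)
  finally have bw: "b - w = (\<Sum>x\<in>gen_pairs m n. conc (letter_br x) (c x))" .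
  define h where "h = (\<Sum>x\<in>gen_pairs m n. conc (gen m x) (c x))"
  have "conc (gen m x) (c x) \<in> ker_sigma m (Suc n)" if "x \<in> gen_pairs m n" for x
    using conc_ker_sigma[OF gen_props(1)[OF gen_pairs_letter[OF that]] c[OF that]]
      letter_pairs_card[OF gen_pairs_letter[OF that]] by simp
  then have h: "h \<in> ker_sigma m (Suc n)" unfolding h_def by (rule ker_sigma_sum)
  have "b - h = w + (\<Sum>x\<in>gen_pairs m n. conc (letter_br x - gen m x) (c x))"
    using bw unfolding h_def by (simp add: conc_diff_left sum_subtractf algebra_simps)
  then have "b - h \<in> bracket_ideal m (Suc n)"
    using bracket_ideal_add[OF w_ideal gen_difference_ideal[OF c]] by simp
  moreover have "b - h \<in> ker_sigma m (Suc n)" by (rule ker_sigma_diff[OF b h])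
  ultimately have "b - h = 0" by (intro ker_ideal_trivial)
  then have "b = h" by simp
  then show ?thesis using c unfolding h_def by blast
qed

text \<open>With v_i [A] in place of the generators, the vanishing sum becomes an element of I, that
  is, a sum of [B] d_B. Comparing coefficients at low pairs, where the left side has none, gives d_B
  = 0 for every B; then the remaining coefficients vanish too.\<close>

theorem gen_independent:
  assumes c: "\<And>x. x \<in> gen_pairs m n \<Longrightarrow> c x \<in> ker_sigma m (n - card (snd x))"
    and sum: "(\<Sum>x\<in>gen_pairs m n. conc (gen m x) (c x)) = 0" and x: "x \<in> gen_pairs m n"
  shows "c x = 0"
proof -
  have "(\<Sum>x\<in>gen_pairs m n. conc (letter_br x) (c x))
      = (\<Sum>x\<in>gen_pairs m n. conc (letter_br x - gen m x) (c x))"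
    using sum by (simp add: conc_diff_left sum_subtractf)
  also have "\<dots> \<in> bracket_ideal m (Suc n)" by (rule gen_difference_ideal[OF c])
  finally obtain d where d: "\<forall>B\<in>nonempty_le m (Suc n). d B \<in> ker_sigma m (Suc n - card B)"
    and eq: "(\<Sum>x\<in>gen_pairs m n. conc (letter_br x) (c x)) = (\<Sum>B\<in>nonempty_le m (Suc n). conc (br B) (d B))"
    unfolding bracket_ideal_def by blast
  define \<delta> where "\<delta> x = (\<Sum>B\<in>nonempty_le m (Suc n). pointwise (*) (br B (fst x # sl (snd x))) (d B))" for x
  \<comment> \<open>Extended by 0 to the low pairs, so that both expansions run over all pairs and
    can be compared term by term.\<close>
  define c' where "c' x = (if x \<in> gen_pairs m n then c x else 0)" for x
  have "(\<Sum>x\<in>letter_pairs m n. conc (letter_br x) (c' x)) = (\<Sum>x\<in>gen_pairs m n. conc (letter_br x) (c' x))"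
    by (rule sum.mono_neutral_right) (auto simp: gen_pairs_def c'_def)
  also have "\<dots> = (\<Sum>x\<in>gen_pairs m n. conc (letter_br x) (c x))" by (simp add: c'_def)
  also have "\<dots> = (\<Sum>x\<in>letter_pairs m n. conc (letter_br x) (\<delta> x))"
    unfolding eq \<delta>_def by (rule bracket_ideal_sum_letters)
  finally have zero: "(\<Sum>x\<in>letter_pairs m n. conc (letter_br x) (c' x - \<delta> x)) = 0"
    by (simp only: conc_diff_right sum_subtractf) simp
  have \<delta>: "\<delta> x \<in> ker_sigma m (n - card (snd x))" if "x \<in> letter_pairs m n" for x
    unfolding \<delta>_def by (rule bracket_ideal_coeff[OF that]) (use d in auto)
  have c': "c' x \<in> ker_sigma m (n - card (snd x))" if "x \<in> letter_pairs m n" for x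
    using c by (simp add: c'_def ker_sigma_zero)
  have c\<delta>: "c' x = \<delta> x" if "x \<in> letter_pairs m n" for x
    using letter_br_independent[of m n "\<lambda>x. c' x - \<delta> x", OF _ zero that] c' \<delta> by (simp add: ker_sigma_diff)
  have "d B = 0" if B: "B \<in> nonempty_le m (Suc n)" for B
  proof -
    \<comment> \<open>At the leading pair of B the right side contributes exactly d_B.\<close>
    obtain y where y: "y \<in> letter_pairs m n" "low y" "ins y = B" using nonempty_le_ins[OF B] by blast
    have "\<delta> y = (\<Sum>B'\<in>nonempty_le m (Suc n). if B' = B then d B' else 0)"
      unfolding \<delta>_def
    proof (rule sum.cong[OF refl])
      fix B' assume "B' \<in> nonempty_le m (Suc n)"
      then have "finite B'" using subsets_le_finite by (auto simp: nonempty_le_def)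
      then show "pointwise (*) (br B' (fst y # sl (snd y))) (d B') = (if B' = B then d B' else 0)"
        using br_low[OF y(1,2)] y(3) by simp
    qed
    also have "\<dots> = d B" using B by simp
    finally have "d B = c' y" using c\<delta>[OF y(1)] by simp
    then show ?thesis using y by (simp add: c'_def gen_pairs_def)
  qed
  then have "\<delta> x = 0" by (simp add: \<delta>_def)
  then show ?thesis using c\<delta>[OF gen_pairs_letter[OF x]] x by (simp add: c'_def)
qed


section \<open>Freeness\<close>

abbreviation word_prod :: "('x \<Rightarrow> 'i list \<Rightarrow> ratfun) \<Rightarrow> 'x list \<Rightarrow> 'i list \<Rightarrow> ratfun" where
  "word_prod g w \<equiv> foldr conc (map g w) (pure 1 [])"

abbreviation component :: "nat \<Rightarrow> (nat list \<Rightarrow> ratfun) \<Rightarrow> nat list \<Rightarrow> ratfun" where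
  "component n f \<equiv> (\<lambda>w. if length w = n then f w else 0)"

lemma eval_hom_sum:
  assumes "finite W" "\<And>w. w \<notin> W \<Longrightarrow> p w = 0"
  shows "eval_hom g p = (\<Sum>w\<in>W. pointwise (*) (p w) (word_prod g w))"
proof
  fix u
  have "lin_ext (word_prod g) p u = (\<Sum>w\<in>W. p w * word_prod g w u)"
    by (rule lin_ext_superset) (fact assms)+
  then show "eval_hom g p u = (\<Sum>w\<in>W. pointwise (*) (p w) (word_prod g w)) u"
    by (simp only: eval_hom_def sum_fun_apply pointwise_def)
qed

lemma free_algD: "p \<in> free_alg X \<Longrightarrow> finite {w. p w \<noteq> 0}" "p \<in> free_alg X \<Longrightarrow> p w \<noteq> 0 \<Longrightarrow> set w \<subseteq> X"
  by (simp_all add: free_alg_def)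

lemma free_alg_subset:
  assumes "p \<in> free_alg X" "\<And>w. q w \<noteq> 0 \<Longrightarrow> p w \<noteq> 0"
  shows "q \<in> free_alg X"
proof -
  have "{w. q w \<noteq> 0} \<subseteq> {w. p w \<noteq> 0}" using assms(2) by blast
  then show ?thesis using assms finite_subset by (auto simp: free_alg_def)
qed

lemma free_alg_add:
  assumes "p \<in> free_alg X" "q \<in> free_alg X"
  shows "p + q \<in> free_alg X"
proof -
  have nz: "p w \<noteq> 0 \<or> q w \<noteq> 0" if "(p + q) w \<noteq> 0" for w using that by auto
  have "finite {w. (p + q) w \<noteq> 0}"
    by (rule finite_subset[of _ "{w. p w \<noteq> 0} \<union> {w. q w \<noteq> 0}"]) (use nz assms free_algD(1) in auto)
  then show ?thesis using nz assms free_algD(2) unfolding free_alg_def by blast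
qed

lemma free_alg_zero: "0 \<in> free_alg X"
  by (simp add: free_alg_def)

lemma free_alg_diff:
  assumes "p \<in> free_alg X" "q \<in> free_alg X"
  shows "p - q \<in> free_alg X"
proof -
  have nz: "p w \<noteq> 0 \<or> q w \<noteq> 0" if "(p - q) w \<noteq> 0" for w using that by auto
  have "finite {w. (p - q) w \<noteq> 0}"
    by (rule finite_subset[of _ "{w. p w \<noteq> 0} \<union> {w. q w \<noteq> 0}"]) (use nz assms free_algD(1) in auto)
  then show ?thesis using nz assms free_algD(2) unfolding free_alg_def by blast
qed

lemma eval_hom_add:
  assumes "p \<in> free_alg X" "q \<in> free_alg X"
  shows "eval_hom g (p + q) = eval_hom g p + eval_hom g q"
proof -
  let ?W = "{w. p w \<noteq> 0} \<union> {w. q w \<noteq> 0}"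
  have fin: "finite ?W" using assms free_algD(1) by blast
  have "eval_hom g (p + q) = (\<Sum>w\<in>?W. pointwise (*) ((p + q) w) (word_prod g w))"
    by (rule eval_hom_sum[OF fin]) auto
  moreover have "eval_hom g p = (\<Sum>w\<in>?W. pointwise (*) (p w) (word_prod g w))"
    and "eval_hom g q = (\<Sum>w\<in>?W. pointwise (*) (q w) (word_prod g w))"
    by (rule eval_hom_sum[OF fin]; auto)+
  ultimately show ?thesis
    by (simp add: K.F.scale_left_distrib sum.distrib)
qed

lemma eval_hom_zero: "eval_hom g 0 = 0"
  using eval_hom_sum[of "{}" 0 g] by simp

lemma eval_hom_diff:
  assumes "p \<in> free_alg X" "q \<in> free_alg X"
  shows "eval_hom g (p - q) = eval_hom g p - eval_hom g q"
  using eval_hom_add[OF free_alg_diff[OF assms] assms(2), of g] by simp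

lemma eval_hom_sum_free:
  "(\<And>i. i \<in> I \<Longrightarrow> p i \<in> free_alg X) \<Longrightarrow>
    (\<Sum>i\<in>I. p i) \<in> free_alg X \<and> eval_hom g (\<Sum>i\<in>I. p i) = (\<Sum>i\<in>I. eval_hom g (p i))"
proof (induction I rule: infinite_finite_induct)
  case (insert i I)
  then have IH: "(\<Sum>i\<in>I. p i) \<in> free_alg X" "eval_hom g (\<Sum>i\<in>I. p i) = (\<Sum>i\<in>I. eval_hom g (p i))"
    and i: "p i \<in> free_alg X" by simp_all
  have "p i + (\<Sum>i\<in>I. p i) \<in> free_alg X" by (rule free_alg_add[OF i IH(1)])
  moreover have "eval_hom g (p i + (\<Sum>i\<in>I. p i)) = eval_hom g (p i) + (\<Sum>i\<in>I. eval_hom g (p i))"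
    by (simp only: eval_hom_add[OF i IH(1)] IH(2))
  ultimately show "(\<Sum>i\<in>insert i I. p i) \<in> free_alg X \<and>
      eval_hom g (\<Sum>i\<in>insert i I. p i) = (\<Sum>i\<in>insert i I. eval_hom g (p i))"
    by (simp only: sum.insert[OF insert.hyps(1,2)] simp_thms)
qed (simp_all only: sum.infinite sum.empty free_alg_zero eval_hom_zero not_False_eq_True simp_thms)

lemma free_alg_tail: "p \<in> free_alg X \<Longrightarrow> (\<lambda>v. p (x # v)) \<in> free_alg X"
proof -
  assume p: "p \<in> free_alg X"
  have "{v. p (x # v) \<noteq> 0} \<subseteq> tl ` {w. p w \<noteq> 0}" by force
  then have "finite {v. p (x # v) \<noteq> 0}" using free_algD(1)[OF p] finite_surj by blast
  then show ?thesis using free_algD(2)[OF p, of "x # _"] by (auto simp: free_alg_def)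
qed

text \<open>Splitting off the first generator gives evaluation the shape of the expansions of kernel
  elements into sums of g_x c_x; injectivity and surjectivity both recurse along it.\<close>

lemma eval_hom_Cons:
  assumes "finite X" "p \<in> free_alg X"
  shows "eval_hom g p = pointwise (*) (p []) (pure 1 []) + (\<Sum>x\<in>X. conc (g x) (eval_hom g (\<lambda>v. p (x # v))))"
proof -
  \<comment> \<open>One finite set of tails that serves all first letters; the tail of the empty
    word does no harm.\<close>
  define V where "V = tl ` {w. p w \<noteq> 0}"
  have V: "finite V" using free_algD(1)[OF assms(2)] by (simp add: V_def)
  have tail: "p (x # v) = 0" if "v \<notin> V" for x v
    using that unfolding V_def by force
  let ?C = "(\<lambda>(x, v). x # v) ` (X \<times> V)"
  have zero: "p w = 0" if "w \<notin> insert [] ?C" for w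
  proof (rule ccontr)
    assume nz: "p w \<noteq> 0"
    have "w \<noteq> []" using that by blast
    then obtain x v where w: "w = x # v" by (cases w) auto
    then have "x \<in> X" using free_algD(2)[OF assms(2) nz] by simp
    moreover have "v \<in> V" using nz w tail by blast
    ultimately show False using that w by force
  qed
  have "eval_hom g p = (\<Sum>w\<in>insert [] ?C. pointwise (*) (p w) (word_prod g w))"
    by (rule eval_hom_sum) (use assms(1) V zero in auto)
  also have "\<dots> = pointwise (*) (p []) (pure 1 []) + (\<Sum>w\<in>?C. pointwise (*) (p w) (word_prod g w))"
    by (subst sum.insert) (use assms(1) V in auto)
  also have "(\<Sum>w\<in>?C. pointwise (*) (p w) (word_prod g w))
      = (\<Sum>(x, v)\<in>X \<times> V. pointwise (*) (p (x # v)) (conc (g x) (word_prod g v)))"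
    by (subst sum.reindex) (auto simp: inj_on_def case_prod_beta)
  also have "\<dots> = (\<Sum>x\<in>X. \<Sum>v\<in>V. pointwise (*) (p (x # v)) (conc (g x) (word_prod g v)))"
    by (rule sum.cartesian_product[symmetric])
  also have "\<dots> = (\<Sum>x\<in>X. conc (g x) (\<Sum>v\<in>V. pointwise (*) (p (x # v)) (word_prod g v)))"
    by (simp only: conc_sum_right conc_scale_right)
  also have "\<dots> = (\<Sum>x\<in>X. conc (g x) (eval_hom g (\<lambda>v. p (x # v))))"
    by (intro sum.cong refl arg_cong[where f = "conc _"] eval_hom_sum[symmetric] V) (rule tail)
  finally show ?thesis .
qed

section \<open>The algebra B(V) and its homogeneous components\<close>

lemma component_tens: "f \<in> tens m n \<Longrightarrow> component k f = (if k = n then f else 0)"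
  by (auto simp: fun_eq_iff tens_length)

lemma B_alg_components:
  assumes "f \<in> B_alg m"
  obtains N where "f = (\<Sum>n\<le>N. component n f)"
proof -
  have fin: "finite {w. f w \<noteq> 0}" using assms by (simp add: B_alg_def)
  then obtain N where N: "\<forall>k\<in>length ` {w. f w \<noteq> 0}. k \<le> N"
    using finite_nat_set_iff_bounded_le by blast
  have "f u = (\<Sum>n\<le>N. component n f) u" for u
  proof (cases "f u = 0")
    case True
    then show ?thesis by (simp add: sum_fun_apply)
  next
    case False
    then have "length u \<le> N" using N by blast
    then show ?thesis by (simp add: sum_fun_apply sum.delta')
  qed
  then show ?thesis using that by blast
qed

lemma B_alg_component: "f \<in> B_alg m \<Longrightarrow> component n f \<in> ker_sigma m n"
  by (simp add: B_alg_def)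

lemma ker_sigma_0: "f \<in> ker_sigma m 0 \<longleftrightarrow> f = pointwise (*) (f []) (pure 1 [])"
proof
  assume f: "f \<in> ker_sigma m 0"
  show "f = pointwise (*) (f []) (pure 1 [])"
  proof
    show "f u = pointwise (*) (f []) (pure 1 []) u" for u
      using tens_length[OF ker_sigmaD[OF f], of u] by (auto simp: pointwise_def pure_def)
  qed
next
  assume "f = pointwise (*) (f []) (pure 1 [])"
  moreover have "pure 1 [] \<in> ker_sigma m 0"
    unfolding ker_sigma_eq by (simp add: pure_tens words_def)
  ultimately show "f \<in> ker_sigma m 0" using ker_sigma_scale by metis
qed

lemma ker_sigma_B_alg:
  assumes "f \<in> ker_sigma m n"
  shows "f \<in> B_alg m"
  unfolding B_alg_def
  using finite_support[OF ker_sigmaD[OF assms]] component_tens[OF ker_sigmaD[OF assms]] assms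
  by (simp add: ker_sigma_zero del: fun_eq_iff)

lemma B_alg_add: "f \<in> B_alg m \<Longrightarrow> g \<in> B_alg m \<Longrightarrow> f + g \<in> B_alg m"
proof -
  assume f: "f \<in> B_alg m" and g: "g \<in> B_alg m"
  have "finite {w. (f + g) w \<noteq> 0}"
    by (rule finite_subset[of _ "{w. f w \<noteq> 0} \<union> {w. g w \<noteq> 0}"])
      (use f g in \<open>auto simp: B_alg_def\<close>)
  moreover have "component n (f + g) = component n f + component n g" for n by auto
  ultimately show ?thesis
    using B_alg_component[OF f] B_alg_component[OF g] by (simp only: B_alg_def mem_Collect_eq ker_sigma_add simp_thms)
qed

lemma B_alg_scale: "f \<in> B_alg m \<Longrightarrow> pointwise (*) c f \<in> B_alg m"
proof -
  assume f: "f \<in> B_alg m"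
  have "finite {w. pointwise (*) c f w \<noteq> 0}"
    by (rule finite_subset[of _ "{w. f w \<noteq> 0}"]) (use f in \<open>auto simp: B_alg_def pointwise_def\<close>)
  moreover have "component n (pointwise (*) c f) = pointwise (*) c (component n f)" for n
    by (auto simp: pointwise_def)
  ultimately show ?thesis
    using B_alg_component[OF f] by (simp only: B_alg_def mem_Collect_eq ker_sigma_scale simp_thms)
qed

lemma B_alg_zero: "0 \<in> B_alg m"
  using ker_sigma_B_alg[OF ker_sigma_zero[of m 0]] .

lemma B_alg_sum: "(\<And>i. i \<in> I \<Longrightarrow> f i \<in> B_alg m) \<Longrightarrow> (\<Sum>i\<in>I. f i) \<in> B_alg m"
  by (induction I rule: infinite_finite_induct) (auto intro: B_alg_add B_alg_zero)

lemma B_alg_conc: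
  assumes "f \<in> B_alg m" "g \<in> B_alg m"
  shows "conc f g \<in> B_alg m"
proof -
  obtain N where N: "f = (\<Sum>n\<le>N. component n f)" by (rule B_alg_components[OF assms(1)])
  obtain N' where N': "g = (\<Sum>n\<le>N'. component n g)" by (rule B_alg_components[OF assms(2)])
  have "conc f g = conc (\<Sum>n\<le>N. component n f) (\<Sum>n\<le>N'. component n g)"
    using N N' by simp
  also have "\<dots> = (\<Sum>n\<le>N. \<Sum>n'\<le>N'. conc (component n f) (component n' g))"
    by (simp only: conc_sum_left conc_sum_right) (rule sum.swap)
  also have "\<dots> \<in> B_alg m"
  proof (intro B_alg_sum)
    fix k l
    show "conc (component k f) (component l g) \<in> B_alg m"
      by (rule ker_sigma_B_alg[OF conc_ker_sigma[OF B_alg_component[OF assms(1)] B_alg_component[OF assms(2)]]])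
  qed
  finally show ?thesis .
qed

lemma subalgebra_B_alg: "subalgebra_conc (B_alg m)"
proof -
  have "pure 1 [] \<in> ker_sigma m 0" unfolding ker_sigma_0 by (simp add: pointwise_def pure_def fun_eq_iff)
  then have "pure 1 [] \<in> B_alg m" by (rule ker_sigma_B_alg)
  then show ?thesis
    unfolding subalgebra_conc_def K.F.subspace_def
    by (auto intro: B_alg_add B_alg_scale B_alg_zero B_alg_conc)
qed

text \<open>The last two assumptions say that the part of B(V) of positive degree is a free right
  module over B(V) on the g_x. Freeness as an algebra follows by induction on the degree, which
  drops at each step because \<open>deg x\<close> is positive.\<close>

locale kernel_generators =
  fixes m :: nat and X :: "'x set" and deg :: "'x \<Rightarrow> nat" and g :: "'x \<Rightarrow> nat list \<Rightarrow> ratfun"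
  assumes finite_X: "finite X" and deg_pos: "\<And>x. x \<in> X \<Longrightarrow> 0 < deg x"
    and g_ker: "\<And>x. x \<in> X \<Longrightarrow> g x \<in> ker_sigma m (deg x)"
    and expand: "\<And>n b. b \<in> ker_sigma m (Suc n) \<Longrightarrow>
      \<exists>c. (\<forall>x\<in>{x \<in> X. deg x \<le> Suc n}. c x \<in> ker_sigma m (Suc n - deg x)) \<and>
        b = (\<Sum>x\<in>{x \<in> X. deg x \<le> Suc n}. conc (g x) (c x))"
    and independent: "\<And>n c x. (\<And>x. x \<in> {x \<in> X. deg x \<le> Suc n} \<Longrightarrow> c x \<in> ker_sigma m (Suc n - deg x)) \<Longrightarrow>
      (\<Sum>x\<in>{x \<in> X. deg x \<le> Suc n}. conc (g x) (c x)) = 0 \<Longrightarrow> x \<in> {x \<in> X. deg x \<le> Suc n} \<Longrightarrow> c x = 0"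
begin

abbreviation "ev \<equiv> eval_hom g"

definition wdeg :: "'x list \<Rightarrow> nat" where
  "wdeg w = sum_list (map deg w)"

lemma word_prod_ker: "set w \<subseteq> X \<Longrightarrow> word_prod g w \<in> ker_sigma m (wdeg w)"
proof (induction w)
  case Nil
  show ?case by (simp add: ker_sigma_0 wdeg_def) (simp add: pointwise_def pure_def fun_eq_iff)
next
  case (Cons x w)
  then show ?case using conc_ker_sigma[OF g_ker[of x], of "word_prod g w" "wdeg w"] by (simp add: wdeg_def)
qed

lemma ev_homogeneous:
  assumes "p \<in> free_alg X" "\<And>w. p w \<noteq> 0 \<Longrightarrow> wdeg w = n"
  shows "ev p \<in> ker_sigma m n"
proof -
  have "ev p = (\<Sum>w\<in>{w. p w \<noteq> 0}. pointwise (*) (p w) (word_prod g w))"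
    by (rule eval_hom_sum[OF free_algD(1)[OF assms(1)]]) simp
  also have "\<dots> \<in> ker_sigma m n"
  proof (rule ker_sigma_sum)
    fix w assume "w \<in> {w. p w \<noteq> 0}"
    then have "set w \<subseteq> X" "wdeg w = n" using free_algD(2)[OF assms(1)] assms(2) by auto
    then show "pointwise (*) (p w) (word_prod g w) \<in> ker_sigma m n"
      using word_prod_ker ker_sigma_scale by blast
  qed
  finally show ?thesis .
qed

lemma ev_B_alg:
  assumes "p \<in> free_alg X"
  shows "ev p \<in> B_alg m"
proof -
  have "ev p = (\<Sum>w\<in>{w. p w \<noteq> 0}. pointwise (*) (p w) (word_prod g w))"
    by (rule eval_hom_sum[OF free_algD(1)[OF assms]]) simp
  also have "\<dots> \<in> B_alg m"
  proof (rule B_alg_sum)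
    fix w assume "w \<in> {w. p w \<noteq> 0}"
    then have "set w \<subseteq> X" using free_algD(2)[OF assms] by blast
    then show "pointwise (*) (p w) (word_prod g w) \<in> B_alg m"
      by (intro B_alg_scale ker_sigma_B_alg[OF word_prod_ker])
  qed
  finally show ?thesis .
qed

text \<open>A product of generators is homogeneous of degree \<open>wdeg\<close>, so evaluation
  respects the grading and can be studied degree by degree.\<close>

lemma ev_component:
  assumes "p \<in> free_alg X"
  shows "ev (\<lambda>w. if wdeg w = n then p w else 0) = component n (ev p)"
proof
  fix u
  let ?W = "{w. p w \<noteq> 0}"
  have fin: "finite ?W" by (rule free_algD(1)[OF assms])
  have "ev (\<lambda>w. if wdeg w = n then p w else 0) u
      = (\<Sum>w\<in>?W. (if wdeg w = n then p w else 0) * word_prod g w u)"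
    using eval_hom_sum[OF fin, of "\<lambda>w. if wdeg w = n then p w else 0" g]
    by (simp add: sum_fun_apply pointwise_def)
  also have "\<dots> = (\<Sum>w\<in>?W. if length u = n then p w * word_prod g w u else 0)"
  proof (rule sum.cong[OF refl])
    fix w assume "w \<in> ?W"
    then have "word_prod g w \<in> tens m (wdeg w)"
      using word_prod_ker ker_sigmaD free_algD(2)[OF assms, of w] by blast
    then have "wdeg w \<noteq> length u \<Longrightarrow> word_prod g w u = 0" using tens_length by metis
    then show "(if wdeg w = n then p w else 0) * word_prod g w u
        = (if length u = n then p w * word_prod g w u else 0)" by auto
  qed
  also have "\<dots> = component n (ev p) u"
    using eval_hom_sum[OF fin, of p g] by (simp add: sum_fun_apply pointwise_def)
  finally show "ev (\<lambda>w. if wdeg w = n then p w else 0) u = component n (ev p) u" .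
qed

lemma wdeg_Cons: "wdeg (x # w) = deg x + wdeg w"
  by (simp add: wdeg_def)

text \<open>Grouping words by their first letter x writes 0 as a sum of g_x times evaluations of
  tails. By uniqueness of such expansions each tail evaluates to 0, and the tails have smaller
  degree.\<close>

lemma ev_injective_homogeneous:
  "p \<in> free_alg X \<Longrightarrow> (\<And>w. p w \<noteq> 0 \<Longrightarrow> wdeg w = n) \<Longrightarrow> ev p = 0 \<Longrightarrow> p = 0"
proof (induction n arbitrary: p rule: less_induct)
  case (less n)
  note p = less.prems(1)
  have hom: "wdeg w = n" if "p w \<noteq> 0" for w using less.prems(2) that .
  have ev0: "ev p = 0" by (rule less.prems(3))
  have cons: "ev p = pointwise (*) (p []) (pure 1 []) + (\<Sum>x\<in>X. conc (g x) (ev (\<lambda>v. p (x # v))))"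
    by (rule eval_hom_Cons[OF finite_X p])
  have p_eq_0: "p = 0" if "p [] = 0" "\<And>x v. x \<in> X \<Longrightarrow> p (x # v) = 0"
  proof
    show "p w = 0 w" for w
      using that free_algD(2)[OF p, of w] by (cases w) auto
  qed
  show "p = 0"
  proof (cases n)
    \<comment> \<open>Generators have positive degree, so the empty word is the only word of degree
      0.\<close>
    case 0
    have tail: "p (x # v) = 0" if "x \<in> X" for x v
      using hom[of "x # v"] 0 deg_pos[OF that] by (auto simp: wdeg_Cons)
    have ev_tail: "ev (\<lambda>v. p (x # v)) = 0" if "x \<in> X" for x
      using eval_hom_sum[of "{}" "\<lambda>v. p (x # v)" g] tail[OF that] by simp
    have "(\<Sum>x\<in>X. conc (g x) (ev (\<lambda>v. p (x # v)))) = 0"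
      by (rule sum.neutral) (simp add: ev_tail)
    then have "ev p = pointwise (*) (p []) (pure 1 [])" using cons by (simp only: add_0_right)
    from fun_cong[OF trans[OF sym[OF this] ev0], of "[]"] have "p [] = 0"
      by (simp add: pointwise_def pure_def)
    then show ?thesis using tail by (rule p_eq_0)
  next
    case (Suc n')
    have nil: "p [] = 0" using hom[of "[]"] Suc by (auto simp: wdeg_def)
    have tail_free: "(\<lambda>v. p (x # v)) \<in> free_alg X" for x by (rule free_alg_tail[OF p])
    have tail_hom: "deg x \<le> n \<and> wdeg v = n - deg x" if "p (x # v) \<noteq> 0" for x v
      using hom[OF that] by (simp add: wdeg_Cons)
    \<comment> \<open>A generator of degree above n begins no word of degree n.\<close>
    have big: "ev (\<lambda>v. p (x # v)) = 0" if "\<not> deg x \<le> n" for x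
    proof -
      have "(\<lambda>v. p (x # v)) = 0" using tail_hom that by (intro ext) (metis zero_fun_apply)
      then show ?thesis by (simp only: eval_hom_zero)
    qed
    have ker: "ev (\<lambda>v. p (x # v)) \<in> ker_sigma m (n - deg x)" for x
      by (rule ev_homogeneous[OF tail_free]) (use tail_hom in blast)
    have "(\<Sum>x\<in>{x \<in> X. deg x \<le> Suc n'}. conc (g x) (ev (\<lambda>v. p (x # v))))
        = (\<Sum>x\<in>X. conc (g x) (ev (\<lambda>v. p (x # v))))"
    proof (rule sum.mono_neutral_left)
      show "\<forall>x\<in>X - {x \<in> X. deg x \<le> Suc n'}. conc (g x) (ev (\<lambda>v. p (x # v))) = 0"
      proof
        fix x assume "x \<in> X - {x \<in> X. deg x \<le> Suc n'}"
        then have "\<not> deg x \<le> n" using Suc by simp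
        from big[OF this] show "conc (g x) (ev (\<lambda>v. p (x # v))) = 0" by (simp only: conc_zero_right)
      qed
    qed (use finite_X in auto)
    also have "\<dots> = ev p" by (rule trans[OF _ cons[symmetric]]) (simp only: nil K.F.scale_zero_left add_0_left)
    also have "\<dots> = 0" by (rule ev0)
    finally have sum0: "(\<Sum>x\<in>{x \<in> X. deg x \<le> Suc n'}. conc (g x) (ev (\<lambda>v. p (x # v)))) = 0" .
    have "p (x # v) = 0" if x: "x \<in> X" for x v
    proof (cases "deg x \<le> n")
      case True
      have ev_tail: "ev (\<lambda>v. p (x # v)) = 0"
      proof (rule independent[OF _ sum0])
        show "ev (\<lambda>v. p (x # v)) \<in> ker_sigma m (Suc n' - deg x)" for x using ker[of x] Suc by simp
        show "x \<in> {x \<in> X. deg x \<le> Suc n'}" using x True Suc by simp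
      qed
      have lt: "n - deg x < n" using deg_pos[OF x] Suc by simp
      have "(\<lambda>v. p (x # v)) = 0"
        by (rule less.IH[OF lt tail_free _ ev_tail]) (use tail_hom in blast)
      from fun_cong[OF this, of v] show ?thesis by simp
    next
      case False
      then show ?thesis using tail_hom by blast
    qed
    then show ?thesis using nil by (intro p_eq_0)
  qed
qed

lemma ev_kernel:
  assumes "p \<in> free_alg X" "ev p = 0"
  shows "p = 0"
proof
  fix w
  let ?q = "\<lambda>v. if wdeg v = wdeg w then p v else 0"
  have "?q \<in> free_alg X" by (rule free_alg_subset[OF assms(1)]) (auto split: if_splits)
  moreover have "ev ?q = 0" by (simp only: ev_component[OF assms(1)] assms(2) zero_fun_def if_cancel)
  moreover have "wdeg v = wdeg w" if "?q v \<noteq> 0" for v using that by (auto split: if_splits)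
  ultimately have "?q = 0" by (intro ev_injective_homogeneous)
  from fun_cong[OF this, of w] show "p w = 0 w" by simp
qed

lemma ev_surj_homogeneous:
  "b \<in> ker_sigma m n \<Longrightarrow> \<exists>p\<in>free_alg X. ev p = b"
proof (induction n arbitrary: b rule: less_induct)
  case (less n)
  show ?case
  proof (cases n)
    case 0
    have p: "pure (b []) [] \<in> free_alg X" by (auto simp: free_alg_def pure_def)
    have "ev (pure (b []) []) = (\<Sum>w\<in>{[]}. pointwise (*) (pure (b []) [] w) (word_prod g w))"
      by (rule eval_hom_sum) (auto simp: pure_def)
    also have "\<dots> = pointwise (*) (b []) (pure 1 [])" by (simp add: pure_def)
    also have "\<dots> = b"
      by (rule sym, rule iffD1[OF ker_sigma_0[of b m]]) (use less.prems 0 in simp)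
    finally show ?thesis using p by blast
  next
    case (Suc n')
    define Y where "Y = {x \<in> X. deg x \<le> Suc n'}"
    have Y: "Y \<subseteq> X" "finite Y" using finite_X by (auto simp: Y_def)
    obtain c where c: "\<forall>x\<in>Y. c x \<in> ker_sigma m (Suc n' - deg x)"
      and b: "b = (\<Sum>x\<in>Y. conc (g x) (c x))"
      using expand[of b n'] less.prems unfolding Suc Y_def by blast
    have "\<exists>p\<in>free_alg X. ev p = c x" if x: "x \<in> Y" for x
    proof (rule less.IH)
      show "n - deg x < n" using deg_pos[of x] x Y(1) Suc by auto
      show "c x \<in> ker_sigma m (n - deg x)" using c x Suc by auto
    qed
    then obtain q where q: "\<And>x. x \<in> Y \<Longrightarrow> q x \<in> free_alg X" "\<And>x. x \<in> Y \<Longrightarrow> ev (q x) = c x"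
      by metis
    \<comment> \<open>Prefixing the preimage of each coefficient c_x by x inverts the recursion of
      \<open>eval_hom_Cons\<close>.\<close>
    define p where "p w = (case w of [] \<Rightarrow> 0 | x # v \<Rightarrow> if x \<in> Y then q x v else 0)" for w
    have p_Cons: "(\<lambda>v. p (x # v)) = (if x \<in> Y then q x else 0)" for x
      by (auto simp: p_def fun_eq_iff)
    have p: "p \<in> free_alg X"
    proof -
      have sub: "{w. p w \<noteq> 0} \<subseteq> (\<Union>x\<in>Y. (#) x ` {v. q x v \<noteq> 0})"
      proof
        fix w assume "w \<in> {w. p w \<noteq> 0}"
        then obtain x v where "w = x # v" "x \<in> Y" "q x v \<noteq> 0"
          unfolding p_def by (cases w) (auto split: if_splits)
        then show "w \<in> (\<Union>x\<in>Y. (#) x ` {v. q x v \<noteq> 0})" by blast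
      qed
      have "finite (\<Union>x\<in>Y. (#) x ` {v. q x v \<noteq> 0})"
        using Y(2) free_algD(1)[OF q(1)] by auto
      then have "finite {w. p w \<noteq> 0}" using sub finite_subset by blast
      moreover have "set w \<subseteq> X" if "p w \<noteq> 0" for w
        using that Y(1) free_algD(2)[OF q(1)]
        by (cases w) (auto simp: p_def split: if_splits)
      ultimately show ?thesis by (simp add: free_alg_def)
    qed
    have "ev p = (\<Sum>x\<in>X. conc (g x) (ev (\<lambda>v. p (x # v))))"
    proof (rule trans[OF eval_hom_Cons[OF finite_X p]])
      have "p [] = 0" by (simp add: p_def)
      then show "pointwise (*) (p []) (pure 1 []) + (\<Sum>x\<in>X. conc (g x) (ev (\<lambda>v. p (x # v))))
          = (\<Sum>x\<in>X. conc (g x) (ev (\<lambda>v. p (x # v))))"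
        by (simp only: K.F.scale_zero_left add_0_left)
    qed
    also have "\<dots> = (\<Sum>x\<in>Y. conc (g x) (ev (\<lambda>v. p (x # v))))"
    proof (rule sum.mono_neutral_right)
      show "\<forall>x\<in>X - Y. conc (g x) (ev (\<lambda>v. p (x # v))) = 0"
      proof
        fix x assume "x \<in> X - Y"
        then have "(\<lambda>v. p (x # v)) = 0" unfolding p_Cons by auto
        then show "conc (g x) (ev (\<lambda>v. p (x # v))) = 0" by (simp only: eval_hom_zero conc_zero_right)
      qed
    qed (use finite_X Y in auto)
    also have "\<dots> = b"
      unfolding b
    proof (rule sum.cong[OF refl])
      fix x assume x: "x \<in> Y"
      then have "(\<lambda>v. p (x # v)) = q x" unfolding p_Cons by auto
      then show "conc (g x) (ev (\<lambda>v. p (x # v))) = conc (g x) (c x)" by (simp only: q(2)[OF x])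
    qed
    finally show ?thesis using p by blast
  qed
qed

theorem freely_generated_B_alg: "freely_generated (B_alg m) X g"
  unfolding freely_generated_def
proof (intro conjI)
  show "subalgebra_conc (B_alg m)" by (rule subalgebra_B_alg)
  show "g ` X \<subseteq> B_alg m" using g_ker ker_sigma_B_alg by blast
  show "bij_betw ev (free_alg X) (B_alg m)"
    unfolding bij_betw_def
  proof
    show "inj_on ev (free_alg X)"
    proof (rule inj_onI)
      fix p q assume p: "p \<in> free_alg X" and q: "q \<in> free_alg X" and eq: "ev p = ev q"
      have "ev (p - q) = 0" unfolding eval_hom_diff[OF p q] eq by simp
      from ev_kernel[OF free_alg_diff[OF p q] this] show "p = q" by simp
    qed
    show "ev ` free_alg X = B_alg m"
    proof (intro equalityI subsetI)
      fix f assume "f \<in> ev ` free_alg X"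
      then show "f \<in> B_alg m" using ev_B_alg by blast
    next
      fix f assume f: "f \<in> B_alg m"
      obtain N where N: "f = (\<Sum>n\<le>N. component n f)" by (rule B_alg_components[OF f])
      have "\<forall>n. \<exists>p\<in>free_alg X. ev p = component n f"
        using ev_surj_homogeneous B_alg_component[OF f] by blast
      then obtain q where q: "\<And>n. q n \<in> free_alg X" "\<And>n. ev (q n) = component n f" by metis
      have "(\<Sum>n\<le>N. q n) \<in> free_alg X \<and> ev (\<Sum>n\<le>N. q n) = (\<Sum>n\<le>N. ev (q n))"
        by (rule eval_hom_sum_free) (rule q(1))
      moreover have "(\<Sum>n\<le>N. ev (q n)) = f" using N q(2) by simp
      ultimately show "f \<in> ev ` free_alg X" by (metis image_eqI)
    qed
  qed
qed

end


section \<open>Counting the generators\<close>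

text \<open>The tensor v_i [A] has degree |A| + 1, and |A| \<le> m holds for every subset, so
  \<open>gen_pairs m m\<close> contains all generators.\<close>

definition deg_gens :: "nat \<Rightarrow> nat \<Rightarrow> (nat \<times> nat set) set" where
  "deg_gens m i = {x \<in> gen_pairs m m. Suc (card (snd x)) = i}"

lemma card_nsubsets: "card (nsubsets m n) = m choose n"
  using n_subsets[of "{1..m}" n] by (simp add: nsubsets_def)

lemma subsets_le_full: "A \<in> subsets_le m m \<longleftrightarrow> A \<subseteq> {1..m}"
proof -
  have "card A \<le> m" if "A \<subseteq> {1..m}" using card_mono[OF _ that] by simp
  then show ?thesis by (auto simp: subsets_le_def)
qed

lemma gen_pairs_deg: "gen_pairs m n = {x \<in> gen_pairs m m. Suc (card (snd x)) \<le> Suc n}"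
proof -
  have "A \<in> subsets_le m n \<longleftrightarrow> A \<in> subsets_le m m \<and> Suc (card A) \<le> Suc n" for A
    unfolding subsets_le_full by (simp add: subsets_le_def)
  then show ?thesis unfolding gen_pairs_def letter_pairs_def mem_Times_iff by blast
qed

lemma gen_pairs_deg_bounds:
  assumes "x \<in> gen_pairs m m"
  shows "2 \<le> Suc (card (snd x))" "Suc (card (snd x)) \<le> m + 1"
proof -
  have x: "snd x \<in> subsets_le m m" "\<not> low x" using assms by (auto simp: gen_pairs_def letter_pairs_def)
  have "snd x \<noteq> {}" using x(2) by (auto simp: low_def)
  then show "2 \<le> Suc (card (snd x))" using subsets_le_finite[OF x(1)] by (cases "card (snd x)") auto
  show "Suc (card (snd x)) \<le> m + 1" using x(1) by (simp add: subsets_le_def)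
qed

text \<open>There are m (m choose n) pairs with |A| = n, and by \<open>ins\<close> the low ones
  correspond to the subsets with n + 1 elements. The additive form avoids truncated
  subtraction.\<close>

lemma card_deg_gens: "card (deg_gens m (Suc n)) + (m choose Suc n) = m * (m choose n)"
proof -
  let ?P = "{1..m} \<times> nsubsets m n"
  let ?L = "{x \<in> ?P. low x}"
  have P: "x \<in> ?P \<longleftrightarrow> x \<in> letter_pairs m m \<and> card (snd x) = n" for x
    unfolding letter_pairs_def mem_Times_iff subsets_le_full by (auto simp: nsubsets_def)
  have "bij_betw ins ?L (nsubsets m (Suc n))"
    unfolding bij_betw_def
  proof
    show "inj_on ins ?L"
    proof (rule inj_onI)
      fix x y assume "x \<in> ?L" "y \<in> ?L" "ins x = ins y"
      then show "x = y" using P by (intro ins_inject) (auto intro: letter_pairs_finite)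
    qed
    show "ins ` ?L = nsubsets m (Suc n)"
    proof (intro equalityI subsetI)
      fix B assume "B \<in> ins ` ?L"
      then obtain x where x: "x \<in> letter_pairs m m" "low x" "card (snd x) = n" "B = ins x" using P by blast
      from ins_nonempty_le[OF x(1,2)] show "B \<in> nsubsets m (Suc n)"
        using x(3,4) by (simp add: nsubsets_def nonempty_le_def subsets_le_def)
    next
      fix B assume B: "B \<in> nsubsets m (Suc n)"
      then have "B \<in> nonempty_le m (Suc m)"
        using subsets_le_full[of B m] by (auto simp: nsubsets_def nonempty_le_def subsets_le_def)
      then obtain x where x: "x \<in> letter_pairs m m" "low x" "ins x = B" using nonempty_le_ins by blast
      have "card (snd x) = n" using ins_nonempty_le(2)[OF x(1,2)] x(3) B by (simp add: nsubsets_def)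
      then show "B \<in> ins ` ?L" using x P by blast
    qed
  qed
  then have L: "card ?L = m choose Suc n" unfolding card_nsubsets[symmetric] by (rule bij_betw_same_card)
  have gens: "deg_gens m (Suc n) = ?P - ?L"
    using P by (auto simp: deg_gens_def gen_pairs_def)
  have sub: "?L \<subseteq> ?P" and fin: "finite ?P" by auto
  have "card (?P - ?L) + card ?L = card ?P"
    using card_Diff_subset[OF finite_subset[OF sub fin] sub] card_mono[OF fin sub] by linarith
  moreover have "card ?P = m * (m choose n)"
    by (simp only: card_cartesian_product card_nsubsets card_atLeastAtMost diff_Suc_1)
  ultimately show ?thesis unfolding gens L by (simp only:)
qed

lemma coeff_one_plus_X_power: "poly.coeff ([:1, 1:] ^ m) i = (of_nat (m choose i) :: 'a :: comm_semiring_1)"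
proof (cases "i \<le> m")
  case True
  then show ?thesis using coeff_linear_poly_power[of i m "1::'a" 1] by simp
next
  case False
  have "degree ([:1, 1:] ^ m :: 'a poly) \<le> m"
    using degree_power_le[of "[:1, 1:] :: 'a poly" m] by simp
  then show ?thesis using False by (simp add: coeff_eq_0 binomial_eq_0)
qed

text \<open>The coefficient of q^(n+1) in (1 - m q) (1 + q)^m is (m choose n + 1) - m (m choose n),
  the negative of the number of generators found in \<open>card_deg_gens\<close>.\<close>

lemma deg_gens_generating_function:
  "1 - (\<Sum>i = 2..m + 1. Polynomial.monom (int (card (deg_gens m i))) i) = [:1, - int m:] * [:1, 1:] ^ m"
proof (rule poly_eqI)
  fix k
  \<comment> \<open>The sum over 2 \<le> i \<le> m + 1 thus misses no generators.\<close>
  have empty: "deg_gens m i = {}" if "i < 2 \<or> m + 1 < i" for i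
  proof (rule equals0I)
    fix x assume "x \<in> deg_gens m i"
    then have "x \<in> gen_pairs m m" "Suc (card (snd x)) = i" by (simp_all add: deg_gens_def)
    with gen_pairs_deg_bounds[of x m] that show False by linarith
  qed
  have "poly.coeff (\<Sum>i = 2..m + 1. Polynomial.monom (int (card (deg_gens m i))) i) k
      = int (card (deg_gens m k))"
  proof (cases "k \<in> {2..m + 1}")
    case True
    then show ?thesis by (simp add: coeff_sum coeff_monom sum.delta)
  next
    case False
    then have "deg_gens m k = {}" using empty[of k] by auto
    moreover have "(\<Sum>i = 2..m + 1. poly.coeff (Polynomial.monom (int (card (deg_gens m i))) i) k) = 0"
      using False by (intro sum.neutral) auto
    ultimately show ?thesis by (simp only: coeff_sum card.empty of_nat_0)
  qed
  moreover have "poly.coeff ([:1, - int m:] * [:1, 1:] ^ m) k = poly.coeff 1 k - int (card (deg_gens m k))"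
  proof (cases k)
    case 0
    then show ?thesis using empty[of 0] by (simp add: coeff_one_plus_X_power)
  next
    case (Suc n)
    have "int (card (deg_gens m (Suc n))) + int (m choose Suc n) = int m * int (m choose n)"
      using card_deg_gens[of m n] by (metis of_nat_add of_nat_mult)
    then show ?thesis using Suc by (simp add: coeff_pCons coeff_one_plus_X_power)
  qed
  ultimately show "poly.coeff (1 - (\<Sum>i = 2..m + 1. Polynomial.monom (int (card (deg_gens m i))) i)) k
      = poly.coeff ([:1, - int m:] * [:1, 1:] ^ m) k" by simp
qed

text \<open>The pairs of each degree i are numbered by j < b i; existence and uniqueness of
  expansions are carried along this numbering, which matches the two index sets for every bound on
  the degree.\<close>

lemma B_alg_free:
  fixes m :: nat
  defines "b \<equiv> \<lambda>i. card (deg_gens m i)"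
  shows "\<exists>g :: nat \<times> nat \<Rightarrow> nat list \<Rightarrow> ratfun.
    (\<forall>i\<in>{2..m + 1}. \<forall>j<b i. g (i, j) \<in> ker_sigma m i) \<and>
    freely_generated (B_alg m) {(i, j). i \<in> {2..m + 1} \<and> j < b i} g"
proof -
  define X where "X = {(i, j). i \<in> {2..m + 1} \<and> j < b i}"
  have "finite (deg_gens m i)" for i by (simp add: deg_gens_def)
  then have "\<exists>h. bij_betw h {0..<b i} (deg_gens m i)" for i
    unfolding b_def by (rule ex_bij_betw_nat_finite)
  then obtain h where h: "\<And>i. bij_betw (h i) {0..<b i} (deg_gens m i)" by metis
  define e where "e x = h (fst x) (snd x)" for x
  define g where "g x = gen m (e x)" for x
  have e_in: "e x \<in> gen_pairs m m \<and> Suc (card (snd (e x))) = fst x" if "x \<in> X" for x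
  proof -
    have "snd x \<in> {0..<b (fst x)}" using that by (auto simp: X_def)
    then have "e x \<in> deg_gens m (fst x)" using bij_betw_apply[OF h] by (simp add: e_def)
    then show ?thesis by (simp add: deg_gens_def)
  qed
  have e_inj: "inj_on e X"
  proof (rule inj_onI)
    fix x y assume xy: "x \<in> X" "y \<in> X" "e x = e y"
    then have fst: "fst x = fst y" using e_in by metis
    have "h (fst x) (snd x) = h (fst x) (snd y)" using xy(3) fst by (simp add: e_def)
    moreover have "snd x \<in> {0..<b (fst x)}" "snd y \<in> {0..<b (fst x)}" using xy fst by (auto simp: X_def)
    ultimately have "snd x = snd y" using bij_betw_imp_inj_on[OF h] by (rule inj_onD[rotated])
    with fst show "x = y" by (rule prod_eqI)
  qed
  have e_surj: "\<exists>x\<in>X. e x = z" if "z \<in> gen_pairs m m" for z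
  proof -
    let ?i = "Suc (card (snd z))"
    have "z \<in> deg_gens m ?i" using that by (simp add: deg_gens_def)
    then have "z \<in> h ?i ` {0..<b ?i}" using bij_betw_imp_surj_on[OF h[of ?i]] by simp
    then obtain j where "j < b ?i" "h ?i j = z" by auto
    moreover have "?i \<in> {2..m + 1}" using gen_pairs_deg_bounds[OF that] by simp
    ultimately show ?thesis by (intro bexI[of _ "(?i, j)"]) (simp_all add: X_def e_def)
  qed
  have e_bij: "bij_betw e {x \<in> X. fst x \<le> Suc n} (gen_pairs m n)" for n
    unfolding bij_betw_def
  proof
    show "inj_on e {x \<in> X. fst x \<le> Suc n}" using e_inj by (rule inj_on_subset) blast
    show "e ` {x \<in> X. fst x \<le> Suc n} = gen_pairs m n"
    proof (intro equalityI subsetI)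
      fix z assume "z \<in> e ` {x \<in> X. fst x \<le> Suc n}"
      then obtain x where "x \<in> X" "fst x \<le> Suc n" "z = e x" by blast
      with e_in[of x] show "z \<in> gen_pairs m n" by (subst gen_pairs_deg) simp
    next
      fix z assume "z \<in> gen_pairs m n"
      then have z: "z \<in> gen_pairs m m" "Suc (card (snd z)) \<le> Suc n" by (subst (asm) gen_pairs_deg, simp)+
      then obtain x where x: "x \<in> X" "e x = z" using e_surj by blast
      then have "fst x \<le> Suc n" using e_in[OF x(1)] z(2) by simp
      with x show "z \<in> e ` {x \<in> X. fst x \<le> Suc n}" by blast
    qed
  qed
  have g_ker: "g x \<in> ker_sigma m (fst x)" if "x \<in> X" for x
    using e_in[OF that] gen_props(1)[OF gen_pairs_letter, of "e x" m m] by (simp add: g_def)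
  interpret kernel_generators m X fst g
  proof
    have "X = Sigma {2..m + 1} (\<lambda>i. {..<b i})" by (auto simp: X_def)
    then show "finite X" by simp
    show "0 < fst x" if "x \<in> X" for x using that by (auto simp: X_def)
    show "g x \<in> ker_sigma m (fst x)" if "x \<in> X" for x by (rule g_ker[OF that])
  next
    fix n f assume "f \<in> ker_sigma m (Suc n)"
    then obtain c where c: "\<forall>z\<in>gen_pairs m n. c z \<in> ker_sigma m (n - card (snd z))"
      and f: "f = (\<Sum>z\<in>gen_pairs m n. conc (gen m z) (c z))"
      using gen_expand by blast
    have "c (e x) \<in> ker_sigma m (Suc n - fst x)" if x: "x \<in> {x \<in> X. fst x \<le> Suc n}" for x
    proof -
      have "e x \<in> gen_pairs m n" using bij_betw_apply[OF e_bij x] .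
      then have "c (e x) \<in> ker_sigma m (n - card (snd (e x)))" using c by blast
      moreover have "Suc n - fst x = n - card (snd (e x))" using e_in[of x] x by auto
      ultimately show ?thesis by simp
    qed
    moreover have "f = (\<Sum>x\<in>{x \<in> X. fst x \<le> Suc n}. conc (g x) (c (e x)))"
      unfolding f g_def by (rule sum.reindex_bij_betw[OF e_bij, symmetric])
    ultimately show "\<exists>c. (\<forall>x\<in>{x \<in> X. fst x \<le> Suc n}. c x \<in> ker_sigma m (Suc n - fst x)) \<and>
        f = (\<Sum>x\<in>{x \<in> X. fst x \<le> Suc n}. conc (g x) (c x))"
      by (intro exI[of _ "\<lambda>x. c (e x)"]) blast
  next
    fix n c x
    let ?Y = "{x \<in> X. fst x \<le> Suc n}"
    assume c: "\<And>x. x \<in> ?Y \<Longrightarrow> c x \<in> ker_sigma m (Suc n - fst x)"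
      and sum0: "(\<Sum>x\<in>?Y. conc (g x) (c x)) = 0" and x: "x \<in> ?Y"
    \<comment> \<open>Carries a coefficient family indexed by (i, j) back to the pairs, for which
      \<open>gen_independent\<close> is stated.\<close>
    define e' where "e' = the_inv_into ?Y e"
    have e': "e' (e y) = y" if "y \<in> ?Y" for y
      unfolding e'_def by (rule the_inv_into_f_f[OF bij_betw_imp_inj_on[OF e_bij] that])
    have "c (e' (e x)) = 0"
    proof (rule gen_independent[of m n "\<lambda>z. c (e' z)"])
      fix z assume "z \<in> gen_pairs m n"
      then have "z \<in> e ` ?Y" using bij_betw_imp_surj_on[OF e_bij] by simp
      then obtain y where y: "y \<in> ?Y" "z = e y" by blast
      have "Suc n - fst y = n - card (snd (e y))" using e_in[of y] y(1) by auto
      then show "c (e' z) \<in> ker_sigma m (n - card (snd z))" using c[OF y(1)] e'[OF y(1)] y(2) by simp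
    next
      have "(\<Sum>z\<in>gen_pairs m n. conc (gen m z) (c (e' z))) = (\<Sum>y\<in>?Y. conc (g y) (c (e' (e y))))"
        unfolding g_def by (rule sum.reindex_bij_betw[OF e_bij, symmetric])
      also have "\<dots> = (\<Sum>y\<in>?Y. conc (g y) (c y))" by (rule sum.cong[OF refl]) (simp only: e')
      finally show "(\<Sum>z\<in>gen_pairs m n. conc (gen m z) (c (e' z))) = 0" using sum0 by simp
      show "e x \<in> gen_pairs m n" using bij_betw_apply[OF e_bij x] .
    qed
    then show "c x = 0" by (simp only: e'[OF x])
  qed
  have "freely_generated (B_alg m) X g" by (rule freely_generated_B_alg)
  moreover have "\<forall>i\<in>{2..m + 1}. \<forall>j<b i. g (i, j) \<in> ker_sigma m i"
    using g_ker by (auto simp: X_def)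
  ultimately show ?thesis unfolding X_def by blast
qed

theorem theorem1p1:
  fixes m :: nat
    and scale :: "ratfun \<Rightarrow> 'a::ab_group_add \<Rightarrow> 'a"
    and RM :: "(nat list \<Rightarrow> 'a) \<Rightarrow> 'a"
  assumes "m \<ge> 1" and "yb_module scale m RM"
  shows
    "cplx_iso (yb_complex m scale RM) (tensor_graded (finite_complex m scale RM) (B_graded m)) \<and>
     is_cplx (finite_complex m scale RM) \<and>
     (\<forall>n>m. carrier (fst (finite_complex m scale RM) n) = {0}) \<and>
     cplx_iso (finite_complex m scale RM) (M_tensor_koszul m scale RM) \<and>
     (\<exists>b :: nat \<Rightarrow> nat.
        1 - (\<Sum>i = 2..m + 1. Polynomial.monom (int (b i)) i) = [:1, - int m:] * [:1, 1:] ^ m \<and>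
        (\<exists>g :: nat \<times> nat \<Rightarrow> nat list \<Rightarrow> ratfun.
           (\<forall>i\<in>{2..m + 1}. \<forall>j<b i. g (i, j) \<in> ker_sigma m i) \<and>
           freely_generated (B_alg m) {(i, j). i \<in> {2..m + 1} \<and> j < b i} g))"
proof -
  interpret yb_module scale m RM by (rule assms(2))
  have "\<forall>n>m. carrier (fst (finite_complex m scale RM) n) = {0}"
    using alt_tens_trivial by (simp add: finite_complex_def mk_module_def M_bracket_eq)
  then show ?thesis
    by (intro conjI exI[of _ "\<lambda>i. card (deg_gens m i)"] yb_complex_iso is_cplx_finite koszul_iso
        deg_gens_generating_function B_alg_free)
qed

end
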